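(* Let $G=(V,E)$ be a graph such that $|V|$ is even, and let $\mathbf{M}(G):=\{\chi_M: M \text{ a perfect matching of } G\}\subseteq\{0,1\}^E$. Then $\mathbf{M}(G)$ is a dyadic generating set for a cone.
   Context: A perfect matching is a set $M\subseteq E$ such that every vertex is incident with exactly one edge of $M$; $\chi_M$ denotes its incidence vector. A dyadic rational is a number $a/2^k$ with $a,k\in\mathbb{Z}$, $k\ge0$. A finite set $S$ of integral vectors is a dyadic generating set for a cone if every integral vector in the conic hull of $S$ is a conic combination of the elements of $S$ with dyadic coefficients (if $S$ is empty its conic hull is $\{\mathbf 0\}$). *)

theory Defs
  imports Complex_Main
begin

text \<open>A (multi)graph: finite vertex set V, finite edge set E, each edge e has a
  2-element set of endpoints ends e contained in V (parallel edges allowed, no loops).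
  Vectors in R^E are modelled as functions 'e => real (zero outside E for the vectors we use).\<close>

definition graph :: "'v set \<Rightarrow> 'e set \<Rightarrow> ('e \<Rightarrow> 'v set) \<Rightarrow> bool" where
  "graph V E ends \<longleftrightarrow> finite V \<and> finite E \<and>
     (\<forall>e\<in>E. ends e \<subseteq> V \<and> card (ends e) = 2)"

definition perfect_matching :: "'v set \<Rightarrow> 'e set \<Rightarrow> ('e \<Rightarrow> 'v set) \<Rightarrow> 'e set \<Rightarrow> bool" where
  "perfect_matching V E ends M \<longleftrightarrow> M \<subseteq> E \<and>
     (\<forall>v\<in>V. card {e\<in>M. v \<in> ends e} = 1)"

definition incidence_vector :: "'e set \<Rightarrow> 'e \<Rightarrow> real" where
  "incidence_vector M = (\<lambda>e. if e \<in> M then 1 else 0)"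

definition perfect_matching_vectors :: "'v set \<Rightarrow> 'e set \<Rightarrow> ('e \<Rightarrow> 'v set) \<Rightarrow> ('e \<Rightarrow> real) set" where
  "perfect_matching_vectors V E ends =
     {incidence_vector M | M. perfect_matching V E ends M}"

definition dyadic :: "real \<Rightarrow> bool" where
  "dyadic r \<longleftrightarrow> (\<exists>(a::int) (k::nat). r = of_int a / 2 ^ k)"

definition integral_vec :: "('e \<Rightarrow> real) \<Rightarrow> bool" where
  "integral_vec x \<longleftrightarrow> (\<forall>e. x e \<in> \<int>)"

definition conic_hull_fin :: "('e \<Rightarrow> real) set \<Rightarrow> ('e \<Rightarrow> real) set" where
  "conic_hull_fin S = {x. \<exists>c. (\<forall>s\<in>S. c s \<ge> 0) \<and> x = (\<lambda>e. \<Sum>s\<in>S. c s * s e)}"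

definition dyadic_generating_set :: "('e \<Rightarrow> real) set \<Rightarrow> bool" where
  "dyadic_generating_set S \<longleftrightarrow> finite S \<and> (\<forall>s\<in>S. integral_vec s) \<and>
     (\<forall>x. integral_vec x \<and> x \<in> conic_hull_fin S \<longrightarrow>
        (\<exists>c. (\<forall>s\<in>S. c s \<ge> 0 \<and> dyadic (c s)) \<and> x = (\<lambda>e. \<Sum>s\<in>S. c s * s e)))"

end

theory Submission
  imports Defs
begin

text \<open>
  By induction on the number of vertices and edges one shows that every dyadic vector \<open>x\<close> satisfying
  Edmonds' inequalities (nonnegative, equal degrees, every odd cut at least the degree) is a nonnegative
  dyadic combination of perfect matchings; Edmonds' theorem comes out along the way. If an edge has weight
  zero, delete it; if a nontrivial odd cut is tight, contract its two sides and glue the decompositions,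
  which only needs subtractions. So \<open>x\<close> may be taken in the interior of the cone, and all dyadic boundary
  points are decomposable by induction. For a facet with defining functional \<open>\<phi>\<close>, the dyadic kernel
  vectors of \<open>\<phi>\<close> are then signed dyadic combinations of matchings, hence so is \<open>x\<close> as soon as \<open>\<phi>\<close> takes one
  of the values 1, 2, 4 on some perfect matching; by density of the dyadic numbers, signed combinations
  suffice.

  If a facet is defined by an edge, the value 1 occurs. Otherwise let \<open>U\<close> be a smallest odd set whose cut
  defines a facet. If some nonzero vector on the edges inside \<open>U\<close> has all degrees zero, moving along it
  reaches a second facet, and uncrossing contradicts the choice of \<open>U\<close>. Otherwise \<open>U\<close> induces an odd cycle.
  Which sets of vertices of \<open>U\<close> can be joined to the outside by a matching covering the outside is a family
  closed under the exchanges along alternating paths, and this forces a perfect matching that crosses the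
  cut of \<open>U\<close> in exactly 3 or 5 edges, so \<open>\<phi>\<close> takes the value 2 or 4.
\<close>

subsection \<open>Dyadic rationals and small steps\<close>

text \<open>The obstacle is an odd factor in a denominator. Taking a multiple of a matching
  \<open>M\<close> off \<open>x\<close> so that the rest lies in the kernel of \<phi> needs the
  coefficient \<phi>(x) / \<phi>(M). For a cut, \<phi>(M) is the number of crossing edges minus 1,
  so 3 or 5 crossing edges mean division by 2 or 4, while 7 would mean division by 6. Even for
  integral \<open>x\<close> the rest is then only dyadic; this is why the induction ranges over
  dyadic vectors. A kernel vector on a facet is a difference of two boundary points: a large
  integral multiple of a point whose only tight constraints are those of the facet absorbs it. Such
  multiples rely on common denominators, so the work is done over the rationals; real coefficients
  occur only in the final theorem, where they serve to verify Edmonds' inequalities. The exchange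
  property used for the cycle is the simultaneous symmetric exchange known from even
  delta-matroids.\<close>

definition qdyadic :: "rat \<Rightarrow> bool" where
  "qdyadic r \<longleftrightarrow> (\<exists>(a::int) (k::nat). r = of_int a / 2 ^ k)"

lemma qdyadic_of_int [simp, intro]: "qdyadic (of_int a)"
  unfolding qdyadic_def by (intro exI[of _ a] exI[of _ 0]) simp

lemma qdyadic_0 [simp]: "qdyadic 0" and qdyadic_1 [simp]: "qdyadic 1"
  using qdyadic_of_int[of 0] qdyadic_of_int[of 1] by auto

lemma qdyadic_add [intro]:
  assumes "qdyadic x" "qdyadic y"
  shows "qdyadic (x + y)"
proof -
  obtain a k b l where xy: "x = of_int a / 2 ^ k" "y = of_int b / 2 ^ l"
    using assms unfolding qdyadic_def by blast
  have "x + y = of_int (a * 2 ^ l + b * 2 ^ k) / 2 ^ (k + l)"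
    unfolding xy by (simp add: field_simps power_add)
  thus ?thesis unfolding qdyadic_def by blast
qed

lemma qdyadic_mult [intro]:
  assumes "qdyadic x" "qdyadic y"
  shows "qdyadic (x * y)"
proof -
  obtain a k b l where xy: "x = of_int a / 2 ^ k" "y = of_int b / 2 ^ l"
    using assms unfolding qdyadic_def by blast
  have "x * y = of_int (a * b) / 2 ^ (k + l)"
    unfolding xy by (simp add: power_add)
  thus ?thesis unfolding qdyadic_def by blast
qed

lemma qdyadic_uminus [intro]: "qdyadic x \<Longrightarrow> qdyadic (- x)"
  using qdyadic_mult[of "-1" x] qdyadic_of_int[of "-1"] by simp

lemma qdyadic_diff [intro]: "qdyadic x \<Longrightarrow> qdyadic y \<Longrightarrow> qdyadic (x - y)"
  using qdyadic_add[of x "- y"] qdyadic_uminus[of y] by simp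

lemma qdyadic_inverse_power: "qdyadic (1 / 2 ^ k)"
  unfolding qdyadic_def by (intro exI[of _ 1] exI[of _ k]) simp

lemma qdyadic_sum [intro]: "(\<And>i. i \<in> A \<Longrightarrow> qdyadic (f i)) \<Longrightarrow> qdyadic (sum f A)"
  by (induction A rule: infinite_finite_induct) auto

lemma qdyadic_div2: "qdyadic x \<Longrightarrow> qdyadic (x / 2)"
  using qdyadic_mult[of x "1/2"] qdyadic_inverse_power[of 1] by simp

lemma qdyadic_div4: "qdyadic x \<Longrightarrow> qdyadic (x / 4)"
  using qdyadic_mult[of x "1/4"] qdyadic_inverse_power[of 2] by simp

lemma common_denominator:
  fixes d :: "'a \<Rightarrow> rat"
  assumes "finite A"
  shows "\<exists>q::nat. q > 0 \<and> (\<forall>i\<in>A. of_nat q * d i \<in> \<int>)"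
  using assms
proof (induction A)
  case (insert i A)
  then obtain q :: nat where q: "q > 0" "\<forall>i\<in>A. of_nat q * d i \<in> \<int>" by blast
  obtain a b where ab: "d i = of_int a / of_int b" "b > 0"
    by (metis quotient_of_denom_pos quotient_of_div surj_pair)
  have "of_nat (q * nat b) * d i = of_nat q * of_int a"
    using ab by (simp add: field_simps)
  moreover have "of_nat (q * nat b) * d j \<in> \<int>" if "j \<in> A" for j
  proof -
    have "of_nat (q * nat b) * d j = of_nat (nat b) * (of_nat q * d j)" by simp
    thus ?thesis using q(2) that by (metis Ints_mult Ints_of_nat)
  qed
  ultimately have "\<forall>j\<in>insert i A. of_nat (q * nat b) * d j \<in> \<int>"
    by (metis Ints_mult Ints_of_int Ints_of_nat insertE)
  thus ?case using q(1) ab(2) by (metis nat_0_less_mult_iff zero_less_nat_eq)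
qed (auto intro: exI[of _ 1])

lemma uniform_small_step:
  fixes f g :: "'k \<Rightarrow> rat"
  assumes "finite A" "\<And>k. k \<in> A \<Longrightarrow> f k > 0"
  shows "\<exists>\<epsilon>>0. \<epsilon> \<le> 1 \<and> (\<forall>k\<in>A. f k + \<epsilon> * g k > 0)"
  using assms
proof (induction A)
  case (insert k A)
  then obtain \<epsilon> where e: "\<epsilon> > 0" "\<epsilon> \<le> 1" "\<forall>k\<in>A. f k + \<epsilon> * g k > 0" by auto
  \<comment> \<open>The factor 2 keeps \<open>f k + \<delta> * g k\<close> strictly positive, and
    the summand 1 covers the case \<open>g k = 0\<close>.\<close>
  define \<delta> where "\<delta> = min \<epsilon> (f k / (2 * (\<bar>g k\<bar> + 1)))"
  have fk: "f k > 0" using insert.prems by simp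
  have d: "\<delta> > 0" "\<delta> \<le> \<epsilon>" using e fk by (auto simp: \<delta>_def)
  have "f j + \<delta> * g j > 0" if j: "j \<in> A" for j
  proof (cases "g j \<ge> 0")
    case True
    thus ?thesis using insert.prems[of j] j d by (simp add: add_pos_nonneg)
  next
    case False
    hence "\<delta> * g j \<ge> \<epsilon> * g j" using d by (simp add: mult_right_mono_neg)
    thus ?thesis using e(3) j by force
  qed
  moreover have "f k + \<delta> * g k > 0"
  proof -
    have "\<delta> * \<bar>g k\<bar> \<le> f k / (2 * (\<bar>g k\<bar> + 1)) * \<bar>g k\<bar>"
      by (rule mult_right_mono) (auto simp: \<delta>_def)
    also have "\<dots> = f k * (\<bar>g k\<bar> / (2 * (\<bar>g k\<bar> + 1)))" by simp
    also have "\<dots> < f k * 1"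
    proof (rule mult_strict_left_mono[OF _ fk])
      have "0 < 2 * (\<bar>g k\<bar> + 1)" "\<bar>g k\<bar> < 2 * (\<bar>g k\<bar> + 1)" by simp_all
      thus "\<bar>g k\<bar> / (2 * (\<bar>g k\<bar> + 1)) < 1" by (simp only: divide_less_eq_1_pos)
    qed
    finally have "\<delta> * \<bar>g k\<bar> < f k" by simp
    moreover have "\<delta> * g k \<ge> - (\<delta> * \<bar>g k\<bar>)"
      using d by (metis abs_ge_minus_self abs_mult abs_of_pos minus_le_iff)
    ultimately show ?thesis by linarith
  qed
  ultimately show ?case using d e(2) by (intro exI[of _ \<delta>]) auto
qed (auto intro: exI[of _ 1])

text \<open>Multiplying the kernel vector \<open>b - c\<close> by a dyadic number close to 1 that clears its
  denominators turns the signed solution \<open>c\<close> into a nonnegative one.\<close>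

lemma nonneg_dyadic_combination:
  fixes v :: "'i \<Rightarrow> 'e \<Rightarrow> rat" and b c :: "'i \<Rightarrow> rat"
  assumes fin: "finite A"
    and b: "\<And>i. i \<in> A \<Longrightarrow> b i > 0"
    and c: "\<And>i. i \<in> A \<Longrightarrow> qdyadic (c i)"
    and eq: "\<And>e. (\<Sum>i\<in>A. b i * v i e) = (\<Sum>i\<in>A. c i * v i e)"
  shows "\<exists>a. (\<forall>i\<in>A. a i \<ge> 0 \<and> qdyadic (a i)) \<and>
    (\<forall>e. (\<Sum>i\<in>A. a i * v i e) = (\<Sum>i\<in>A. c i * v i e))"
proof -
  define d where "d i = b i - c i" for i
  obtain q :: nat where q: "q > 0" "\<forall>i\<in>A. of_nat q * d i \<in> \<int>"
    using common_denominator[OF fin] by blast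
  obtain \<epsilon> where e: "\<epsilon> > 0" "\<epsilon> \<le> 1" "\<forall>i\<in>A. b i + \<epsilon> * (- \<bar>d i\<bar>) > 0"
    using uniform_small_step[OF fin, of b "\<lambda>i. - \<bar>d i\<bar>"] b by blast
  obtain j :: nat where j: "of_nat q / \<epsilon> < 2 ^ j"
    using reals_Archimedean2[of "of_nat q / \<epsilon>"] by (metis less_trans of_nat_less_two_power)
  \<comment> \<open>\<open>s\<close> is the largest multiple of \<open>q / 2 ^ j\<close> that is at
    most 1. By the choice of \<open>j\<close> it lies within \<epsilon> of 1, and its factor
    \<open>q\<close> clears the denominators of \<open>d\<close>.\<close>
  define m where "m = \<lfloor>(2 ^ j :: rat) / of_nat q\<rfloor>"
  define s where "s = of_nat q * of_int m / (2 ^ j :: rat)"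
  have q0: "(of_nat q :: rat) > 0" using q(1) by simp
  have m: "of_int m \<le> (2 ^ j :: rat) / of_nat q" "(2 ^ j :: rat) / of_nat q < of_int m + 1"
    unfolding m_def by (rule of_int_floor_le, rule floor_correct[THEN conjunct2, simplified])
  have "s \<le> 1" using m(1) q0 by (simp add: s_def field_simps)
  moreover have "1 - \<epsilon> \<le> s"
  proof -
    have "(2 ^ j :: rat) - of_nat q \<le> of_nat q * of_int m" using m(2) q0 by (simp add: field_simps)
    moreover have "of_nat q \<le> \<epsilon> * 2 ^ j" using j e(1) by (simp add: field_simps)
    ultimately have "(2 ^ j :: rat) - \<epsilon> * 2 ^ j \<le> of_nat q * of_int m" by linarith
    thus ?thesis by (simp add: s_def field_simps)
  qed
  ultimately have s: "\<bar>s - 1\<bar> \<le> \<epsilon>" by linarith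
  have "c i + s * d i \<ge> 0" if "i \<in> A" for i
  proof -
    have "\<bar>(s - 1) * d i\<bar> \<le> \<epsilon> * \<bar>d i\<bar>"
      using s by (simp add: abs_mult mult_right_mono)
    moreover have "b i - \<epsilon> * \<bar>d i\<bar> > 0" using e(3) that by fastforce
    moreover have "c i + s * d i = b i + (s - 1) * d i" by (simp add: d_def algebra_simps)
    ultimately show ?thesis by linarith
  qed
  moreover have "qdyadic (c i + s * d i)" if "i \<in> A" for i
  proof -
    have "s * d i = (of_nat q * d i) * (of_int m * (1 / 2 ^ j))" by (simp add: s_def)
    moreover have "qdyadic (of_nat q * d i)" using q(2) that by (metis Ints_cases qdyadic_of_int)
    ultimately show ?thesis using c[OF that] qdyadic_inverse_power by (metis qdyadic_add qdyadic_mult qdyadic_of_int)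
  qed
  moreover have "(\<Sum>i\<in>A. (c i + s * d i) * v i e) = (\<Sum>i\<in>A. c i * v i e)" for e
  proof -
    have "(\<Sum>i\<in>A. d i * v i e) = 0"
      using eq[of e] by (simp add: d_def left_diff_distrib sum_subtractf)
    moreover have "(\<Sum>i\<in>A. (c i + s * d i) * v i e) = (\<Sum>i\<in>A. c i * v i e) + s * (\<Sum>i\<in>A. d i * v i e)"
      by (simp add: algebra_simps sum.distrib sum_distrib_left)
    ultimately show ?thesis by simp
  qed
  ultimately show ?thesis by (intro exI[of _ "\<lambda>i. c i + s * d i"]) auto
qed

subsection \<open>Homogeneous linear systems\<close>

text \<open>Gaussian elimination: an equation that is not identically zero is solved for the unknown
  \<open>i0\<close> and substituted into the others, which removes one equation and one
  unknown.\<close>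

lemma underdetermined_system:
  fixes a :: "'b \<Rightarrow> 'i \<Rightarrow> rat"
  assumes "finite B" "finite A" "card B < card A"
  shows "\<exists>z. (\<exists>i\<in>A. z i \<noteq> 0) \<and> (\<forall>i. i \<notin> A \<longrightarrow> z i = 0) \<and> (\<forall>b\<in>B. (\<Sum>i\<in>A. a b i * z i) = 0)"
  using assms
proof (induction B arbitrary: A a)
  case empty
  then obtain i where "i \<in> A" by (metis card.empty less_nat_zero_code all_not_in_conv)
  thus ?case by (intro exI[of _ "\<lambda>j. if j = i then 1 else 0"]) auto
next
  case (insert b B)
  show ?case
  proof (cases "\<forall>i\<in>A. a b i = 0")
    case True
    have "card B < card A" using insert by simp
    from insert.IH[OF insert.prems(1) this, of a] obtain z where
      "\<exists>i\<in>A. z i \<noteq> 0" "\<forall>i. i \<notin> A \<longrightarrow> z i = 0" "\<forall>b\<in>B. (\<Sum>i\<in>A. a b i * z i) = 0" by blast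
    moreover have "(\<Sum>i\<in>A. a b i * z i) = 0" by (rule sum.neutral) (simp add: True)
    ultimately show ?thesis by blast
  next
    case False
    then obtain i0 where i0: "i0 \<in> A" "a b i0 \<noteq> 0" by blast
    define A' where "A' = A - {i0}"
    define a' where "a' b' i = a b' i - a b' i0 * a b i / a b i0" for b' i
    have A': "finite A'" "card B < card A'" using insert i0 by (auto simp: A'_def)
    from insert.IH[OF A', of a'] obtain z where z: "\<exists>i\<in>A'. z i \<noteq> 0" "\<forall>i. i \<notin> A' \<longrightarrow> z i = 0"
      "\<forall>b\<in>B. (\<Sum>i\<in>A'. a' b i * z i) = 0" by blast
    define w where "w = z(i0 := - (\<Sum>i\<in>A'. a b i * z i) / a b i0)"
    have split: "(\<Sum>i\<in>A. f i * w i) = f i0 * w i0 + (\<Sum>i\<in>A'. f i * z i)" for f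
    proof -
      have "(\<Sum>i\<in>A. f i * w i) = f i0 * w i0 + (\<Sum>i\<in>A'. f i * w i)"
        unfolding A'_def using i0(1) insert.prems(1) by (rule sum.remove[rotated])
      also have "(\<Sum>i\<in>A'. f i * w i) = (\<Sum>i\<in>A'. f i * z i)"
        by (rule sum.cong) (auto simp: w_def A'_def)
      finally show ?thesis .
    qed
    have "(\<Sum>i\<in>A. a b i * w i) = 0" unfolding split using i0(2) by (simp add: w_def)
    moreover have "(\<Sum>i\<in>A. a b' i * w i) = 0" if "b' \<in> B" for b'
    proof -
      have "(\<Sum>i\<in>A'. a' b' i * z i) = (\<Sum>i\<in>A'. a b' i * z i) - a b' i0 / a b i0 * (\<Sum>i\<in>A'. a b i * z i)"
        by (simp add: a'_def algebra_simps sum_subtractf sum_distrib_left)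
      thus ?thesis unfolding split using z(3) that by (simp add: w_def)
    qed
    moreover have "\<exists>i\<in>A. w i \<noteq> 0" using z(1) by (auto simp: w_def A'_def)
    moreover have "\<forall>i. i \<notin> A \<longrightarrow> w i = 0" using z(2) i0(1) by (auto simp: w_def A'_def)
    ultimately show ?thesis by blast
  qed
qed

text \<open>Induction over \<open>B\<close>. If \<open>g b\<close> is nonzero at some
  \<open>w\<close> in the common kernel of the others, then \<open>f - m * g b\<close> with
  \<open>m = f w / g b w\<close> vanishes on that whole kernel, because every vector there can be
  corrected by a multiple of \<open>w\<close>. \<open>S\<close> plays the role of a subspace of the
  space of all functions.\<close>

lemma functional_in_span:
  fixes g :: "'b \<Rightarrow> ('e \<Rightarrow> rat) \<Rightarrow> rat" and f :: "('e \<Rightarrow> rat) \<Rightarrow> rat"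
  assumes "finite B"
    and lin: "\<And>b s y t z. b \<in> B \<Longrightarrow> y \<in> S \<Longrightarrow> z \<in> S \<Longrightarrow> g b (\<lambda>e. s * y e + t * z e) = s * g b y + t * g b z"
    and flin: "\<And>s y t z. y \<in> S \<Longrightarrow> z \<in> S \<Longrightarrow> f (\<lambda>e. s * y e + t * z e) = s * f y + t * f z"
    and S: "\<And>s y t z. y \<in> S \<Longrightarrow> z \<in> S \<Longrightarrow> (\<lambda>e. s * y e + t * z e) \<in> S"
    and ker: "\<And>z. z \<in> S \<Longrightarrow> \<forall>b\<in>B. g b z = 0 \<Longrightarrow> f z = 0"
  shows "\<exists>p. \<forall>z\<in>S. f z = (\<Sum>b\<in>B. p b * g b z)"
  using assms(1) lin flin ker
proof (induction B arbitrary: f)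
  case (insert b B)
  show ?case
  proof (cases "\<exists>w\<in>S. (\<forall>b'\<in>B. g b' w = 0) \<and> g b w \<noteq> 0")
    case False
    have "\<exists>p. \<forall>z\<in>S. f z = (\<Sum>b\<in>B. p b * g b z)"
    proof (rule insert.IH)
      fix z assume z: "z \<in> S" "\<forall>b\<in>B. g b z = 0"
      hence "\<forall>b'\<in>insert b B. g b' z = 0" using False by blast
      thus "f z = 0" using insert.prems(3) z(1) by blast
    qed (use insert.prems in auto)
    then obtain p where p: "\<forall>z\<in>S. f z = (\<Sum>b\<in>B. p b * g b z)" by blast
    have "(\<Sum>b'\<in>insert b B. (p(b := 0)) b' * g b' z) = (\<Sum>b'\<in>B. p b' * g b' z)" for z
    proof -
      have "(\<Sum>b'\<in>insert b B. (p(b := 0)) b' * g b' z) = (\<Sum>b'\<in>B. (p(b := 0)) b' * g b' z)"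
        using insert.hyps by simp
      also have "\<dots> = (\<Sum>b'\<in>B. p b' * g b' z)"
        using insert.hyps by (intro sum.cong) auto
      finally show ?thesis .
    qed
    thus ?thesis using p by (intro exI[of _ "p(b := 0)"]) metis
  next
    case True
    then obtain w where w: "w \<in> S" "\<forall>b'\<in>B. g b' w = 0" "g b w \<noteq> 0" by blast
    define m where "m = f w / g b w"
    have "\<exists>p. \<forall>z\<in>S. f z - m * g b z = (\<Sum>b\<in>B. p b * g b z)"
    proof (rule insert.IH)
      fix z assume z: "z \<in> S" "\<forall>b\<in>B. g b z = 0"
      let ?u = "\<lambda>e. g b w * z e + (- g b z) * w e"
      have "f ?u = 0"
      proof (rule insert.prems(3))
        show "?u \<in> S" using S[OF z(1) w(1)] .
        show "\<forall>b'\<in>insert b B. g b' ?u = 0"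
        proof
          fix b' assume b': "b' \<in> insert b B"
          have "g b' ?u = g b w * g b' z + (- g b z) * g b' w"
            by (rule insert.prems(1)[OF b' z(1) w(1)])
          thus "g b' ?u = 0" using b' z(2) w(2) by auto
        qed
      qed
      moreover have "f ?u = g b w * f z + (- g b z) * f w"
        by (rule insert.prems(2)[OF z(1) w(1)])
      ultimately show "f z - m * g b z = 0" using w(3) by (simp add: m_def field_simps)
    qed (use insert.prems in \<open>auto simp: algebra_simps\<close>)
    then obtain p where p: "\<forall>z\<in>S. f z - m * g b z = (\<Sum>b\<in>B. p b * g b z)" by blast
    have "f z = (\<Sum>b'\<in>insert b B. (p(b := m)) b' * g b' z)" if "z \<in> S" for z
    proof -
      have "(\<Sum>b'\<in>insert b B. (p(b := m)) b' * g b' z) = m * g b z + (\<Sum>b'\<in>B. (p(b := m)) b' * g b' z)"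
        using insert.hyps by simp
      also have "(\<Sum>b'\<in>B. (p(b := m)) b' * g b' z) = (\<Sum>b'\<in>B. p b' * g b' z)"
        using insert.hyps by (intro sum.cong) auto
      finally show ?thesis using p that by (metis add_diff_cancel_left' diff_add_cancel add.commute)
    qed
    thus ?thesis by blast
  qed
qed auto

subsection \<open>Polyhedral cones with an interior point\<close>

text \<open>The inequalities of the cone are indexed abstractly, so that edges and odd cuts can be
  treated alike. The point \<open>x\<close> is strictly inside relative to the subspace
  \<open>L\<close>; moving towards it releases every tight constraint.\<close>

locale cone_interior =
  fixes L :: "('e \<Rightarrow> rat) set" and K :: "'k set"
    and slack :: "'k \<Rightarrow> ('e \<Rightarrow> rat) \<Rightarrow> rat" and x :: "'e \<Rightarrow> rat"
  assumes finite_K: "finite K"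
    and L_comb: "\<And>y z s t. y \<in> L \<Longrightarrow> z \<in> L \<Longrightarrow> (\<lambda>e. s * y e + t * z e) \<in> L"
    and slack_comb: "\<And>k y z s t. k \<in> K \<Longrightarrow> y \<in> L \<Longrightarrow> z \<in> L \<Longrightarrow>
      slack k (\<lambda>e. s * y e + t * z e) = s * slack k y + t * slack k z"
    and x_L: "x \<in> L" and x_pos: "\<And>k. k \<in> K \<Longrightarrow> slack k x > 0"
begin

definition C :: "('e \<Rightarrow> rat) set" where "C = {y \<in> L. \<forall>k\<in>K. slack k y \<ge> 0}"
definition tight :: "('e \<Rightarrow> rat) \<Rightarrow> 'k set" where "tight y = {k \<in> K. slack k y = 0}"

lemma finite_tight [simp]: "finite (tight y)"
  using finite_K by (simp add: tight_def)

text \<open>Constraints that are not tight leave room for a short step, so only the tight ones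
  restrict the direction; those that grow along \<open>d\<close> cease to be tight.\<close>

lemma small_step:
  assumes y: "y \<in> C" and d: "d \<in> L" "\<And>k. k \<in> tight y \<Longrightarrow> slack k d \<ge> 0"
  obtains \<epsilon> where "\<epsilon> > 0" "(\<lambda>e. 1 * y e + \<epsilon> * d e) \<in> C"
    "tight (\<lambda>e. 1 * y e + \<epsilon> * d e) = {k \<in> tight y. slack k d = 0}"
proof -
  have yL: "y \<in> L" and y0: "\<And>k. k \<in> K \<Longrightarrow> slack k y \<ge> 0" using y by (auto simp: C_def)
  have "\<exists>\<epsilon>>0. \<epsilon> \<le> 1 \<and> (\<forall>k\<in>K - tight y. slack k y + \<epsilon> * slack k d > 0)"
    by (rule uniform_small_step) (use finite_K y0 in \<open>auto simp: tight_def less_le\<close>)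
  then obtain \<epsilon> where e: "\<epsilon> > 0" "\<forall>k\<in>K - tight y. slack k y + \<epsilon> * slack k d > 0" by blast
  let ?u = "\<lambda>e. 1 * y e + \<epsilon> * d e"
  have slack: "slack k ?u = slack k y + \<epsilon> * slack k d" if "k \<in> K" for k
    using slack_comb[OF that yL d(1), of 1 \<epsilon>] by simp
  have alT: "slack k ?u = \<epsilon> * slack k d" if "k \<in> tight y" for k
    using slack[of k] that by (simp add: tight_def)
  have "?u \<in> L" using L_comb[OF yL d(1)] .
  moreover have "slack k ?u \<ge> 0" if "k \<in> K" for k
    using slack[OF that] e d(2) alT[of k] that by (cases "k \<in> tight y") (auto simp: less_imp_le)
  ultimately have "?u \<in> C" by (simp add: C_def)
  moreover have "tight ?u = {k \<in> tight y. slack k d = 0}"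
  proof (intro set_eqI iffI)
    fix k assume k: "k \<in> tight ?u"
    hence kK: "k \<in> K" "slack k ?u = 0" by (auto simp: tight_def)
    hence "k \<in> tight y" using e(2) slack[of k] by (metis DiffI less_irrefl)
    thus "k \<in> {k \<in> tight y. slack k d = 0}" using alT[of k] kK e(1) by simp
  next
    fix k assume "k \<in> {k \<in> tight y. slack k d = 0}"
    thus "k \<in> tight ?u" using alT[of k] by (auto simp: tight_def)
  qed
  ultimately show ?thesis using that e(1) by blast
qed

text \<open>Ratio test: \<open>t\<close> is the first time at which a constraint that decreases
  along \<open>z\<close> reaches 0.\<close>

lemma shoot:
  assumes y: "y \<in> C" and z: "z \<in> L" and k0: "k0 \<in> K" "slack k0 z < 0"
    and T0: "\<And>k. k \<in> tight y \<Longrightarrow> slack k z \<ge> 0"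
  obtains t k where "t > 0" "(\<lambda>e. 1 * y e + t * z e) \<in> C"
    "k \<in> tight (\<lambda>e. 1 * y e + t * z e)" "slack k z < 0"
proof -
  have yL: "y \<in> L" and y0: "\<And>k. k \<in> K \<Longrightarrow> slack k y \<ge> 0" using y by (auto simp: C_def)
  define N where "N = {k \<in> K. slack k z < 0}"
  define r where "r k = slack k y / (- slack k z)" for k
  have N: "finite N" "N \<noteq> {}" using finite_K k0 by (auto simp: N_def)
  define t where "t = Min (r ` N)"
  have "t \<in> r ` N" unfolding t_def using N by (intro Min_in) auto
  then obtain k1 where k1: "k1 \<in> N" "t = r k1" by blast
  have tle: "t \<le> r k" if "k \<in> N" for k unfolding t_def using N that by simp
  have "slack k1 y > 0"
    using k1 y0[of k1] T0[of k1] by (auto simp: N_def tight_def less_le)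
  hence "r k1 > 0" using k1(1) unfolding r_def N_def by (intro divide_pos_pos) auto
  hence t0: "t > 0" using k1(2) by simp
  let ?u = "\<lambda>e. 1 * y e + t * z e"
  have slack: "slack k ?u = slack k y + t * slack k z" if "k \<in> K" for k
    using slack_comb[OF that yL z, of 1 t] by simp
  have "?u \<in> L" using L_comb[OF yL z] .
  moreover have "slack k ?u \<ge> 0" if k: "k \<in> K" for k
  proof (cases "slack k z < 0")
    case True
    have "t \<le> slack k y / (- slack k z)" using True tle[of k] k by (simp add: N_def r_def)
    moreover have "0 < - slack k z" using True by simp
    ultimately have "t * (- slack k z) \<le> slack k y" by (simp only: pos_le_divide_eq)
    thus ?thesis using slack[OF k] by simp
  next
    case False
    thus ?thesis using slack[OF k] y0[OF k] t0 by simp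
  qed
  ultimately have "?u \<in> C" by (simp add: C_def)
  moreover have "k1 \<in> tight ?u"
    using slack[of k1] k1 by (auto simp: tight_def N_def r_def)
  ultimately show ?thesis using that t0 k1(1) by (auto simp: N_def)
qed

text \<open>A face with inclusion-minimal nonempty set of tight constraints is a facet: moving from a
  point of it towards the interior point, corrected by a vector separating two of the tight
  constraints, would release some but not all of them.\<close>

lemma facet_exists:
  assumes w: "w \<in> C" "tight w \<noteq> {}"
  obtains y where "y \<in> C" "tight y \<noteq> {}" "tight y \<subseteq> tight w"
    "\<And>k k' z. k \<in> tight y \<Longrightarrow> k' \<in> tight y \<Longrightarrow> z \<in> L \<Longrightarrow> slack k z = 0 \<Longrightarrow> slack k' z = 0"
proof -
  obtain y where y: "y \<in> C" "tight y \<noteq> {}" "tight y \<subseteq> tight w"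
    and min: "\<And>u. u \<in> C \<Longrightarrow> tight u \<noteq> {} \<Longrightarrow> tight u \<subseteq> tight w \<Longrightarrow> card (tight y) \<le> card (tight u)"
    using ex_has_least_nat[of "\<lambda>u. u \<in> C \<and> tight u \<noteq> {} \<and> tight u \<subseteq> tight w" w "\<lambda>u. card (tight u)"] w by blast
  have key: False if k: "k \<in> tight y" "k' \<in> tight y" and z: "z \<in> L" "slack k z = 0" "slack k' z > 0" for k k' z
  proof -
    have TK: "j \<in> K" if "j \<in> tight y" for j using that by (simp add: tight_def)
    have pos: "slack j x > 0" if "j \<in> tight y" for j using x_pos TK that by blast
    \<comment> \<open>With the maximal ratio \<open>m\<close>, the direction
      \<open>m * x - z\<close> decreases no tight constraint, leaves the one attaining the maximum
      at 0, and increases \<open>k\<close> because \<open>slack k z = 0\<close>.\<close>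
    define r where "r j = slack j z / slack j x" for j
    define m where "m = Max (r ` tight y)"
    have "m \<in> r ` tight y" unfolding m_def using k by (intro Max_in) auto
    then obtain j1 where j1: "j1 \<in> tight y" "m = r j1" by blast
    have le: "r j \<le> m" if "j \<in> tight y" for j unfolding m_def using that by simp
    have m0: "m > 0" using le[OF k(2)] pos[OF k(2)] z(3) by (simp add: r_def) (meson divide_pos_pos less_le_trans)
    let ?d = "\<lambda>e. m * x e + (- 1) * z e"
    have d: "?d \<in> L" by (rule L_comb[OF x_L z(1)])
    have ald: "slack j ?d = m * slack j x - slack j z" if "j \<in> tight y" for j
      using slack_comb[OF TK[OF that] x_L z(1), of m "- 1"] by simp
    have ald0: "slack j ?d \<ge> 0" if "j \<in> tight y" for j
      using le[OF that] pos[OF that] ald[OF that] by (simp add: r_def divide_le_eq)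
    obtain \<epsilon> where e: "\<epsilon> > 0" "(\<lambda>e. 1 * y e + \<epsilon> * ?d e) \<in> C"
      "tight (\<lambda>e. 1 * y e + \<epsilon> * ?d e) = {k \<in> tight y. slack k ?d = 0}"
      by (rule small_step[OF y(1) d ald0])
    have "slack j1 ?d = 0" using ald[OF j1(1)] j1(2) pos[OF j1(1)] by (simp add: r_def)
    hence j1': "j1 \<in> {k \<in> tight y. slack k ?d = 0}" using j1(1) by blast
    have "slack k ?d > 0" using ald[OF k(1)] z(2) m0 pos[OF k(1)] by simp
    hence "k \<notin> {k \<in> tight y. slack k ?d = 0}" by simp
    hence "{k \<in> tight y. slack k ?d = 0} \<subset> tight y" using k(1) by blast
    hence "card {k \<in> tight y. slack k ?d = 0} < card (tight y)" by (intro psubset_card_mono) auto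
    moreover have "card (tight y) \<le> card {k \<in> tight y. slack k ?d = 0}"
      using min[OF e(2)] j1' y(3) unfolding e(3) by blast
    ultimately show False by simp
  qed
  have "slack k' z = 0" if k: "k \<in> tight y" "k' \<in> tight y" and z: "z \<in> L" "slack k z = 0" for k k' z
  proof (rule ccontr)
    assume ne: "slack k' z \<noteq> 0"
    let ?n = "\<lambda>e. (- 1) * z e + 0 * z e"
    have n: "?n \<in> L" by (rule L_comb[OF z(1) z(1)])
    have "slack j ?n = - slack j z" if "j \<in> tight y" for j
      using slack_comb[of j z z "- 1" 0] that z(1) by (simp add: tight_def)
    thus False using key[OF k z] key[OF k n] k z(2) ne by fastforce
  qed
  thus ?thesis using that y by blast
qed

text \<open>From \<open>x2\<close> a small step is made in direction \<open>x - s * x1\<close>, with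
  \<open>s\<close> as large as the constraints in the difference allow. Those tight at
  \<open>x1\<close> only see \<open>x\<close> and are all released, while one in the difference,
  where the ratio is minimal, stays tight.\<close>

lemma second_face:
  assumes x1: "x1 \<in> C" and x2: "x2 \<in> C" and tight: "tight x1 \<subset> tight x2"
  obtains y where "y \<in> C" "tight y \<noteq> {}" "tight y \<subseteq> tight x2 - tight x1"
proof -
  have x1L: "x1 \<in> L" and x10: "\<And>k. k \<in> K \<Longrightarrow> slack k x1 \<ge> 0" using x1 by (auto simp: C_def)
  let ?N = "tight x2 - tight x1"
  have TK: "j \<in> K" if "j \<in> tight x2" for j using that by (simp add: tight_def)
  have N: "finite ?N" "?N \<noteq> {}" using tight by auto
  have pos: "slack j x1 > 0" if "j \<in> ?N" for j
    using that x10[of j] TK[of j] by (auto simp: tight_def less_le)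
  define r where "r j = slack j x / slack j x1" for j
  define s where "s = Min (r ` ?N)"
  have "s \<in> r ` ?N" unfolding s_def using N by (intro Min_in) auto
  then obtain j1 where j1: "j1 \<in> ?N" "s = r j1" by blast
  have le: "s \<le> r j" if "j \<in> ?N" for j unfolding s_def using N(1) that by simp
  let ?d = "\<lambda>e. 1 * x e + (- s) * x1 e"
  have d: "?d \<in> L" by (rule L_comb[OF x_L x1L])
  have ald: "slack j ?d = slack j x - s * slack j x1" if "j \<in> tight x2" for j
    using slack_comb[OF TK[OF that] x_L x1L, of 1 "- s"] by simp
  have ald1: "slack j ?d > 0" if "j \<in> tight x1" for j
    using ald[of j] x_pos[of j] TK[of j] tight that by (auto simp: tight_def)
  have ald0: "slack j ?d \<ge> 0" if "j \<in> tight x2" for j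
  proof (cases "j \<in> tight x1")
    case False
    thus ?thesis using le[of j] pos[of j] ald[OF that] that by (simp add: r_def le_divide_eq)
  qed (use ald1 less_imp_le in blast)
  obtain \<epsilon> where e: "\<epsilon> > 0" "(\<lambda>e. 1 * x2 e + \<epsilon> * ?d e) \<in> C"
    "tight (\<lambda>e. 1 * x2 e + \<epsilon> * ?d e) = {k \<in> tight x2. slack k ?d = 0}"
    by (rule small_step[OF x2 d ald0])
  have "slack j1 ?d = 0" using ald[of j1] j1 pos[OF j1(1)] by (simp add: r_def)
  hence "j1 \<in> {k \<in> tight x2. slack k ?d = 0}" using j1 by blast
  moreover have "{k \<in> tight x2. slack k ?d = 0} \<subseteq> tight x2 - tight x1" using ald1 by fastforce
  ultimately show ?thesis using that[OF e(2)] unfolding e(3) by blast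
qed

end

subsection \<open>Exchanging matchings along alternating paths\<close>

definition matching :: "('e \<Rightarrow> 'v set) \<Rightarrow> 'e set \<Rightarrow> bool" where
  "matching ends N \<longleftrightarrow> (\<forall>e\<in>N. card (ends e) = 2) \<and>
    (\<forall>e\<in>N. \<forall>e'\<in>N. e \<noteq> e' \<longrightarrow> ends e \<inter> ends e' = {})"

abbreviation covered :: "('e \<Rightarrow> 'v set) \<Rightarrow> 'e set \<Rightarrow> 'v set" where
  "covered ends N \<equiv> \<Union> (ends ` N)"

definition symd :: "'a set \<Rightarrow> 'a set \<Rightarrow> 'a set" where
  "symd A B = (A - B) \<union> (B - A)"

lemma matching_remove:
  assumes "matching ends N" "e \<in> N"
  shows "matching ends (N - {e})" "covered ends (N - {e}) = covered ends N - ends e"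
proof -
  show "matching ends (N - {e})" using assms unfolding matching_def by simp
  have "ends e \<inter> ends e' = {}" if "e' \<in> N - {e}" for e'
    using assms that unfolding matching_def by auto
  thus "covered ends (N - {e}) = covered ends N - ends e" by blast
qed

lemma matching_insert:
  assumes "matching ends N" "card (ends e) = 2" "ends e \<inter> covered ends N = {}"
  shows "matching ends (insert e N)" "covered ends (insert e N) = covered ends N \<union> ends e"
proof -
  have "ends e \<inter> ends e' = {}" "ends e' \<inter> ends e = {}" if "e' \<in> N" for e'
    using assms(3) that by auto
  thus "matching ends (insert e N)" using assms(1,2) unfolding matching_def by simp
qed auto

text \<open>The component of \<open>a\<close> in the union of the two matchings is an alternating
  path that starts with an edge of \<open>N1\<close>; interchanging the matchings along it toggles
  exactly its ends \<open>a\<close> and \<open>b\<close>. The induction follows the path two edges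
  at a time, from \<open>a\<close> along \<open>e\<close> to \<open>v\<close> and along
  \<open>f\<close> to \<open>w\<close>; the path may stop at \<open>v\<close> or at
  \<open>w\<close>.\<close>

lemma matching_exchange:
  assumes "finite N1" "matching ends N1" "matching ends N2" "a \<in> covered ends N1" "a \<notin> covered ends N2"
  shows "\<exists>M1 M2 b. matching ends M1 \<and> matching ends M2 \<and> M1 \<union> M2 \<subseteq> N1 \<union> N2 \<and> b \<noteq> a \<and>
    b \<in> symd (covered ends N1) (covered ends N2) \<and>
    covered ends M1 = symd (covered ends N1) {a, b} \<and> covered ends M2 = symd (covered ends N2) {a, b}"
  using assms
proof (induction "card N1" arbitrary: N1 N2 a rule: less_induct)
  case less
  then obtain e where e: "e \<in> N1" "a \<in> ends e" by blast
  have "card (ends e) = 2" using less.prems(2) e(1) by (auto simp: matching_def)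
  then obtain v where v: "ends e = {a, v}" "v \<noteq> a"
    using e(2) by (metis card_2_iff insert_iff singletonD insert_commute)
  note R1 = matching_remove[OF less.prems(2) e(1)]
  have c1: "a \<in> covered ends N1" "v \<in> covered ends N1" using e v by auto
  show ?case
  proof (cases "v \<in> covered ends N2")
    case False
    have I2: "matching ends (insert e N2)" "covered ends (insert e N2) = covered ends N2 \<union> ends e"
      using matching_insert[OF less.prems(3), of e] False less.prems(5) v by auto
    have "covered ends (N1 - {e}) = symd (covered ends N1) {a, v}"
      unfolding R1(2) v(1) symd_def using c1 by blast
    moreover have "covered ends (insert e N2) = symd (covered ends N2) {a, v}"
      unfolding I2(2) v(1) symd_def using False less.prems(5) by blast
    moreover have "v \<in> symd (covered ends N1) (covered ends N2)"
      unfolding symd_def using c1 False by blast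
    moreover have "N1 - {e} \<union> insert e N2 \<subseteq> N1 \<union> N2" using e(1) by blast
    ultimately show ?thesis using R1(1) I2(1) v(2)
      by (intro exI[of _ "N1 - {e}"] exI[of _ "insert e N2"] exI[of _ v] conjI)
  next
    case True
    then obtain f where f: "f \<in> N2" "v \<in> ends f" by blast
    have "card (ends f) = 2" using less.prems(3) f(1) by (auto simp: matching_def)
    then obtain w where w: "ends f = {v, w}" "w \<noteq> v"
      using f(2) by (metis card_2_iff insert_iff singletonD insert_commute)
    have wa: "w \<noteq> a" using f(1) w less.prems(5) by auto
    note R2 = matching_remove[OF less.prems(3) f(1)]
    have c2: "v \<in> covered ends N2" "w \<in> covered ends N2" using f(1) w(1) by auto
    have card_ef: "card (ends e) = 2" "card (ends f) = 2" using v w by auto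
    show ?thesis
    proof (cases "w \<in> covered ends N1")
      case False
      have I1: "matching ends (insert f (N1 - {e}))"
        "covered ends (insert f (N1 - {e})) = covered ends N1 - ends e \<union> ends f"
        using matching_insert[OF R1(1) card_ef(2)] R1(2) v w False by auto
      have I2: "matching ends (insert e (N2 - {f}))"
        "covered ends (insert e (N2 - {f})) = covered ends N2 - ends f \<union> ends e"
        using matching_insert[OF R2(1) card_ef(1)] R2(2) v w less.prems(5) by auto
      have "covered ends (insert f (N1 - {e})) = symd (covered ends N1) {a, w}"
        unfolding I1(2) v(1) w(1) symd_def using c1 False v(2) by blast
      moreover have "covered ends (insert e (N2 - {f})) = symd (covered ends N2) {a, w}"
        unfolding I2(2) v(1) w(1) symd_def using c2 w(2) less.prems(5) by blast
      moreover have "w \<in> symd (covered ends N1) (covered ends N2)"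
        unfolding symd_def using c2 False by blast
      moreover have "insert f (N1 - {e}) \<union> insert e (N2 - {f}) \<subseteq> N1 \<union> N2" using e(1) f(1) by blast
      ultimately show ?thesis using I1(1) I2(1) wa
        by (intro exI[of _ "insert f (N1 - {e})"] exI[of _ "insert e (N2 - {f})"] exI[of _ w] conjI)
    next
      case True
      \<comment> \<open>Without \<open>e\<close> and \<open>f\<close> the situation is the same with
        \<open>w\<close> in place of \<open>a\<close>; afterwards \<open>e\<close> and
        \<open>f\<close> are put back interchanged.\<close>
      have "card (N1 - {e}) < card N1" using less.prems(1) e(1) by (rule card_Diff1_less)
      moreover have "w \<in> covered ends (N1 - {e})" unfolding R1(2) v(1) using True wa w(2) by simp
      moreover have "w \<notin> covered ends (N2 - {f})" unfolding R2(2) w(1) by simp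
      ultimately have "\<exists>M1 M2 b. matching ends M1 \<and> matching ends M2 \<and>
          M1 \<union> M2 \<subseteq> (N1 - {e}) \<union> (N2 - {f}) \<and> b \<noteq> w \<and>
          b \<in> symd (covered ends (N1 - {e})) (covered ends (N2 - {f})) \<and>
          covered ends M1 = symd (covered ends (N1 - {e})) {w, b} \<and>
          covered ends M2 = symd (covered ends (N2 - {f})) {w, b}"
        by (intro less.hyps finite_Diff less.prems(1) R1(1) R2(1))
      from this[unfolded R1(2) R2(2)]
      obtain M1 M2 b where M: "matching ends M1" "matching ends M2"
        "M1 \<union> M2 \<subseteq> (N1 - {e}) \<union> (N2 - {f})" "b \<noteq> w"
        "b \<in> symd (covered ends N1 - ends e) (covered ends N2 - ends f)"
        "covered ends M1 = symd (covered ends N1 - ends e) {w, b}"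
        "covered ends M2 = symd (covered ends N2 - ends f) {w, b}"
        by (elim exE conjE)
      have b: "b \<noteq> v" "b \<noteq> a" using M(5) v w less.prems(5) by (auto simp: symd_def)
      have I1: "matching ends (insert f M1)" "covered ends (insert f M1) = covered ends M1 \<union> ends f"
        using matching_insert[OF M(1) card_ef(2)] M(6) v w b True wa by (auto simp: symd_def)
      have I2: "matching ends (insert e M2)" "covered ends (insert e M2) = covered ends M2 \<union> ends e"
        using matching_insert[OF M(2) card_ef(1)] M(7) v w b wa less.prems(5) by (auto simp: symd_def)
      have "b \<in> symd (covered ends N1) (covered ends N2)"
        using M(5) v w b M(4) c1 c2 True by (auto simp: symd_def)
      moreover have "covered ends (insert f M1) = symd (covered ends N1) {a, b}"
        unfolding I1(2) M(6) v(1) w(1) symd_def using b M(4) c1 wa v(2) w(2) True by auto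
      moreover have "covered ends (insert e M2) = symd (covered ends N2) {a, b}"
        unfolding I2(2) M(7) v(1) w(1) symd_def using b M(4) c2 wa v(2) w(2) less.prems(5) by auto
      moreover have "insert f M1 \<union> insert e M2 \<subseteq> N1 \<union> N2" using M(3) e(1) f(1) by blast
      ultimately show ?thesis using I1(1) I2(1) b(2)
        by (intro exI[of _ "insert f M1"] exI[of _ "insert e M2"] exI[of _ b] conjI)
    qed
  qed
qed

text \<open>If no such set exists, the triples \<open>{0,1,c}\<close>, \<open>{0,2,c}\<close>, \<open>{0,2,c+1}\<close>, \<open>{1,2,c+1}\<close> are
  forced one after the other, and the first cannot be exchanged with the last.\<close>

lemma alternating_exchange:
  fixes I :: "nat set set"
  assumes exch: "\<And>A B a. A \<in> I \<Longrightarrow> B \<in> I \<Longrightarrow> a \<in> symd A B \<Longrightarrow>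
      \<exists>b\<in>symd A B. b \<noteq> a \<and> symd A {a, b} \<in> I \<and> symd B {a, b} \<in> I"
    and single: "\<And>i. i < l \<Longrightarrow> {i} \<in> I" and full: "{..<l} \<in> I"
    and l: "odd l" "l \<ge> 7"
  shows "(\<exists>a b c. a < b \<and> b < c \<and> c < l \<and> odd (a + b) \<and> odd (b + c) \<and> {a, b, c} \<in> I) \<or>
    (\<exists>a b c d e. a < b \<and> b < c \<and> c < d \<and> d < e \<and> e < l \<and> odd (a + b) \<and> odd (b + c) \<and>
      odd (c + d) \<and> odd (d + e) \<and> {a, b, c, d, e} \<in> I)"
proof (rule ccontr)
  assume neg: "\<not> ?thesis"
  have no3: "{a, b, c} \<notin> I" if "a < b" "b < c" "c < l" "odd (a + b)" "odd (b + c)" for a b c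
    using neg that by blast
  have no5: "{a, b, c, d, e} \<notin> I" if "a < b" "b < c" "c < d" "d < e" "e < l" "odd (a + b)" "odd (b + c)"
    "odd (c + d)" "odd (d + e)" for a b c d e
    using neg that by blast
  \<comment> \<open>Exchanging a triple with the singleton \<open>{t}\<close> at \<open>t\<close>
    forces \<open>t\<close> to replace one of the three elements, as nothing else is in the
    symmetric difference.\<close>
  have step: "{t, q, r} \<in> I \<or> {p, t, r} \<in> I \<or> {p, q, t} \<in> I"
    if "{p, q, r} \<in> I" "t < l" "p \<noteq> q" "q \<noteq> r" "p \<noteq> r" "t \<noteq> p" "t \<noteq> q" "t \<noteq> r" for p q r t
  proof -
    have "t \<in> symd {p, q, r} {t}" using that by (auto simp: symd_def)
    from exch[OF that(1) single[OF that(2)] this] obtain b where b: "b \<in> symd {p, q, r} {t}"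
      "b \<noteq> t" "symd {p, q, r} {t, b} \<in> I" by blast
    have "b = p \<or> b = q \<or> b = r" using b by (auto simp: symd_def)
    moreover have "symd {p, q, r} {t, p} = {t, q, r}" "symd {p, q, r} {t, q} = {p, t, r}"
      "symd {p, q, r} {t, r} = {p, q, t}" using that by (auto simp: symd_def)
    ultimately show ?thesis using b(3) by metis
  qed
  have "1 \<in> symd {0} {..<l}" using l by (auto simp: symd_def)
  from exch[OF single full this] l obtain c where c: "c \<in> symd {0} {..<l}" "c \<noteq> 1" "symd {0} {1, c} \<in> I"
    by (metis gr0I not_less_zero odd_pos)
  have c1: "c \<noteq> 0" "c < l" using c(1) l by (auto simp: symd_def)
  have "symd {0} {1, c} = {0, 1, c}" using c1 c(2) by (auto simp: symd_def)
  hence A: "{0, 1, c} \<in> I" using c(3) by simp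
  \<comment> \<open>For even \<open>c\<close> the elements 0, 1, \<open>c\<close> would alternate in
    parity. As \<open>c\<close> is odd, \<open>c + 1\<close> is even and hence different from the
    odd number \<open>l\<close>.\<close>
  have oc: "odd c" using no3[of 0 1 c] A c1 c(2) by fastforce
  have c3: "c \<ge> 3" using oc c1(1) c(2) by presburger
  have cl: "c + 1 < l" using oc c1(2) l(1) by presburger
  have B: "{0, 2, c} \<in> I"
    using step[OF A, of 2] no3[of 1 2 c] no3[of 0 1 2] c3 c1 oc l by (auto simp: insert_commute)
  have D: "{0, 2, c + 1} \<in> I"
    using step[OF B, of "c + 1"] no3[of 2 c "c + 1"] no3[of 0 c "c + 1"] c3 cl oc by (auto simp: insert_commute)
  have E: "{1, 2, c + 1} \<in> I"
    using step[OF D, of 1] no3[of 0 1 "c + 1"] no3[of 0 1 2] c3 cl oc by (auto simp: insert_commute)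
  have "0 \<in> symd {0, 1, c} {1, 2, c + 1}" by (auto simp: symd_def)
  from exch[OF A E this] obtain b where b: "b \<in> symd {0, 1, c} {1, 2, c + 1}" "b \<noteq> 0"
    "symd {0, 1, c} {0, b} \<in> I" "symd {1, 2, c + 1} {0, b} \<in> I" by blast
  have "b = 2 \<or> b = c \<or> b = c + 1" using b(1,2) by (auto simp: symd_def)
  thus False
  proof (elim disjE)
    assume "b = 2"
    hence "symd {0, 1, c} {0, b} = {1, 2, c}" using c3 by (auto simp: symd_def)
    thus False using b(3) no3[of 1 2 c] c3 c1 oc by auto
  next
    assume "b = c"
    hence "symd {1, 2, c + 1} {0, b} = {0, 1, 2, c, c + 1}" using c3 by (auto simp: symd_def)
    thus False using b(4) no5[of 0 1 2 c "c + 1"] c3 cl oc by auto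
  next
    assume "b = c + 1"
    hence "symd {1, 2, c + 1} {0, b} = {0, 1, 2}" using c3 by (auto simp: symd_def)
    thus False using b(4) no3[of 0 1 2] l by auto
  qed
qed

subsection \<open>Cuts, matchings and cones of a graph\<close>

definition cut :: "'e set \<Rightarrow> ('e \<Rightarrow> 'v set) \<Rightarrow> 'v set \<Rightarrow> 'e set" where
  "cut E ends X = {e \<in> E. card (ends e \<inter> X) = 1}"

definition inner :: "'e set \<Rightarrow> ('e \<Rightarrow> 'v set) \<Rightarrow> 'v set \<Rightarrow> 'e set" where
  "inner E ends X = {e \<in> E. ends e \<subseteq> X}"

text \<open>It is applied to disjoint \<open>X\<close> and \<open>Y\<close>, for which it consists
  of the edges joining them.\<close>

definition between :: "'e set \<Rightarrow> ('e \<Rightarrow> 'v set) \<Rightarrow> 'v set \<Rightarrow> 'v set \<Rightarrow> 'e set" where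
  "between E ends X Y = {e \<in> E. ends e \<inter> X \<noteq> {} \<and> ends e \<inter> Y \<noteq> {}}"

definition ind :: "'e set \<Rightarrow> 'e \<Rightarrow> rat" where
  "ind M e = (if e \<in> M then 1 else 0)"

definition pms :: "'v set \<Rightarrow> 'e set \<Rightarrow> ('e \<Rightarrow> 'v set) \<Rightarrow> 'e set set" where
  "pms V E ends = {M. perfect_matching V E ends M}"

definition dcone :: "'v set \<Rightarrow> 'e set \<Rightarrow> ('e \<Rightarrow> 'v set) \<Rightarrow> ('e \<Rightarrow> rat) set" where
  "dcone V E ends = {x. \<exists>c. (\<forall>M\<in>pms V E ends. c M \<ge> 0 \<and> qdyadic (c M)) \<and>
     (\<forall>e. x e = (\<Sum>M\<in>pms V E ends. c M * ind M e))}"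

text \<open>The homogeneous form of Edmonds' description of the perfect matching polytope: the
  common degree \<open>r\<close> replaces the right-hand side 1.\<close>

definition mcone :: "'v set \<Rightarrow> 'e set \<Rightarrow> ('e \<Rightarrow> 'v set) \<Rightarrow> ('e \<Rightarrow> rat) set" where
  "mcone V E ends = {x. (\<forall>e. x e \<ge> 0) \<and> (\<forall>e. e \<notin> E \<longrightarrow> x e = 0) \<and>
     (\<exists>r. (\<forall>v\<in>V. sum x (cut E ends {v}) = r) \<and>
          (\<forall>X\<subseteq>V. odd (card X) \<longrightarrow> r \<le> sum x (cut E ends X)))}"

lemma finite_pms [simp]: "finite E \<Longrightarrow> finite (pms V E ends)"
  by (rule finite_subset[of _ "Pow E"]) (auto simp: pms_def perfect_matching_def)

lemma dcone_0: "(\<lambda>_. 0) \<in> dcone V E ends"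
  unfolding dcone_def by (auto intro!: exI[of _ "\<lambda>_. 0"])

lemma dcone_comb:
  assumes "x \<in> dcone V E ends" "y \<in> dcone V E ends" "s \<ge> 0" "qdyadic s" "t \<ge> 0" "qdyadic t"
  shows "(\<lambda>e. s * x e + t * y e) \<in> dcone V E ends"
proof -
  obtain c d where c: "\<forall>M\<in>pms V E ends. c M \<ge> 0 \<and> qdyadic (c M)"
      "\<forall>e. x e = (\<Sum>M\<in>pms V E ends. c M * ind M e)"
    and d: "\<forall>M\<in>pms V E ends. d M \<ge> 0 \<and> qdyadic (d M)"
      "\<forall>e. y e = (\<Sum>M\<in>pms V E ends. d M * ind M e)"
    using assms(1,2) unfolding dcone_def by blast
  have "\<forall>M\<in>pms V E ends. s * c M + t * d M \<ge> 0 \<and> qdyadic (s * c M + t * d M)"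
    using c(1) d(1) assms(3-6) by auto
  moreover have "s * x e + t * y e = (\<Sum>M\<in>pms V E ends. (s * c M + t * d M) * ind M e)" for e
    using c(2) d(2) by (simp add: distrib_right sum.distrib sum_distrib_left mult.assoc)
  ultimately show ?thesis
    unfolding dcone_def by (intro CollectI exI[of _ "\<lambda>M. s * c M + t * d M"] conjI allI)
qed

lemma ind_in_dcone:
  assumes "finite E" "M \<in> pms V E ends"
  shows "ind M \<in> dcone V E ends"
proof -
  have "(\<Sum>N\<in>pms V E ends. (if N = M then 1 else 0) * ind N e) = ind M e" for e
  proof -
    have "(\<Sum>N\<in>pms V E ends. (if N = M then 1 else 0) * ind N e) = (\<Sum>N\<in>pms V E ends. if N = M then ind N e else 0)"
      by (rule sum.cong) auto
    thus ?thesis using assms by (simp add: sum.delta)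
  qed
  thus ?thesis unfolding dcone_def by (intro CollectI exI[of _ "\<lambda>N. if N = M then 1 else 0"]) auto
qed

lemma dcone_mono:
  assumes "finite E" "E' \<subseteq> E"
  shows "dcone V E' ends \<subseteq> dcone V E ends"
proof
  fix x assume "x \<in> dcone V E' ends"
  then obtain c where c: "\<forall>M\<in>pms V E' ends. c M \<ge> 0 \<and> qdyadic (c M)"
    "\<forall>e. x e = (\<Sum>M\<in>pms V E' ends. c M * ind M e)" unfolding dcone_def by blast
  have sub: "pms V E' ends \<subseteq> pms V E ends"
    using assms(2) by (auto simp: pms_def perfect_matching_def)
  define d where "d M = (if M \<in> pms V E' ends then c M else 0)" for M
  have "(\<Sum>M\<in>pms V E ends. d M * ind M e) = (\<Sum>M\<in>pms V E' ends. c M * ind M e)" for e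
    by (rule sum.mono_neutral_cong_right) (use assms(1) sub in \<open>auto simp: d_def\<close>)
  thus "x \<in> dcone V E ends"
    using c unfolding dcone_def by (intro CollectI exI[of _ d]) (auto simp: d_def)
qed

locale mgraph =
  fixes V :: "'v set" and E :: "'e set" and ends :: "'e \<Rightarrow> 'v set"
  assumes graph: "graph V E ends"
begin

abbreviation "cutE \<equiv> cut E ends"
abbreviation "innerE \<equiv> inner E ends"
abbreviation "betweenE \<equiv> between E ends"
abbreviation "PM \<equiv> pms V E ends"

lemma finite_V [simp]: "finite V" and finite_E [simp]: "finite E"
  using graph by (auto simp: graph_def)

lemma finite_subset_V: "X \<subseteq> V \<Longrightarrow> finite X"
  using finite_subset finite_V by blast

lemma finite_cut [simp]: "finite (cutE X)" and finite_inner [simp]: "finite (innerE X)"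
  and finite_between [simp]: "finite (betweenE X Y)"
  by (auto simp: cut_def inner_def between_def)

lemma card_compl: "X \<subseteq> V \<Longrightarrow> card (V - X) + card X = card V"
  using card_Diff_subset[of X V] card_mono[of V X] finite_subset_V[of X] by simp

lemma edgeE:
  assumes "e \<in> E"
  obtains a b where "ends e = {a, b}" "a \<noteq> b" "a \<in> V" "b \<in> V"
  using assms graph unfolding graph_def by (metis card_2_iff insert_subset)

lemma in_cut:
  assumes "e \<in> E" "ends e = {a, b}" "a \<noteq> b"
  shows "e \<in> cutE X \<longleftrightarrow> (a \<in> X) \<noteq> (b \<in> X)"
proof -
  have "ends e \<inter> X = (if a \<in> X then if b \<in> X then {a, b} else {a} else if b \<in> X then {b} else {})"
    using assms(2) by auto
  thus ?thesis using assms by (auto simp: cut_def)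
qed

lemma in_inner:
  assumes "e \<in> E" "ends e = {a, b}"
  shows "e \<in> innerE X \<longleftrightarrow> a \<in> X \<and> b \<in> X"
  using assms by (auto simp: inner_def)

lemma in_between:
  assumes "e \<in> E" "ends e = {a, b}"
  shows "e \<in> betweenE X Y \<longleftrightarrow> (a \<in> X \<or> b \<in> X) \<and> (a \<in> Y \<or> b \<in> Y)"
  using assms by (auto simp: between_def)

lemma cut_single: "v \<in> V \<Longrightarrow> cutE {v} = {e \<in> E. v \<in> ends e}"
proof -
  assume "v \<in> V"
  have "e \<in> cutE {v} \<longleftrightarrow> v \<in> ends e" if e: "e \<in> E" for e
  proof -
    obtain a b where ab: "ends e = {a, b}" "a \<noteq> b" using e by (rule edgeE)
    show ?thesis using in_cut[OF e ab] ab by auto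
  qed
  thus ?thesis by (auto simp: cut_def)
qed

lemma cut_subset: "cutE X \<subseteq> E" and inner_subset: "innerE X \<subseteq> E"
  and between_subset: "betweenE X Y \<subseteq> E"
  by (auto simp: cut_def inner_def between_def)

lemma cut_compl: "cutE (V - X) = cutE X"
proof (intro set_eqI)
  fix e show "e \<in> cutE (V - X) \<longleftrightarrow> e \<in> cutE X"
  proof (cases "e \<in> E")
    case True
    then obtain a b where "ends e = {a, b}" "a \<noteq> b" "a \<in> V" "b \<in> V" by (rule edgeE)
    thus ?thesis using in_cut[OF True] by auto
  qed (auto simp: cut_def)
qed

text \<open>Writing weights of cuts as sums over all of \<open>E\<close> with coefficients 0 and 1
  allows identities between cuts to be checked edge by edge.\<close>

lemma sum_restrict: "S \<subseteq> E \<Longrightarrow> sum y S = (\<Sum>e\<in>E. of_bool (e \<in> S) * y e)" for y :: "'e \<Rightarrow> rat"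
  by (rule sum.mono_neutral_cong_left) auto

lemma sum_cut: "sum y (cutE X) = (\<Sum>e\<in>E. of_bool (e \<in> cutE X) * y e)" for y :: "'e \<Rightarrow> rat"
  by (rule sum_restrict[OF cut_subset])

lemma sum_inner: "sum y (innerE X) = (\<Sum>e\<in>E. of_bool (e \<in> innerE X) * y e)" for y :: "'e \<Rightarrow> rat"
  by (rule sum_restrict[OF inner_subset])

lemma sum_between: "sum y (betweenE X Y) = (\<Sum>e\<in>E. of_bool (e \<in> betweenE X Y) * y e)" for y :: "'e \<Rightarrow> rat"
  by (rule sum_restrict[OF between_subset])

lemma degree_sum:
  fixes y :: "'e \<Rightarrow> rat"
  assumes X: "X \<subseteq> V"
  shows "(\<Sum>v\<in>X. p v * sum y (cutE {v})) = (\<Sum>e\<in>E. (\<Sum>v\<in>ends e \<inter> X. p v) * y e)"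
proof -
  have "(\<Sum>v\<in>X. p v * sum y (cutE {v})) = (\<Sum>v\<in>X. \<Sum>e\<in>E. p v * (of_bool (v \<in> ends e) * y e))"
  proof (rule sum.cong)
    fix v assume "v \<in> X"
    hence "\<And>e. e \<in> E \<Longrightarrow> e \<in> cutE {v} \<longleftrightarrow> v \<in> ends e" using cut_single X by auto
    hence "(\<Sum>e\<in>E. of_bool (e \<in> cutE {v}) * y e) = (\<Sum>e\<in>E. of_bool (v \<in> ends e) * y e)"
      by (intro sum.cong) auto
    thus "p v * sum y (cutE {v}) = (\<Sum>e\<in>E. p v * (of_bool (v \<in> ends e) * y e))"
      unfolding sum_cut sum_distrib_left[symmetric] by (rule arg_cong)
  qed simp
  also have "\<dots> = (\<Sum>e\<in>E. \<Sum>v\<in>X. p v * (of_bool (v \<in> ends e) * y e))" by (rule sum.swap)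
  also have "\<dots> = (\<Sum>e\<in>E. (\<Sum>v\<in>ends e \<inter> X. p v) * y e)"
  proof (rule sum.cong)
    fix e assume "e \<in> E"
    have "(\<Sum>v\<in>ends e \<inter> X. p v) = (\<Sum>v\<in>X. p v * of_bool (v \<in> ends e))"
      by (rule sum.mono_neutral_cong_left) (use finite_subset_V[OF X] in auto)
    thus "(\<Sum>v\<in>X. p v * (of_bool (v \<in> ends e) * y e)) = (\<Sum>v\<in>ends e \<inter> X. p v) * y e"
      by (simp add: sum_distrib_right mult.assoc)
  qed simp
  finally show ?thesis .
qed

lemma sum_degrees:
  fixes y :: "'e \<Rightarrow> rat"
  assumes X: "X \<subseteq> V"
  shows "(\<Sum>v\<in>X. sum y (cutE {v})) = sum y (cutE X) + 2 * sum y (innerE X)"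
proof -
  have "(\<Sum>v\<in>X. sum y (cutE {v})) = (\<Sum>e\<in>E. (\<Sum>v\<in>ends e \<inter> X. 1) * y e)"
    using degree_sum[OF X, of "\<lambda>_. 1" y] by simp
  also have "\<dots> = (\<Sum>e\<in>E. of_bool (e \<in> cutE X) * y e + 2 * (of_bool (e \<in> innerE X) * y e))"
  proof (rule sum.cong)
    fix e assume e: "e \<in> E"
    then obtain a b where ab: "ends e = {a, b}" "a \<noteq> b" by (rule edgeE)
    have "ends e \<inter> X = (if a \<in> X then if b \<in> X then {a, b} else {a} else if b \<in> X then {b} else {})"
      using ab(1) by auto
    thus "(\<Sum>v\<in>ends e \<inter> X. 1) * y e = of_bool (e \<in> cutE X) * y e + 2 * (of_bool (e \<in> innerE X) * y e)"
      using ab in_cut[OF e ab] in_inner[OF e ab(1)] by auto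
  qed simp
  finally show ?thesis by (simp only: sum_cut sum_inner sum.distrib sum_distrib_left)
qed

text \<open>Submodularity of cuts with its exact defect: an edge joining \<open>U - W\<close> to
  \<open>W - U\<close> lies in both cuts on the left, but in neither of those of the intersection
  and the union.\<close>

lemma uncross:
  fixes y :: "'e \<Rightarrow> rat"
  shows "sum y (cutE U) + sum y (cutE W) =
    sum y (cutE (U \<inter> W)) + sum y (cutE (U \<union> W)) + 2 * sum y (betweenE (U - W) (W - U))"
proof -
  have "(\<Sum>e\<in>E. of_bool (e \<in> cutE U) * y e + of_bool (e \<in> cutE W) * y e) =
    (\<Sum>e\<in>E. of_bool (e \<in> cutE (U \<inter> W)) * y e + of_bool (e \<in> cutE (U \<union> W)) * y e +
       2 * (of_bool (e \<in> betweenE (U - W) (W - U)) * y e))"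
  proof (rule sum.cong)
    fix e assume e: "e \<in> E"
    then obtain a b where ab: "ends e = {a, b}" "a \<noteq> b" by (rule edgeE)
    show "of_bool (e \<in> cutE U) * y e + of_bool (e \<in> cutE W) * y e =
       of_bool (e \<in> cutE (U \<inter> W)) * y e + of_bool (e \<in> cutE (U \<union> W)) * y e +
       2 * (of_bool (e \<in> betweenE (U - W) (W - U)) * y e)"
      unfolding in_cut[OF e ab] in_between[OF e ab(1)]
      by (cases "a \<in> U"; cases "b \<in> U"; cases "a \<in> W"; cases "b \<in> W") auto
  qed simp
  thus ?thesis by (simp only: sum_cut sum_between sum.distrib sum_distrib_left)
qed

lemma cut_disjoint_union:
  fixes y :: "'e \<Rightarrow> rat"
  assumes "X \<inter> Y = {}"
  shows "sum y (cutE (X \<union> Y)) = sum y (cutE X) + sum y (cutE Y) - 2 * sum y (betweenE X Y)"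
proof -
  have "X - Y = X" "Y - X = Y" using assms by auto
  moreover have "cutE {} = {}" by (auto simp: cut_def)
  ultimately show ?thesis using uncross[of y X Y] assms by simp
qed

lemma between_nonneg: "\<forall>e. y e \<ge> 0 \<Longrightarrow> sum y (betweenE X Y) \<ge> 0" for y :: "'e \<Rightarrow> rat"
  by (rule sum_nonneg) auto

lemma pms_subset: "M \<in> PM \<Longrightarrow> M \<subseteq> E"
  by (auto simp: pms_def perfect_matching_def)

lemma finite_pm: "M \<in> PM \<Longrightarrow> finite M"
  using pms_subset finite_E finite_subset by blast

lemma sum_ind: "finite S \<Longrightarrow> sum (ind M) S = of_nat (card (M \<inter> S))"
proof -
  assume S: "finite S"
  have "sum (ind M) S = (\<Sum>e\<in>S \<inter> M. 1)"
    unfolding sum.inter_restrict[OF S] by (rule sum.cong) (auto simp: ind_def)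
  thus ?thesis by (simp add: Int_commute)
qed

lemma pm_degree:
  assumes "M \<in> PM" "v \<in> V"
  shows "card (M \<inter> cutE {v}) = 1"
proof -
  have "M \<inter> cutE {v} = {e \<in> M. v \<in> ends e}"
    using cut_single[OF assms(2)] pms_subset[OF assms(1)] by auto
  thus ?thesis using assms by (simp add: pms_def perfect_matching_def)
qed

lemma pm_edge_unique:
  assumes "M \<in> PM" "v \<in> V" "e \<in> M" "f \<in> M" "v \<in> ends e" "v \<in> ends f"
  shows "e = f"
proof -
  have "card {e \<in> M. v \<in> ends e} = 1" using assms by (simp add: pms_def perfect_matching_def)
  then obtain g where "{e \<in> M. v \<in> ends e} = {g}" by (auto simp: card_1_singleton_iff)
  moreover have "e \<in> {e \<in> M. v \<in> ends e}" "f \<in> {e \<in> M. v \<in> ends e}" using assms by auto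
  ultimately show ?thesis by simp
qed

lemma pm_edge_exists:
  assumes "M \<in> PM" "v \<in> V"
  obtains e where "e \<in> M" "v \<in> ends e"
proof -
  have "card {e \<in> M. v \<in> ends e} = 1" using assms by (simp add: pms_def perfect_matching_def)
  hence "{e \<in> M. v \<in> ends e} \<noteq> {}" by (metis card.empty zero_neq_one)
  thus ?thesis using that by blast
qed

lemma pm_card:
  assumes M: "M \<in> PM" and X: "X \<subseteq> V"
  shows "card X = card (M \<inter> cutE X) + 2 * card (M \<inter> innerE X)"
proof -
  have "(\<Sum>v\<in>X. sum (ind M) (cutE {v})) = (\<Sum>v\<in>X. 1)"
    by (rule sum.cong) (use pm_degree[OF M] X in \<open>auto simp: sum_ind\<close>)
  hence "(of_nat (card X) :: rat) = of_nat (card (M \<inter> cutE X)) + 2 * of_nat (card (M \<inter> innerE X))"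
    using sum_degrees[OF X, of "ind M"] by (simp add: sum_ind)
  hence "(of_nat (card X) :: rat) = of_nat (card (M \<inter> cutE X) + 2 * card (M \<inter> innerE X))"
    by simp
  thus ?thesis by (simp only: of_nat_eq_iff)
qed

lemma pm_cut_odd:
  assumes "M \<in> PM" "X \<subseteq> V" "odd (card X)"
  shows "odd (card (M \<inter> cutE X))"
  using pm_card[OF assms(1,2)] assms(3) by presburger

lemma pm_matching:
  assumes M: "M \<in> PM"
  shows "matching ends M" "covered ends M = V"
proof -
  have E: "e \<in> E" if "e \<in> M" for e using that pms_subset[OF M] by blast
  have two: "card (ends e) = 2 \<and> ends e \<subseteq> V" if "e \<in> M" for e
    using E[OF that] graph by (auto simp: graph_def)
  show "matching ends M"
    unfolding matching_def
  proof (intro conjI ballI impI)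
    fix e f assume ef: "e \<in> M" "f \<in> M" "e \<noteq> f"
    show "ends e \<inter> ends f = {}"
    proof (rule ccontr)
      assume "ends e \<inter> ends f \<noteq> {}"
      then obtain v where v: "v \<in> ends e" "v \<in> ends f" by blast
      hence "v \<in> V" using two[OF ef(1)] by blast
      thus False using pm_edge_unique[OF M _ ef(1,2) v] ef(3) by blast
    qed
  qed (use two in blast)
  show "covered ends M = V"
    using two pm_edge_exists[OF M] by blast
qed

lemma matching_pm:
  assumes "M \<subseteq> E" "matching ends M" "covered ends M = V"
  shows "M \<in> PM"
proof -
  have "card {e \<in> M. v \<in> ends e} = 1" if "v \<in> V" for v
  proof -
    have "v \<in> covered ends M" using that assms(3) by simp
    then obtain e where e: "e \<in> M" "v \<in> ends e" by blast
    have "f = e" if "f \<in> M" "v \<in> ends f" for f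
      using assms(2) e that unfolding matching_def by auto
    hence "{e \<in> M. v \<in> ends e} = {e}" using e by blast
    thus ?thesis by simp
  qed
  thus ?thesis using assms(1) by (simp add: pms_def perfect_matching_def)
qed

end

subsection \<open>Contracting tight cuts\<close>

lemma sum_fun_upd_diff:
  fixes a f :: "'a \<Rightarrow> rat"
  assumes "finite A" "i \<in> A"
  shows "(\<Sum>j\<in>A. (a(i := a i - t)) j * f j) = (\<Sum>j\<in>A. a j * f j) - t * f i"
proof -
  have "(\<Sum>j\<in>A. (a(i := a i - t)) j * f j) = (a i - t) * f i + (\<Sum>j\<in>A - {i}. (a(i := a i - t)) j * f j)"
    using sum.remove[OF assms, of "\<lambda>j. (a(i := a i - t)) j * f j"] by simp
  also have "(\<Sum>j\<in>A - {i}. (a(i := a i - t)) j * f j) = (\<Sum>j\<in>A - {i}. a j * f j)"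
    by (rule sum.cong) auto
  finally show ?thesis using sum.remove[OF assms, of "\<lambda>j. a j * f j"] by (simp add: algebra_simps)
qed

lemma sum_pos_exists:
  fixes f :: "'a \<Rightarrow> rat"
  assumes "sum f A > 0"
  shows "\<exists>i\<in>A. f i > 0"
  using assms by (meson not_le sum_nonpos)

text \<open>The contracted vertex is represented by an element \<open>u\<close> of \<open>U\<close>,
  and the edges keep their names. Thus vectors and matchings of the contracted graph have the same
  types as those of the original one and can be compared edge by edge.\<close>

definition contract_ends :: "'v set \<Rightarrow> 'v \<Rightarrow> ('e \<Rightarrow> 'v set) \<Rightarrow> 'e \<Rightarrow> 'v set" where
  "contract_ends U u ends e = (\<lambda>v. if v \<in> U then u else v) ` ends e"

context mgraph
begin

lemma contract_graph:
  assumes "U \<subseteq> V" "u \<in> U"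
  shows "graph (insert u (V - U)) (E - innerE U) (contract_ends U u ends)"
proof -
  have "contract_ends U u ends e \<subseteq> insert u (V - U) \<and> card (contract_ends U u ends e) = 2"
    if e: "e \<in> E - innerE U" for e
  proof -
    have eE: "e \<in> E" using e by simp
    then obtain a b where ab: "ends e = {a, b}" "a \<noteq> b" "a \<in> V" "b \<in> V" by (rule edgeE)
    let ?a = "if a \<in> U then u else a" and ?b = "if b \<in> U then u else b"
    have c: "contract_ends U u ends e = {?a, ?b}" by (simp add: contract_ends_def ab(1))
    have "\<not> (a \<in> U \<and> b \<in> U)" using e in_inner[OF eE ab(1)] by auto
    hence "?a \<noteq> ?b" using ab(2) assms(2) by auto
    moreover have "?a \<in> insert u (V - U)" "?b \<in> insert u (V - U)" using ab by auto
    ultimately show ?thesis unfolding c by simp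
  qed
  thus ?thesis by (simp add: graph_def)
qed

lemma contract_in_ends:
  assumes "v \<notin> U" "u \<in> U"
  shows "v \<in> contract_ends U u ends e \<longleftrightarrow> v \<in> ends e"
proof
  assume "v \<in> ends e"
  hence "(if v \<in> U then u else v) \<in> contract_ends U u ends e" unfolding contract_ends_def by (rule imageI)
  thus "v \<in> contract_ends U u ends e" using assms by simp
next
  assume "v \<in> contract_ends U u ends e"
  then obtain w where "w \<in> ends e" "v = (if w \<in> U then u else w)" unfolding contract_ends_def by blast
  thus "v \<in> ends e" using assms by (simp split: if_splits)
qed

lemma contract_cut:
  assumes U: "U \<subseteq> V" "u \<in> U" and X: "X \<subseteq> insert u (V - U)"
  shows "cut (E - innerE U) (contract_ends U u ends) X =
    cutE (if u \<in> X then (X - {u}) \<union> U else X)"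
proof (intro set_eqI)
  fix e
  let ?X = "if u \<in> X then (X - {u}) \<union> U else X"
  interpret c: mgraph "insert u (V - U)" "E - innerE U" "contract_ends U u ends"
    using contract_graph[OF U] by unfold_locales
  show "e \<in> cut (E - innerE U) (contract_ends U u ends) X \<longleftrightarrow> e \<in> cutE ?X"
  proof (cases "e \<in> E")
    case True
    then obtain a b where ab: "ends e = {a, b}" "a \<noteq> b" "a \<in> V" "b \<in> V" by (rule edgeE)
    show ?thesis
    proof (cases "a \<in> U \<and> b \<in> U")
      case True
      thus ?thesis using in_cut[OF \<open>e \<in> E\<close> ab(1,2)] in_inner[OF \<open>e \<in> E\<close> ab(1)] X U
        by (auto simp: cut_def[of "E - innerE U"])
    next
      case False
      let ?h = "\<lambda>v. if v \<in> U then u else v"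
      have e: "e \<in> E - innerE U" using False in_inner[OF True ab(1)] True by simp
      have ab': "contract_ends U u ends e = {?h a, ?h b}" "?h a \<noteq> ?h b"
        using ab(2) False U(2) by (simp add: contract_ends_def ab(1), auto)
      show ?thesis
        unfolding c.in_cut[OF e ab'] in_cut[OF True ab(1,2)] using X U ab False by auto
    qed
  qed (auto simp: cut_def)
qed

text \<open>Tightness of the cut of \<open>U\<close> is the degree condition at the new vertex. Odd
  cuts are inherited because replacing \<open>u\<close> by the odd set \<open>U\<close> preserves
  parity.\<close>

lemma contract_mcone:
  assumes U: "U \<subseteq> V" "u \<in> U" "odd (card U)" and x: "x \<in> mcone V E ends"
    and tight: "\<And>v. v \<in> V \<Longrightarrow> sum x (cutE U) = sum x (cutE {v})"
  shows "(\<lambda>e. if e \<in> E - innerE U then x e else 0)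
    \<in> mcone (insert u (V - U)) (E - innerE U) (contract_ends U u ends)"
proof -
  obtain r where x0: "\<forall>e. x e \<ge> 0" "\<forall>e. e \<notin> E \<longrightarrow> x e = 0" "\<forall>v\<in>V. sum x (cutE {v}) = r"
    "\<forall>X\<subseteq>V. odd (card X) \<longrightarrow> r \<le> sum x (cutE X)"
    using x unfolding mcone_def by blast
  let ?y = "\<lambda>e. if e \<in> E - innerE U then x e else 0"
  let ?cut = "cut (E - innerE U) (contract_ends U u ends)"
  have y: "sum ?y (?cut X) = sum x (cutE (if u \<in> X then (X - {u}) \<union> U else X))"
    if "X \<subseteq> insert u (V - U)" for X
  proof -
    have "sum ?y (?cut X) = sum x (?cut X)" by (rule sum.cong) (auto simp: cut_def)
    thus ?thesis using contract_cut[OF U(1,2) that] by simp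
  qed
  have "sum ?y (?cut {v}) = r" if "v \<in> insert u (V - U)" for v
    using y[of "{v}"] that tight x0(3) U by (cases "v = u") auto
  moreover have "r \<le> sum ?y (?cut X)" if X: "X \<subseteq> insert u (V - U)" "odd (card X)" for X
  proof -
    have fin: "finite X" by (rule finite_subset[OF X(1)]) simp
    have "odd (card (if u \<in> X then (X - {u}) \<union> U else X))"
    proof (cases "u \<in> X")
      case True
      have "card ((X - {u}) \<union> U) = card (X - {u}) + card U"
        using X(1) fin U(1) by (intro card_Un_disjoint) (auto intro: finite_subset_V)
      thus ?thesis using True fin X(2) U(3) by (simp add: card_Diff_singleton_if)
    qed (use X in simp)
    moreover have "(if u \<in> X then (X - {u}) \<union> U else X) \<subseteq> V" using X(1) U by auto
    ultimately show ?thesis using x0(4) y[OF X(1)] by simp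
  qed
  ultimately show ?thesis using x0(1,2) unfolding mcone_def by auto
qed

lemma contract_pm_cut_edge:
  assumes U: "U \<subseteq> V" "u \<in> U"
    and M: "M \<in> pms (insert u (V - U)) (E - innerE U) (contract_ends U u ends)"
  obtains g where "M \<inter> cutE U = {g}" "M \<subseteq> E - innerE U"
proof -
  interpret c: mgraph "insert u (V - U)" "E - innerE U" "contract_ends U u ends"
    using contract_graph[OF U] by unfold_locales
  have "card (M \<inter> cut (E - innerE U) (contract_ends U u ends) {u}) = 1"
    using c.pm_degree[OF M] by simp
  hence "card (M \<inter> cutE U) = 1" using contract_cut[OF U, of "{u}"] by simp
  then obtain g where "M \<inter> cutE U = {g}" by (rule card_1_singletonE)
  thus ?thesis using that c.pms_subset[OF M] by blast
qed

text \<open>An edge outside the cut lies inside one of the two sides, so the matchings can interfere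
  only in the cut, where both consist of \<open>g\<close>.\<close>

lemma glue_pms:
  assumes U: "U \<subseteq> V" "u \<in> U" and w: "w \<in> V - U"
    and M1: "M1 \<in> pms (insert u (V - U)) (E - innerE U) (contract_ends U u ends)"
    and M2: "M2 \<in> pms (insert w (V - (V - U))) (E - innerE (V - U)) (contract_ends (V - U) w ends)"
    and g: "M1 \<inter> cutE U = {g}" "M2 \<inter> cutE U = {g}"
  shows "M1 \<union> M2 \<in> PM"
    and "\<And>e. e \<in> E - innerE U \<Longrightarrow> ind (M1 \<union> M2) e = ind M1 e"
    and "\<And>e. e \<in> E - innerE (V - U) \<Longrightarrow> ind (M1 \<union> M2) e = ind M2 e"
proof -
  have s1: "M1 \<subseteq> E - innerE U" and s2: "M2 \<subseteq> E - innerE (V - U)"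
    using M1 M2 by (auto simp: pms_def perfect_matching_def)
  have cutI: "e \<in> cutE U" if "e \<in> E" "e \<notin> innerE U" "e \<notin> innerE (V - U)" for e
  proof -
    note e = that
    obtain a b where ab: "ends e = {a, b}" "a \<noteq> b" "a \<in> V" "b \<in> V" using e(1) by (rule edgeE)
    show ?thesis using e ab(3,4) in_cut[OF e(1) ab(1,2)] in_inner[OF e(1) ab(1)] by auto
  qed
  have m1: "e \<in> M1" if "e \<in> M2" "e \<in> E - innerE U" for e
    using that s2 cutI[of e] g by blast
  have m2: "e \<in> M2" if "e \<in> M1" "e \<in> E - innerE (V - U)" for e
    using that s1 cutI[of e] g by blast
  show "ind (M1 \<union> M2) e = ind M1 e" if "e \<in> E - innerE U" for e
    using m1 that by (auto simp: ind_def)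
  show "ind (M1 \<union> M2) e = ind M2 e" if "e \<in> E - innerE (V - U)" for e
    using m2 that by (auto simp: ind_def)
  have "card {e \<in> M1 \<union> M2. v \<in> ends e} = 1" if v: "v \<in> V" for v
  proof (cases "v \<in> U")
    case False
    have "e \<notin> innerE U" if "v \<in> ends e" for e using that False by (auto simp: inner_def)
    hence "{e \<in> M1 \<union> M2. v \<in> ends e} = {e \<in> M1. v \<in> contract_ends U u ends e}"
      using contract_in_ends[of v U u] False U(2) s1 s2 m1 by blast
    thus ?thesis using M1 v False by (simp add: pms_def perfect_matching_def)
  next
    case True
    have "e \<notin> innerE (V - U)" if "v \<in> ends e" for e using that True by (auto simp: inner_def)
    hence "{e \<in> M1 \<union> M2. v \<in> ends e} = {e \<in> M2. v \<in> contract_ends (V - U) w ends e}"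
      using contract_in_ends[of v "V - U" w] True w s1 s2 m2 by blast
    thus ?thesis using M2 v True by (simp add: pms_def perfect_matching_def)
  qed
  thus "M1 \<union> M2 \<in> PM" using s1 s2 by (auto simp: pms_def perfect_matching_def)
qed

text \<open>A matching of one side is paired with one of the other side that uses the same cut edge,
  and the union is taken off with the smaller of the two coefficients. Each round makes a
  coefficient vanish, so the number of positive coefficients drops.\<close>

lemma glue_dcone:
  assumes U: "U \<subseteq> V" "u \<in> U" and w: "w \<in> V - U" and x0: "\<forall>e. e \<notin> E \<longrightarrow> x e = 0"
    and x1: "(\<lambda>e. if e \<in> E - innerE U then x e else 0)
      \<in> dcone (insert u (V - U)) (E - innerE U) (contract_ends U u ends)"
    and x2: "(\<lambda>e. if e \<in> E - innerE (V - U) then x e else 0)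
      \<in> dcone (insert w (V - (V - U))) (E - innerE (V - U)) (contract_ends (V - U) w ends)"
  shows "x \<in> dcone V E ends"
proof -
  let ?E1 = "E - innerE U" and ?E2 = "E - innerE (V - U)"
  let ?P1 = "pms (insert u (V - U)) ?E1 (contract_ends U u ends)"
  let ?P2 = "pms (insert w (V - (V - U))) ?E2 (contract_ends (V - U) w ends)"
  have fin: "finite ?P1" "finite ?P2" by simp_all
  have W: "V - U \<subseteq> V" by blast
  have cutE: "cutE U \<subseteq> ?E1" "cutE U \<subseteq> ?E2" and E12: "E \<subseteq> ?E1 \<union> ?E2"
  proof -
    have "(e \<in> cutE U \<longrightarrow> e \<in> ?E1 \<and> e \<in> ?E2) \<and> e \<in> ?E1 \<union> ?E2" if e: "e \<in> E" for e
    proof -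
      obtain a b where ab: "ends e = {a, b}" "a \<noteq> b" using e by (rule edgeE)
      show ?thesis using in_cut[OF e ab] in_inner[OF e ab(1)] e by auto
    qed
    thus "cutE U \<subseteq> ?E1" "cutE U \<subseteq> ?E2" "E \<subseteq> ?E1 \<union> ?E2" using cut_subset by blast+
  qed
  have main: "x \<in> dcone V E ends"
    if "\<forall>e. e \<notin> E \<longrightarrow> x e = 0" "\<forall>M\<in>?P1. a M \<ge> 0 \<and> qdyadic (a M)" "\<forall>M\<in>?P2. b M \<ge> 0 \<and> qdyadic (b M)"
      "\<forall>e\<in>?E1. x e = (\<Sum>M\<in>?P1. a M * ind M e)" "\<forall>e\<in>?E2. x e = (\<Sum>M\<in>?P2. b M * ind M e)" for x a b
    using that
  proof (induction "card {M \<in> ?P1. a M > 0} + card {M \<in> ?P2. b M > 0}" arbitrary: x a b rule: less_induct)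
    case less
    note pr = less.prems
    show ?case
    proof (cases "\<exists>M1\<in>?P1. a M1 > 0")
      case True
      then obtain M1 where M1: "M1 \<in> ?P1" "a M1 > 0" by blast
      obtain g where g: "M1 \<inter> cutE U = {g}" and "M1 \<subseteq> ?E1"
        by (rule contract_pm_cut_edge[OF U M1(1)])
      have "g \<in> M1 \<inter> cutE U" unfolding g by simp
      hence gcut: "g \<in> cutE U" and gM1: "g \<in> M1" by simp_all
      hence gE: "g \<in> ?E1" "g \<in> ?E2" "g \<in> M1" using cutE by auto
      have "a M1 * ind M1 g \<le> (\<Sum>M\<in>?P1. a M * ind M g)"
        by (rule member_le_sum) (use M1 pr(2) in \<open>auto simp: ind_def\<close>)
      \<comment> \<open>Both decompositions represent the weight of the cut edge \<open>g\<close>,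
        so the second one also has a matching through \<open>g\<close> with positive
        coefficient.\<close>
      hence "x g > 0" using pr(4) gE M1(2) by (simp add: ind_def)
      hence "(\<Sum>M\<in>?P2. b M * ind M g) > 0" using pr(5) gE by simp
      then obtain M2 where M2: "M2 \<in> ?P2" "b M2 * ind M2 g > 0" using sum_pos_exists by blast
      have M2': "g \<in> M2" "b M2 > 0" using M2(2) by (auto simp: ind_def split: if_splits)
      obtain g' where "M2 \<inter> cutE (V - U) = {g'}" and "M2 \<subseteq> ?E2"
        by (rule contract_pm_cut_edge[OF W w M2(1)])
      hence g': "M2 \<inter> cutE U = {g'}" unfolding cut_compl by simp
      have "g \<in> M2 \<inter> cutE U" using M2'(1) gcut by simp
      hence g2: "M2 \<inter> cutE U = {g}" unfolding g' by simp
      note glue = glue_pms[OF U w M1(1) M2(1) g g2]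
      define t where "t = min (a M1) (b M2)"
      have t: "t > 0" "t \<le> a M1" "t \<le> b M2" "qdyadic t"
        using M1 M2 M2' pr(2,3) by (auto simp: t_def min_def)
      define a' where "a' = a(M1 := a M1 - t)"
      define b' where "b' = b(M2 := b M2 - t)"
      define x' where "x' e = x e - t * ind (M1 \<union> M2) e" for e
      have sub: "{M \<in> ?P1. a' M > 0} \<subseteq> {M \<in> ?P1. a M > 0}" "{M \<in> ?P2. b' M > 0} \<subseteq> {M \<in> ?P2. b M > 0}"
        using M1 M2' t by (auto simp: a'_def b'_def)
      have "card {M \<in> ?P1. a' M > 0} + card {M \<in> ?P2. b' M > 0} < card {M \<in> ?P1. a M > 0} + card {M \<in> ?P2. b M > 0}"
      proof (cases "t = a M1")
        case True
        hence "M1 \<notin> {M \<in> ?P1. a' M > 0}" by (simp add: a'_def)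
        hence "{M \<in> ?P1. a' M > 0} \<subset> {M \<in> ?P1. a M > 0}" using sub(1) M1 by blast
        hence "card {M \<in> ?P1. a' M > 0} < card {M \<in> ?P1. a M > 0}" by (intro psubset_card_mono) auto
        moreover have "card {M \<in> ?P2. b' M > 0} \<le> card {M \<in> ?P2. b M > 0}" by (intro card_mono sub) auto
        ultimately show ?thesis by simp
      next
        case False
        hence "t = b M2" by (auto simp: t_def min_def)
        hence "M2 \<notin> {M \<in> ?P2. b' M > 0}" by (simp add: b'_def)
        hence "{M \<in> ?P2. b' M > 0} \<subset> {M \<in> ?P2. b M > 0}" using sub(2) M2(1) M2' by blast
        hence "card {M \<in> ?P2. b' M > 0} < card {M \<in> ?P2. b M > 0}" by (intro psubset_card_mono) auto
        moreover have "card {M \<in> ?P1. a' M > 0} \<le> card {M \<in> ?P1. a M > 0}" by (intro card_mono sub) auto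
        ultimately show ?thesis by simp
      qed
      moreover have "\<forall>e. e \<notin> E \<longrightarrow> x' e = 0"
        using pr(1) pms_subset[OF glue(1)] by (auto simp: x'_def ind_def)
      moreover have "\<forall>M\<in>?P1. a' M \<ge> 0 \<and> qdyadic (a' M)" "\<forall>M\<in>?P2. b' M \<ge> 0 \<and> qdyadic (b' M)"
        using pr(2,3) t M1(1) M2(1) by (auto simp: a'_def b'_def)
      moreover have "\<forall>e\<in>?E1. x' e = (\<Sum>M\<in>?P1. a' M * ind M e)"
        unfolding a'_def sum_fun_upd_diff[OF fin(1) M1(1), of a t] using pr(4) glue(2) by (simp add: x'_def)
      moreover have "\<forall>e\<in>?E2. x' e = (\<Sum>M\<in>?P2. b' M * ind M e)"
        unfolding b'_def sum_fun_upd_diff[OF fin(2) M2(1), of b t] using pr(5) glue(3) by (simp add: x'_def)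
      ultimately have "x' \<in> dcone V E ends" by (rule less.hyps)
      hence "(\<lambda>e. 1 * x' e + t * ind (M1 \<union> M2) e) \<in> dcone V E ends"
        using ind_in_dcone[OF finite_E glue(1)] t by (intro dcone_comb) auto
      thus ?thesis by (simp add: x'_def)
    next
      case False
      hence a0: "a M = 0" if "M \<in> ?P1" for M using pr(2) that by force
      have x1: "x e = 0" if "e \<in> ?E1" for e using pr(4) that a0 by simp
      \<comment> \<open>Every matching of the second side contains a cut edge, where
        \<open>x\<close> is already known to vanish.\<close>
      have b0: "b M = 0" if M: "M \<in> ?P2" for M
      proof -
        obtain g where "M \<inter> cutE (V - U) = {g}" and "M \<subseteq> ?E2"
          by (rule contract_pm_cut_edge[OF W w M])
        hence "g \<in> M \<inter> cutE U" unfolding cut_compl by simp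
        hence g: "g \<in> M" "g \<in> cutE U" by simp_all
        have "b M * ind M g \<le> (\<Sum>M\<in>?P2. b M * ind M g)"
          by (rule member_le_sum) (use M pr(3) in \<open>auto simp: ind_def\<close>)
        also have "(\<Sum>M\<in>?P2. b M * ind M g) = x g" using pr(5) g(2) cutE(2) by auto
        also have "x g = 0" using x1 g(2) cutE(1) by blast
        finally have "b M \<le> 0" using g(1) by (simp add: ind_def)
        thus ?thesis using pr(3) M by force
      qed
      have "x e = 0" if "e \<in> ?E2" for e using pr(5) that b0 by simp
      hence "x = (\<lambda>_. 0)" using x1 pr(1) E12 by blast
      thus ?thesis using dcone_0 by simp
    qed
  qed
  obtain a where a: "\<forall>M\<in>?P1. a M \<ge> 0 \<and> qdyadic (a M)"
    "\<forall>e. (if e \<in> ?E1 then x e else 0) = (\<Sum>M\<in>?P1. a M * ind M e)" using x1 unfolding dcone_def by blast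
  obtain b where b: "\<forall>M\<in>?P2. b M \<ge> 0 \<and> qdyadic (b M)"
    "\<forall>e. (if e \<in> ?E2 then x e else 0) = (\<Sum>M\<in>?P2. b M * ind M e)" using x2 unfolding dcone_def by blast
  have "x e = (\<Sum>M\<in>?P1. a M * ind M e)" if "e \<in> ?E1" for e using a(2)[rule_format, of e] that by simp
  moreover have "x e = (\<Sum>M\<in>?P2. b M * ind M e)" if "e \<in> ?E2" for e using b(2)[rule_format, of e] that by simp
  ultimately show ?thesis using main[OF x0 a(1) b(1)] by blast
qed

end

subsection \<open>Points in the interior of the cone\<close>

text \<open>The induction hypotheses enter as \<open>edge_IH\<close> (after deleting an edge) and
  \<open>cut_IH\<close> (after contracting a tight cut); together they cover every dyadic boundary
  point of the cone, not only points near \<open>x\<close>. From six vertices on there are odd sets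
  with at least three vertices on either side.\<close>

locale interior = mgraph V E ends
  for V :: "'v set" and E :: "'e set" and ends :: "'e \<Rightarrow> 'v set" +
  fixes x :: "'e \<Rightarrow> rat"
  assumes even_V: "even (card V)" and card_V: "card V \<ge> 6"
    and x_mcone: "x \<in> mcone V E ends" and x_dyadic: "\<And>e. qdyadic (x e)"
    and x_edge: "\<And>e. e \<in> E \<Longrightarrow> x e > 0"
    and x_cut: "\<And>X v. X \<subseteq> V \<Longrightarrow> odd (card X) \<Longrightarrow> 3 \<le> card X \<Longrightarrow> card X + 3 \<le> card V \<Longrightarrow> v \<in> V \<Longrightarrow>
      sum x (cutE {v}) < sum x (cutE X)"
    and edge_IH: "\<And>y e. y \<in> mcone V E ends \<Longrightarrow> (\<And>e. qdyadic (y e)) \<Longrightarrow> e \<in> E \<Longrightarrow> y e = 0 \<Longrightarrow>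
      y \<in> dcone V E ends"
    and cut_IH: "\<And>y X. y \<in> mcone V E ends \<Longrightarrow> (\<And>e. qdyadic (y e)) \<Longrightarrow>
      X \<subseteq> V \<Longrightarrow> odd (card X) \<Longrightarrow> 3 \<le> card X \<Longrightarrow> card X + 3 \<le> card V \<Longrightarrow>
      (\<And>v. v \<in> V \<Longrightarrow> sum y (cutE X) = sum y (cutE {v})) \<Longrightarrow> y \<in> dcone V E ends"
begin

definition v0 :: 'v where "v0 = (SOME v. v \<in> V)"

lemma v0: "v0 \<in> V"
proof -
  have "V \<noteq> {}" using card_V by auto
  thus ?thesis unfolding v0_def by (simp add: some_in_eq)
qed

text \<open>Reading the degree at one fixed vertex gives a linear functional on all functions, which
  on \<open>L\<close> is the common degree.\<close>

definition vdeg :: "('e \<Rightarrow> rat) \<Rightarrow> rat" where "vdeg y = sum y (cutE {v0})"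

definition excess :: "'v set \<Rightarrow> ('e \<Rightarrow> rat) \<Rightarrow> rat" where
  "excess X y = sum y (cutE X) - vdeg y"

definition L :: "('e \<Rightarrow> rat) set" where
  "L = {y. (\<forall>e. e \<notin> E \<longrightarrow> y e = 0) \<and> (\<forall>v\<in>V. sum y (cutE {v}) = vdeg y)}"

text \<open>Singletons and their complements are excluded: their excess is identically 0 on
  \<open>L\<close>, so no point would have positive slack for them.\<close>

definition odds :: "'v set set" where
  "odds = {X. X \<subseteq> V \<and> odd (card X) \<and> 3 \<le> card X \<and> card X + 3 \<le> card V}"

definition K :: "('e + 'v set) set" where "K = Inl ` E \<union> Inr ` odds"

definition slack :: "'e + 'v set \<Rightarrow> ('e \<Rightarrow> rat) \<Rightarrow> rat" where
  "slack k y = (case k of Inl e \<Rightarrow> y e | Inr X \<Rightarrow> excess X y)"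

lemma slack_simps [simp]: "slack (Inl e) y = y e" "slack (Inr X) y = excess X y"
  by (auto simp: slack_def)

lemma sum_lin: "sum (\<lambda>e. s * y e + t * z e) S = s * sum y S + t * sum z S" for y z :: "'e \<Rightarrow> rat"
  by (simp add: sum.distrib sum_distrib_left)

lemma vdeg_lin: "vdeg (\<lambda>e. s * y e + t * z e) = s * vdeg y + t * vdeg z"
  by (simp add: vdeg_def sum_lin)

lemma excess_lin: "excess X (\<lambda>e. s * y e + t * z e) = s * excess X y + t * excess X z"
  by (simp add: excess_def sum_lin vdeg_lin algebra_simps)

lemma slack_lin: "slack k (\<lambda>e. s * y e + t * z e) = s * slack k y + t * slack k z"
  by (cases k) (simp_all add: excess_lin)

lemma L_lin: "y \<in> L \<Longrightarrow> z \<in> L \<Longrightarrow> (\<lambda>e. s * y e + t * z e) \<in> L"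
  by (auto simp: L_def sum_lin vdeg_lin)

lemma L_degree: "y \<in> L \<Longrightarrow> v \<in> V \<Longrightarrow> sum y (cutE {v}) = vdeg y"
  by (simp add: L_def)

lemma L_zero: "y \<in> L \<Longrightarrow> e \<notin> E \<Longrightarrow> y e = 0"
  by (simp add: L_def)

lemma oddsD:
  assumes "X \<in> odds"
  shows "X \<subseteq> V" "odd (card X)" "3 \<le> card X" "card X + 3 \<le> card V"
  using assms by (auto simp: odds_def)

lemma finite_odds: "finite odds"
  by (rule finite_subset[of _ "Pow V"]) (auto simp: odds_def)

lemma odds_compl:
  assumes "X \<in> odds"
  shows "V - X \<in> odds"
  using oddsD[OF assms] card_compl[of X] even_V unfolding odds_def by auto presburger+

lemma excess_compl: "excess (V - X) y = excess X y"
  by (simp add: excess_def cut_compl)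

lemma mcone_L:
  assumes "y \<in> mcone V E ends"
  shows "y \<in> L" "\<And>k. k \<in> K \<Longrightarrow> slack k y \<ge> 0"
proof -
  obtain r where y: "\<forall>e. y e \<ge> 0" "\<forall>e. e \<notin> E \<longrightarrow> y e = 0" "\<forall>v\<in>V. sum y (cutE {v}) = r"
    "\<forall>X\<subseteq>V. odd (card X) \<longrightarrow> r \<le> sum y (cutE X)"
    using assms unfolding mcone_def by blast
  have r: "vdeg y = r" using y(3) v0 by (simp add: vdeg_def)
  show "y \<in> L" using y r by (simp add: L_def)
  show "slack k y \<ge> 0" if "k \<in> K" for k
    using that y(1,4) r by (auto simp: K_def odds_def excess_def)
qed

sublocale cone_interior L K slack x
proof
  show "finite K" using finite_odds by (simp add: K_def)
  show "x \<in> L" by (rule mcone_L[OF x_mcone])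
  show "slack k x > 0" if "k \<in> K" for k
    using that x_edge x_cut v0 by (auto simp: K_def odds_def excess_def vdeg_def)
qed (auto intro: L_lin simp: slack_lin)

lemma K_iff [simp]: "Inl e \<in> K \<longleftrightarrow> e \<in> E" "Inr X \<in> K \<longleftrightarrow> X \<in> odds"
  by (auto simp: K_def)

lemma C_L: "y \<in> C \<Longrightarrow> y \<in> L" and C_al: "y \<in> C \<Longrightarrow> k \<in> K \<Longrightarrow> slack k y \<ge> 0"
  by (auto simp: C_def)

lemma C_nonneg: "y \<in> C \<Longrightarrow> y e \<ge> 0"
  using L_zero[of y e, OF C_L] C_al[of y "Inl e"] by (cases "e \<in> E") auto

lemma excess_single: "y \<in> L \<Longrightarrow> v \<in> V \<Longrightarrow> excess {v} y = 0"
  by (simp add: excess_def L_degree)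

lemma odd_cases:
  assumes "X \<subseteq> V" "odd (card X)"
  obtains "X \<in> odds" | v where "v \<in> V" "X = {v}" | v where "v \<in> V" "V - X = {v}"
proof -
  have c: "card (V - X) + card X = card V" by (rule card_compl[OF assms(1)])
  hence o: "odd (card (V - X))" using assms(2) even_V by presburger
  show ?thesis
  proof (cases "card X = 1")
    case True
    thus ?thesis using that(2) assms(1) by (auto simp: card_1_singleton_iff)
  next
    case False
    show ?thesis
    proof (cases "card (V - X) = 1")
      case True
      then obtain v where v: "V - X = {v}" by (rule card_1_singletonE)
      hence "v \<in> V" by blast
      thus ?thesis using that(3) v by blast
    next
      case f: False
      have "card X \<ge> 3" using False assms(2) by presburger
      moreover have "card (V - X) \<ge> 3" using f o by presburger
      ultimately show ?thesis using that(1) assms c by (simp add: odds_def)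
    qed
  qed
qed

lemma excess_nonneg:
  assumes "y \<in> C" "X \<subseteq> V" "odd (card X)"
  shows "excess X y \<ge> 0"
proof -
  have yL: "y \<in> L" using assms by (simp add: C_def)
  show ?thesis using assms(2,3)
  proof (cases rule: odd_cases)
    case 1
    thus ?thesis using C_al[OF assms(1), of "Inr X"] by simp
  next
    case (2 v)
    thus ?thesis using excess_single[OF yL] by simp
  next
    case (3 v)
    thus ?thesis using excess_single[OF yL, of v] excess_compl[of X y] by simp
  qed
qed

lemma C_mcone: "y \<in> C \<Longrightarrow> y \<in> mcone V E ends"
proof -
  assume y: "y \<in> C"
  hence yL: "y \<in> L" by (simp add: C_def)
  have "vdeg y \<le> sum y (cutE X)" if "X \<subseteq> V" "odd (card X)" for X
    using excess_nonneg[OF y that] by (simp add: excess_def)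
  thus ?thesis unfolding mcone_def
    using C_nonneg[OF y] L_zero[OF yL] L_degree[OF yL] by blast
qed

lemma C_comb: "y \<in> C \<Longrightarrow> z \<in> C \<Longrightarrow> s \<ge> 0 \<Longrightarrow> t \<ge> 0 \<Longrightarrow> (\<lambda>e. s * y e + t * z e) \<in> C"
  by (auto simp: C_def L_lin slack_lin)

lemma x_C: "x \<in> C"
  using x_L x_pos by (auto simp: C_def less_imp_le)

lemma tight_x: "tight x = {}"
  using x_pos by (fastforce simp: tight_def)

lemma pm_C:
  assumes M: "M \<in> PM"
  shows "ind M \<in> C" "vdeg (ind M) = 1" "excess X (ind M) = of_nat (card (M \<inter> cutE X)) - 1"
proof -
  have deg: "sum (ind M) (cutE {v}) = 1" if "v \<in> V" for v
    using pm_degree[OF M that] by (simp add: sum_ind)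
  show r: "vdeg (ind M) = 1" using deg v0 by (simp add: vdeg_def)
  show ex: "excess X (ind M) = of_nat (card (M \<inter> cutE X)) - 1" for X
    by (simp add: excess_def r sum_ind)
  have "slack k (ind M) \<ge> 0" if "k \<in> K" for k
  proof (cases k)
    case (Inr X)
    hence X: "X \<subseteq> V" "odd (card X)" using that by (auto simp: K_def odds_def)
    have "odd (card (M \<inter> cutE X))" by (rule pm_cut_odd[OF M X])
    hence "card (M \<inter> cutE X) \<ge> 1" using odd_pos by fastforce
    thus ?thesis using Inr ex[of X] by simp
  qed (simp add: ind_def)
  moreover have "ind M \<in> L" using deg r pms_subset[OF M] by (auto simp: L_def ind_def)
  ultimately show "ind M \<in> C" by (simp add: C_def)
qed

lemma boundary_dcone:
  assumes y: "y \<in> C" "\<And>e. qdyadic (y e)" and tight: "tight y \<noteq> {}"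
  shows "y \<in> dcone V E ends"
proof -
  have yL: "y \<in> L" using y(1) by (simp add: C_def)
  obtain k where k: "k \<in> K" "slack k y = 0" using tight by (auto simp: tight_def)
  show ?thesis
  proof (cases k)
    case (Inl e)
    thus ?thesis using k by (intro edge_IH[OF C_mcone[OF y(1)] y(2), of e]) (auto simp: K_def)
  next
    case (Inr X)
    hence X: "X \<in> odds" "excess X y = 0" using k by (auto simp: K_def)
    have "sum y (cutE X) = sum y (cutE {v})" if "v \<in> V" for v
      using X(2) L_degree[OF yL that] by (simp add: excess_def)
    thus ?thesis by (rule cut_IH[OF C_mcone[OF y(1)] y(2) oddsD[OF X(1)]])
  qed
qed

section \<open>Nonnegative rational and signed dyadic combinations of perfect matchings\<close>

definition qcone :: "('e \<Rightarrow> rat) set" where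
  "qcone = {y. \<exists>c. (\<forall>M\<in>PM. c M \<ge> 0) \<and> (\<forall>e. y e = (\<Sum>M\<in>PM. c M * ind M e))}"

definition dspan :: "('e \<Rightarrow> rat) set" where
  "dspan = {y. \<exists>c. (\<forall>M\<in>PM. qdyadic (c M)) \<and> (\<forall>e. y e = (\<Sum>M\<in>PM. c M * ind M e))}"

lemma dspan_comb:
  assumes "y \<in> dspan" "z \<in> dspan" "qdyadic s" "qdyadic t"
  shows "(\<lambda>e. s * y e + t * z e) \<in> dspan"
proof -
  obtain c where c: "\<forall>M\<in>PM. qdyadic (c M)" "\<forall>e. y e = (\<Sum>M\<in>PM. c M * ind M e)"
    using assms(1) unfolding dspan_def by blast
  obtain d where d: "\<forall>M\<in>PM. qdyadic (d M)" "\<forall>e. z e = (\<Sum>M\<in>PM. d M * ind M e)"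
    using assms(2) unfolding dspan_def by blast
  have "\<forall>M\<in>PM. qdyadic (s * c M + t * d M)" using c(1) d(1) assms(3,4) by auto
  moreover have "s * y e + t * z e = (\<Sum>M\<in>PM. (s * c M + t * d M) * ind M e)" for e
    using c(2) d(2) by (simp add: distrib_right sum.distrib sum_distrib_left mult.assoc)
  ultimately show ?thesis
    unfolding dspan_def by (intro CollectI exI[of _ "\<lambda>M. s * c M + t * d M"] conjI allI)
qed

lemma dcone_dspan: "dcone V E ends \<subseteq> dspan"
  unfolding dcone_def dspan_def by blast

lemma ind_dspan: "M \<in> PM \<Longrightarrow> ind M \<in> dspan"
  using ind_in_dcone[OF finite_E] dcone_dspan by blast

lemma clear_denominators:
  assumes "y \<in> L"
  obtains q :: nat where "q > 0" "\<forall>e. of_nat q * y e \<in> \<int>"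
proof -
  obtain q :: nat where q: "q > 0" "\<forall>e\<in>E. of_nat q * y e \<in> \<int>"
    using common_denominator[OF finite_E] by blast
  have "of_nat q * y e \<in> \<int>" for e
    using q(2) L_zero[OF assms, of e] by (cases "e \<in> E") auto
  thus ?thesis using that q(1) by blast
qed

lemma qdyadic_Ints: "a \<in> \<int> \<Longrightarrow> qdyadic a"
  by (auto elim: Ints_cases)

lemma boundary_qcone:
  assumes y: "y \<in> C" and tight: "tight y \<noteq> {}"
  shows "y \<in> qcone"
proof -
  have yL: "y \<in> L" using y by (simp add: C_def)
  obtain q :: nat where q: "q > 0" "\<forall>e. of_nat q * y e \<in> \<int>" by (rule clear_denominators[OF yL])
  let ?y = "\<lambda>e. of_nat q * y e + 0 * y e"
  have "?y \<in> C" using y q(1) by (intro C_comb) auto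
  moreover have "tight ?y = tight y" unfolding tight_def slack_lin using q(1) by simp
  moreover have "qdyadic (?y e)" for e using q(2) by (simp add: qdyadic_Ints)
  ultimately have "?y \<in> dcone V E ends" using tight by (intro boundary_dcone) auto
  then obtain c where c: "\<forall>M\<in>PM. c M \<ge> 0 \<and> qdyadic (c M)"
    "\<forall>e. ?y e = (\<Sum>M\<in>PM. c M * ind M e)" unfolding dcone_def by blast
  have "y e = (\<Sum>M\<in>PM. (c M / of_nat q) * ind M e)" for e
  proof -
    have "(\<Sum>M\<in>PM. (c M / of_nat q) * ind M e) = (\<Sum>M\<in>PM. c M * ind M e) / of_nat q"
      by (simp add: sum_divide_distrib)
    moreover have "of_nat q * y e = (\<Sum>M\<in>PM. c M * ind M e)" using c(2)[rule_format, of e] by simp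
    ultimately show ?thesis using q(1) by (metis nonzero_mult_div_cancel_left of_nat_0_eq_iff less_irrefl)
  qed
  moreover have "\<forall>M\<in>PM. c M / of_nat q \<ge> 0" using c(1) by simp
  ultimately show ?thesis unfolding qcone_def by (intro CollectI exI[of _ "\<lambda>M. c M / of_nat q"] conjI allI)
qed

section \<open>Connectivity and degrees of a graph with an interior point\<close>

lemma vdeg_x_pos: "vdeg x > 0"
proof (rule ccontr)
  assume "\<not> vdeg x > 0"
  hence r: "vdeg x = 0" using C_nonneg[OF x_C] by (simp add: vdeg_def sum_nonneg order.antisym not_less)
  \<comment> \<open>The cut of a three-element set is heavier than the degree, so it contains an
    edge of positive weight, which forces a positive degree at its ends.\<close>
  obtain S where S: "S \<subseteq> V" "card S = 3" using card_V obtain_subset_with_card_n[of 3 V] by auto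
  have "S \<in> odds" using S card_V by (simp add: odds_def)
  hence "slack (Inr S) x > 0" by (intro x_pos) (simp add: K_def)
  hence "sum x (cutE S) > 0" using r by (simp add: excess_def)
  then obtain e where e: "e \<in> cutE S" "x e > 0" using sum_pos_exists by blast
  have "e \<in> E" using e(1) cut_subset by blast
  then obtain a b where ab: "ends e = {a, b}" "a \<in> V" by (rule edgeE)
  have "e \<in> cutE {a}" using cut_single[OF ab(2)] ab(1) \<open>e \<in> E\<close> by simp
  hence "x e \<le> sum x (cutE {a})" by (intro member_le_sum) (auto simp: C_nonneg[OF x_C])
  thus False using e(2) L_degree[OF x_L ab(2)] r by simp
qed

lemma sum_zero_empty:
  assumes "S \<subseteq> E" "sum x S \<le> 0"
  shows "S = {}"
proof (rule ccontr)
  assume "S \<noteq> {}"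
  hence "sum x S > 0" using assms(1) x_edge finite_subset[OF assms(1)] by (intro sum_pos) auto
  thus False using assms(2) by simp
qed

text \<open>If no edge leaves an even set \<open>Y\<close>, then \<open>Y - {v}\<close> has the same
  cut as \<open>v\<close>. This would be a tight nontrivial odd cut once \<open>Y\<close> has at
  least four elements, which holds for \<open>X\<close> or for its complement.\<close>

lemma no_isolated_even:
  assumes X: "X \<subseteq> V" "even (card X)" "X \<noteq> {}" "X \<noteq> V"
  shows "cutE X \<noteq> {}"
proof
  assume empty: "cutE X = {}"
  have big: False if Y: "Y \<subseteq> V" "even (card Y)" "Y \<noteq> V" "card Y \<ge> 4" "cutE Y = {}" for Y
  proof -
    obtain v where v: "v \<in> Y" using Y(4) by fastforce
    have finY: "finite Y" using finite_subset_V[OF Y(1)] .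
    have c: "card (Y - {v}) = card Y - 1" using v finY by simp
    have "V - Y \<noteq> {}" using Y(1,3) by blast
    hence "card (V - Y) > 0" by (simp add: card_gt_0_iff)
    moreover have cc: "card (V - Y) + card Y = card V" by (rule card_compl[OF Y(1)])
    ultimately have "card (V - Y) \<ge> 2" using Y(2) even_V by presburger
    hence "Y - {v} \<in> odds" using Y c cc by (auto simp: odds_def)
    hence "slack (Inr (Y - {v})) x > 0" by (intro x_pos) (simp add: K_def)
    moreover have "cutE (Y - {v}) = cutE {v}"
    proof (intro set_eqI)
      fix e show "e \<in> cutE (Y - {v}) \<longleftrightarrow> e \<in> cutE {v}"
      proof (cases "e \<in> E")
        case True
        then obtain a b where ab: "ends e = {a, b}" "a \<noteq> b" by (rule edgeE)
        have "e \<notin> cutE Y" using Y(5) by simp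
        hence "(a \<in> Y) = (b \<in> Y)" unfolding in_cut[OF True ab] by simp
        thus ?thesis unfolding in_cut[OF True ab] using v ab(2) by auto
      qed (simp add: cut_def)
    qed
    ultimately show False using L_degree[OF x_L, of v] v Y(1) by (auto simp: excess_def)
  qed
  have c: "card (V - X) + card X = card V" by (rule card_compl[OF X(1)])
  show False
  proof (cases "card X \<ge> 4")
    case True
    thus False using big[OF X(1,2,4)] empty by simp
  next
    case False
    have "V - X \<noteq> V" using X(1,3) by blast
    moreover have "card (V - X) \<ge> 4" "even (card (V - X))"
      using False X(2) c card_V even_V by presburger+
    ultimately show False using big[of "V - X"] empty by (simp add: cut_compl)
  qed
qed

text \<open>Let \<open>X\<close> consist of \<open>v\<close> and its neighbours. All edges at
  \<open>v\<close> lie inside \<open>X\<close>, so the degree sum over \<open>X\<close> bounds the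
  weight of its cut by \<open>card X - 2\<close> times the degree. This excludes
  \<open>card X\<close> below 4: the bound is negative for 1, gives an isolated pair for 2, and
  contradicts the strict odd cut inequality for 3.\<close>

lemma degree_ge_3:
  assumes v: "v \<in> V"
  shows "card (cutE {v}) \<ge> 3"
proof -
  let ?N = "cutE {v}"
  define Y where "Y = (\<Union>e\<in>?N. ends e - {v})"
  define X where "X = insert v Y"
  have N: "e \<in> E" "v \<in> ends e" if "e \<in> ?N" for e using that cut_single[OF v] by auto
  have XV: "X \<subseteq> V" using N graph v by (auto simp: X_def Y_def graph_def)
  have finX: "finite X" by (rule finite_subset_V[OF XV])
  have one: "card (ends e - {v}) = 1" if "e \<in> ?N" for e
  proof -
    have "card (ends e) = 2" using N(1)[OF that] graph by (simp add: graph_def)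
    thus ?thesis using N(2)[OF that] by (simp add: card_Diff_singleton)
  qed
  have "card Y \<le> (\<Sum>e\<in>?N. card (ends e - {v}))" unfolding Y_def by (rule card_UN_le) simp
  also have "\<dots> = card ?N" using one by simp
  finally have le: "card X \<le> Suc (card ?N)"
    using finX unfolding X_def by (simp add: card_insert_if)
  have NX: "?N \<subseteq> innerE X" using N by (auto simp: inner_def X_def Y_def)
  have "vdeg x \<le> sum x (innerE X)"
    unfolding L_degree[OF x_L v, symmetric] by (rule sum_mono2) (use NX C_nonneg[OF x_C] in auto)
  moreover have "(\<Sum>w\<in>X. sum x (cutE {w})) = of_nat (card X) * vdeg x"
    using L_degree[OF x_L] XV by (simp add: subset_eq)
  ultimately have s: "sum x (cutE X) \<le> (of_nat (card X) - 2) * vdeg x"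
    using sum_degrees[OF XV, of x] by (simp add: algebra_simps)
  have "card X \<noteq> 0" using finX by (auto simp: X_def)
  moreover have "card X \<noteq> 1"
  proof
    assume "card X = 1"
    hence "sum x (cutE X) \<le> - vdeg x" using s by simp
    moreover have "sum x (cutE X) \<ge> 0" by (rule sum_nonneg) (simp add: C_nonneg[OF x_C])
    ultimately show False using vdeg_x_pos by simp
  qed
  moreover have "card X \<noteq> 2"
  proof
    assume c: "card X = 2"
    hence "sum x (cutE X) \<le> 0" using s by simp
    hence "cutE X = {}" by (rule sum_zero_empty[OF cut_subset])
    moreover have "X \<noteq> {}" "X \<noteq> V" "even (card X)" using c card_V by auto
    ultimately show False using no_isolated_even[OF XV] by blast
  qed
  moreover have "card X \<noteq> 3"
  proof
    assume c: "card X = 3"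
    hence "X \<in> odds" using XV card_V by (simp add: odds_def)
    hence "slack (Inr X) x > 0" by (intro x_pos) (simp add: K_def)
    thus False using s c by (simp add: excess_def)
  qed
  ultimately show ?thesis using le by linarith
qed

text \<open>Degrees of at least 3 give 2|E| \<ge> 3|V|. Hence there are more edges than degree
  equations, and a nonzero vector with all degrees zero exists.\<close>

lemma card_E_gt: "card E > card V"
proof -
  have cutV: "cutE V = {}" "innerE V = E"
  proof -
    show "innerE V = E" using graph by (auto simp: inner_def graph_def)
    have "cutE (V - {}) = cutE {}" by (rule cut_compl)
    thus "cutE V = {}" by (simp add: cut_def)
  qed
  have "(\<Sum>v\<in>V. sum (\<lambda>_. 1::rat) (cutE {v})) = 2 * of_nat (card E)"
    using sum_degrees[of V "\<lambda>_. 1"] cutV by simp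
  hence "(of_nat (\<Sum>v\<in>V. card (cutE {v})) :: rat) = of_nat (2 * card E)" by simp
  hence "(\<Sum>v\<in>V. card (cutE {v})) = 2 * card E" by (simp only: of_nat_eq_iff)
  moreover have "(\<Sum>v\<in>V. 3) \<le> (\<Sum>v\<in>V. card (cutE {v}))"
    by (rule sum_mono) (rule degree_ge_3)
  ultimately show ?thesis using card_V by simp
qed

section \<open>Boundary points and Edmonds' theorem\<close>

lemma kernel_vector:
  assumes A: "A \<subseteq> E" "finite B" "card B < card A"
  obtains z :: "'e \<Rightarrow> rat" where "\<exists>e\<in>A. z e \<noteq> 0" "\<forall>e. e \<notin> A \<longrightarrow> z e = 0"
    "\<forall>v\<in>B \<inter> V. sum z (cutE {v}) = 0"
proof -
  have "finite A" using A(1) finite_E finite_subset by blast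
  from underdetermined_system[OF A(2) this A(3), of "\<lambda>v e. of_bool (v \<in> ends e)"]
  obtain z :: "'e \<Rightarrow> rat" where z: "\<exists>e\<in>A. z e \<noteq> 0" "\<forall>e. e \<notin> A \<longrightarrow> z e = 0"
    "\<forall>v\<in>B. (\<Sum>e\<in>A. of_bool (v \<in> ends e) * z e) = 0" by blast
  have "sum z (cutE {v}) = 0" if "v \<in> B" "v \<in> V" for v
  proof -
    have "sum z (cutE {v}) = (\<Sum>e\<in>E. of_bool (v \<in> ends e) * z e)"
      unfolding sum_cut by (rule sum.cong) (use cut_single[OF that(2)] in auto)
    also have "\<dots> = (\<Sum>e\<in>A. of_bool (v \<in> ends e) * z e)"
      by (rule sum.mono_neutral_right) (use A(1) z(2) in auto)
    finally show ?thesis using z(3) that(1) by simp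
  qed
  thus ?thesis using that z by blast
qed

lemma L_zero_degrees:
  assumes "\<And>e. e \<notin> E \<Longrightarrow> z e = 0" "\<And>v. v \<in> V \<Longrightarrow> sum z (cutE {v}) = 0"
  shows "z \<in> L" "vdeg z = 0"
  using assms v0 by (auto simp: L_def vdeg_def)

lemma negative_entry:
  assumes z: "z \<in> L" "vdeg z = 0" "z e \<noteq> 0"
  obtains f where "f \<in> E" "z f < 0"
proof -
  have eE: "e \<in> E" using z(3) L_zero[OF z(1)] by blast
  then obtain a b where ab: "ends e = {a, b}" "a \<in> V" by (rule edgeE)
  have s: "sum z (cutE {a}) = 0" using L_degree[OF z(1) ab(2)] z(2) by simp
  have e: "e \<in> cutE {a}" using cut_single[OF ab(2)] ab(1) eE by simp
  have "\<exists>f\<in>cutE {a}. z f < 0"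
  proof (rule ccontr)
    assume "\<not> ?thesis"
    hence "\<And>f. f \<in> cutE {a} \<Longrightarrow> z f \<ge> 0" by (simp add: not_less)
    hence "z e = 0" using s e sum_nonneg_eq_0_iff[of "cutE {a}" z] by simp
    thus False using z(3) by simp
  qed
  thus ?thesis using that cut_subset by blast
qed

text \<open>Moving from \<open>x\<close> along a vector with zero degrees keeps the degree positive
  until the boundary is reached. The decomposition of such a boundary point supplies the first
  perfect matching in \<open>pm_exists\<close>.\<close>

lemma boundary_exists:
  obtains w where "w \<in> C" "tight w \<noteq> {}" "vdeg w > 0"
proof -
  obtain z :: "'e \<Rightarrow> rat" where z: "\<exists>e\<in>E. z e \<noteq> 0" "\<forall>e. e \<notin> E \<longrightarrow> z e = 0"
    "\<forall>v\<in>V \<inter> V. sum z (cutE {v}) = 0"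
    by (rule kernel_vector[OF subset_refl finite_V card_E_gt])
  have zL: "z \<in> L" "vdeg z = 0" using L_zero_degrees[of z] z(2,3) by auto
  obtain e where e: "z e \<noteq> 0" using z(1) by blast
  obtain f where f: "f \<in> E" "z f < 0" by (rule negative_entry[OF zL e])
  have k: "Inl f \<in> K" "slack (Inl f) z < 0" using f by (auto simp: K_def)
  have T0: "slack k z \<ge> 0" if "k \<in> tight x" for k using that tight_x by simp
  obtain t k where t: "t > 0" "(\<lambda>e. 1 * x e + t * z e) \<in> C" "k \<in> tight (\<lambda>e. 1 * x e + t * z e)" "slack k z < 0"
    by (rule shoot[OF x_C zL(1) k T0])
  have "vdeg (\<lambda>e. 1 * x e + t * z e) > 0" unfolding vdeg_lin using zL(2) vdeg_x_pos by simp
  thus ?thesis using that[OF t(2)] t(3) by blast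
qed

lemma vdeg_qcone:
  assumes "\<forall>e. y e = (\<Sum>M\<in>PM. c M * ind M e)"
  shows "sum y S = (\<Sum>M\<in>PM. c M * sum (ind M) S)"
proof -
  have "sum y S = (\<Sum>e\<in>S. \<Sum>M\<in>PM. c M * ind M e)" using assms by simp
  also have "\<dots> = (\<Sum>M\<in>PM. \<Sum>e\<in>S. c M * ind M e)" by (rule sum.swap)
  finally show ?thesis by (simp add: sum_distrib_left)
qed

lemma slack_qcone:
  assumes "\<forall>e. y e = (\<Sum>M\<in>PM. c M * ind M e)"
  shows "slack k y = (\<Sum>M\<in>PM. c M * slack k (ind M))"
proof (cases k)
  case (Inr X)
  thus ?thesis unfolding Inr slack_simps excess_def vdeg_def vdeg_qcone[OF assms]
    by (simp add: right_diff_distrib sum_subtractf)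
qed (use assms in simp)

lemma pm_exists: "PM \<noteq> {}"
proof -
  obtain w where w: "w \<in> C" "tight w \<noteq> {}" "vdeg w > 0" by (rule boundary_exists)
  obtain c where c: "\<forall>e. w e = (\<Sum>M\<in>PM. c M * ind M e)"
    using boundary_qcone[OF w(1,2)] unfolding qcone_def by blast
  have "sum w (cutE {v0}) > 0" using w(3) by (simp add: vdeg_def)
  thus ?thesis unfolding vdeg_qcone[OF c] by auto
qed

text \<open>From an interior point a multiple of some perfect matching is subtracted until a
  constraint becomes tight; boundary points are known to decompose.\<close>

lemma C_qcone:
  assumes y: "y \<in> C"
  shows "y \<in> qcone"
proof (cases "tight y = {}")
  case False
  thus ?thesis using boundary_qcone[OF y] by simp
next
  case True
  obtain M where M: "M \<in> PM" using pm_exists by blast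
  let ?z = "\<lambda>e. (-1) * ind M e + 0 * ind M e"
  have indL: "ind M \<in> L" using pm_C(1)[OF M] by (simp add: C_def)
  have zL: "?z \<in> L" by (rule L_lin[OF indL indL])
  obtain e where e: "e \<in> M" "v0 \<in> ends e" by (rule pm_edge_exists[OF M v0])
  have k: "Inl e \<in> K" "slack (Inl e) ?z < 0" using e pms_subset[OF M] by (auto simp: K_def ind_def)
  have T0: "slack k ?z \<ge> 0" if "k \<in> tight y" for k using that True by simp
  obtain t k where t: "t > 0" "(\<lambda>e. 1 * y e + t * ?z e) \<in> C" "k \<in> tight (\<lambda>e. 1 * y e + t * ?z e)" "slack k ?z < 0"
    by (rule shoot[OF y zL k T0])
  hence "(\<lambda>e. 1 * y e + t * ?z e) \<in> qcone" by (intro boundary_qcone) auto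
  then obtain c where c: "\<forall>N\<in>PM. c N \<ge> 0"
    "\<forall>e. 1 * y e + t * ?z e = (\<Sum>N\<in>PM. c N * ind N e)" unfolding qcone_def by blast
  \<comment> \<open>The double sign puts the increase by \<open>t\<close> into the form of
    \<open>sum_fun_upd_diff\<close>.\<close>
  define d where "d = c(M := c M - (- t))"
  have dsum: "(\<Sum>N\<in>PM. d N * ind N e) = (\<Sum>N\<in>PM. c N * ind N e) - (- t) * ind M e" for e
    unfolding d_def by (rule sum_fun_upd_diff) (use M in auto)
  hence "\<forall>e. y e = (\<Sum>N\<in>PM. d N * ind N e)"
    unfolding dsum c(2)[rule_format, symmetric] by simp
  moreover have "\<forall>N\<in>PM. d N \<ge> 0" using c(1) t(1) M by (auto simp: d_def)
  ultimately show ?thesis unfolding qcone_def by blast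
qed

text \<open>Complementary slackness: in a nonnegative decomposition of \<open>y\<close>, all
  matchings with positive coefficient satisfy the constraints tight at \<open>y\<close> with
  equality, and one of them must contribute to the slack of \<open>k\<close>.\<close>

lemma tight_pm:
  assumes y: "y \<in> C" and k: "k \<in> K" "slack k y > 0"
  obtains M where "M \<in> PM" "slack k (ind M) > 0" "\<forall>j\<in>tight y. slack j (ind M) = 0"
proof -
  obtain c where c: "\<forall>N\<in>PM. c N \<ge> 0" "\<forall>e. y e = (\<Sum>N\<in>PM. c N * ind N e)"
    using C_qcone[OF y] unfolding qcone_def by blast
  have "(\<Sum>M\<in>PM. c M * slack k (ind M)) > 0" using k(2) slack_qcone[OF c(2)] by simp
  then obtain M where M: "M \<in> PM" "c M * slack k (ind M) > 0" using sum_pos_exists by blast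
  have al0: "slack j (ind N) \<ge> 0" if "N \<in> PM" "j \<in> K" for N j
    using pm_C(1)[OF that(1)] that(2) by (simp add: C_def)
  have cM: "c M > 0" "slack k (ind M) > 0"
    using M(2) c(1) M(1) al0[OF M(1) k(1)] by (auto simp: zero_less_mult_iff)
  have "slack j (ind M) = 0" if j: "j \<in> tight y" for j
  proof -
    have jK: "j \<in> K" and "slack j y = 0" using j by (auto simp: tight_def)
    hence "(\<Sum>M\<in>PM. c M * slack j (ind M)) = 0" using slack_qcone[OF c(2)] by simp
    hence "\<forall>M\<in>PM. c M * slack j (ind M) = 0"
      by (subst (asm) sum_nonneg_eq_0_iff) (use c(1) al0 jK in auto)
    thus ?thesis using M(1) cM(1) by fastforce
  qed
  thus ?thesis using that M(1) cM(2) by blast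
qed

lemma tight_pm_edge:
  assumes y: "y \<in> C" and e: "e \<in> E" "y e > 0"
  obtains M where "M \<in> PM" "e \<in> M" "\<forall>X. Inr X \<in> tight y \<longrightarrow> card (M \<inter> cutE X) = 1"
proof -
  have k: "Inl e \<in> K" "slack (Inl e) y > 0" using e by (auto simp: K_def)
  obtain M where M: "M \<in> PM" "slack (Inl e) (ind M) > 0" "\<forall>j\<in>tight y. slack j (ind M) = 0"
    by (rule tight_pm[OF y k])
  have "e \<in> M" using M(2) by (simp add: ind_def split: if_splits)
  moreover have "card (M \<inter> cutE X) = 1" if "Inr X \<in> tight y" for X
    using M(3) that pm_C(3)[OF M(1), of X] by fastforce
  ultimately show ?thesis using that M(1) by blast
qed

section \<open>From signed combinations to nonnegative ones, and facets\<close>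

lemma dspan_dcone:
  assumes "x \<in> dspan"
  shows "x \<in> dcone V E ends"
proof -
  obtain c where c: "\<forall>M\<in>PM. qdyadic (c M)" "\<forall>e. x e = (\<Sum>M\<in>PM. c M * ind M e)"
    using assms unfolding dspan_def by blast
  \<comment> \<open>Adding a small multiple of \<open>S\<close>, the negative of the sum of all
    perfect matchings, to \<open>x\<close> stays in the cone. Decomposing the result and adding that
    multiple back gives \<open>x\<close> with all coefficients strictly positive, as
    \<open>nonneg_dyadic_combination\<close> requires.\<close>
  define S where "S e = - (\<Sum>M\<in>PM. 1 * ind M e)" for e
  have SL: "S \<in> L"
  proof -
    have s: "sum S A = - (\<Sum>M\<in>PM. 1 * sum (ind M) A)" for A
      unfolding S_def sum_negf by (simp add: sum.swap[of _ A])
    have "sum S (cutE {v}) = - of_nat (card (PM))" if "v \<in> V" for v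
      unfolding s using pm_degree that by (simp add: sum_ind)
    moreover have "S e = 0" if "e \<notin> E" for e
    proof -
      have "ind M e = 0" if "M \<in> PM" for M
        using pms_subset[OF that] \<open>e \<notin> E\<close> by (auto simp: ind_def)
      thus ?thesis unfolding S_def by simp
    qed
    ultimately show ?thesis using v0 by (simp add: L_def vdeg_def)
  qed
  have T0: "slack k S \<ge> 0" if "k \<in> tight x" for k using that tight_x by simp
  obtain \<epsilon> where e: "\<epsilon> > 0" "(\<lambda>e. 1 * x e + \<epsilon> * S e) \<in> C"
    "tight (\<lambda>e. 1 * x e + \<epsilon> * S e) = {k \<in> tight x. slack k S = 0}"
    by (rule small_step[OF x_C SL T0])
  obtain b where b: "\<forall>M\<in>PM. b M \<ge> 0"
    "\<forall>e. 1 * x e + \<epsilon> * S e = (\<Sum>M\<in>PM. b M * ind M e)"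
    using C_qcone[OF e(2)] unfolding qcone_def by blast
  have eq: "(\<Sum>M\<in>PM. (b M + \<epsilon>) * ind M f) = (\<Sum>M\<in>PM. c M * ind M f)" for f
  proof -
    have "(\<Sum>M\<in>PM. (b M + \<epsilon>) * ind M f) = (\<Sum>M\<in>PM. b M * ind M f) - \<epsilon> * S f"
      by (simp add: S_def distrib_right sum.distrib sum_distrib_left)
    also have "\<dots> = x f" using b(2)[rule_format, of f] by simp
    finally show ?thesis using c(2) by simp
  qed
  have "\<exists>a. (\<forall>M\<in>PM. a M \<ge> 0 \<and> qdyadic (a M)) \<and>
    (\<forall>e. (\<Sum>M\<in>PM. a M * ind M e) = (\<Sum>M\<in>PM. c M * ind M e))"
    by (rule nonneg_dyadic_combination[OF _ _ _ eq]) (use b(1) c(1) e(1) in \<open>auto simp: add_nonneg_pos\<close>)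
  then obtain a where "\<forall>M\<in>PM. a M \<ge> 0 \<and> qdyadic (a M)"
    "\<forall>e. (\<Sum>M\<in>PM. a M * ind M e) = (\<Sum>M\<in>PM. c M * ind M e)" by blast
  thus ?thesis using c(2) unfolding dcone_def by (intro CollectI exI[of _ a]) simp
qed

text \<open>All functionals tight at \<open>y\<close> have the same kernel on \<open>L\<close>. As
  they are positive at \<open>x\<close>, they are positive multiples of each other there, so the
  face of \<open>y\<close> has codimension one.\<close>

definition facet :: "('e \<Rightarrow> rat) \<Rightarrow> bool" where
  "facet y \<longleftrightarrow> y \<in> C \<and> tight y \<noteq> {} \<and>
    (\<forall>k\<in>tight y. \<forall>k'\<in>tight y. \<forall>z\<in>L. slack k z = 0 \<longrightarrow> slack k' z = 0)"

lemma facet_below: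
  assumes "w \<in> C" "tight w \<noteq> {}"
  obtains y where "facet y" "tight y \<subseteq> tight w"
proof -
  show thesis
  proof (rule facet_exists[OF assms])
    fix y assume "y \<in> C" "tight y \<noteq> {}" "tight y \<subseteq> tight w"
      "\<And>k k' z. k \<in> tight y \<Longrightarrow> k' \<in> tight y \<Longrightarrow> z \<in> L \<Longrightarrow> slack k z = 0 \<Longrightarrow> slack k' z = 0"
    thus thesis using that[of y] unfolding facet_def by blast
  qed
qed

text \<open>For large integral \<open>N\<close> both \<open>N * y\<close> and
  \<open>N * y + z\<close> are dyadic boundary points, to which the induction hypothesis applies;
  \<open>z\<close> is their difference.\<close>

lemma facet_kernel:
  assumes y: "facet y" "k \<in> tight y" and z: "z \<in> L" "\<And>e. qdyadic (z e)" "slack k z = 0"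
  shows "z \<in> dspan"
proof -
  have yC: "y \<in> C" "tight y \<noteq> {}" using y(1) unfolding facet_def by simp_all
  have ker: "slack k' z = 0" if "k' \<in> tight y" for k'
    using y(1) y(2) that z(1,3) unfolding facet_def by blast
  have yL: "y \<in> L" using yC by (simp add: C_def)
  have T0: "slack j z \<ge> 0" if "j \<in> tight y" for j using ker[OF that] by simp
  obtain \<epsilon> where e: "\<epsilon> > 0" "(\<lambda>e. 1 * y e + \<epsilon> * z e) \<in> C"
    "tight (\<lambda>e. 1 * y e + \<epsilon> * z e) = {k \<in> tight y. slack k z = 0}"
    by (rule small_step[OF yC(1) z(1) T0])
  obtain q :: nat where q: "q > 0" "\<forall>e. of_nat q * y e \<in> \<int>" by (rule clear_denominators[OF yL])
  obtain n :: nat where n: "1 / \<epsilon> \<le> of_nat n" using real_arch_simple by blast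
  \<comment> \<open>The factor \<open>q\<close> makes \<open>N * y\<close> integral; the factor
    \<open>n\<close> gives \<open>N \<ge> 1 / \<epsilon>\<close>, so that \<open>N * y + z\<close>
    is the nonnegative combination \<open>?u\<close> of two points of the cone.\<close>
  define N :: rat where "N = of_nat n * of_nat q"
  have "n * 1 \<le> n * q" using q(1) by (intro mult_le_mono2) simp
  hence nN: "of_nat n \<le> N" unfolding N_def of_nat_mult[symmetric] of_nat_le_iff by simp
  let ?u = "\<lambda>e. (N - 1 / \<epsilon>) * y e + 1 / \<epsilon> * (1 * y e + \<epsilon> * z e)"
  have u: "?u = (\<lambda>e. N * y e + 1 * z e)" 
  proof
    fix f
    have "1 / \<epsilon> * (1 * y f + \<epsilon> * z f) = 1 / \<epsilon> * y f + z f" using e(1) by (simp add: distrib_left)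
    thus "?u f = N * y f + 1 * z f" by (simp add: left_diff_distrib)
  qed
  have dy: "qdyadic (N * y f)" for f
  proof -
    have "of_nat n * (of_nat q * y f) \<in> \<int>" using q(2) by simp
    thus ?thesis unfolding N_def mult.assoc by (rule qdyadic_Ints)
  qed
  have "?u \<in> C" by (rule C_comb[OF yC(1) e(2)]) (use e(1) n nN in auto)
  hence uC: "(\<lambda>e. N * y e + 1 * z e) \<in> C" unfolding u .
  have "k \<in> tight (\<lambda>e. N * y e + 1 * z e)" using y(2) z(3) unfolding tight_def slack_lin by simp
  hence 1: "(\<lambda>e. N * y e + 1 * z e) \<in> dspan"
    using boundary_dcone[OF uC] dy z(2) dcone_dspan by auto
  have N0: "N \<ge> 0" by (simp add: N_def)
  have "(\<lambda>e. N * y e + 0 * y e) \<in> C" using yC(1) N0 by (intro C_comb) auto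
  moreover have "k \<in> tight (\<lambda>e. N * y e + 0 * y e)" using y(2) unfolding tight_def slack_lin by simp
  ultimately have 2: "(\<lambda>e. N * y e + 0 * y e) \<in> dspan"
    using boundary_dcone dy dcone_dspan by auto
  have "(\<lambda>e. 1 * (N * y e + 1 * z e) + (-1) * (N * y e + 0 * y e)) \<in> dspan"
    using qdyadic_of_int[of "-1"] by (intro dspan_comb 1 2) auto
  thus ?thesis by simp
qed

lemma facet_unit:
  assumes y: "facet y" "k \<in> tight y" and M: "M \<in> PM" "slack k (ind M) \<in> {1, 2, 4}"
  shows "x \<in> dcone V E ends"
proof -
  define s where "s = slack k x / slack k (ind M)"
  have "qdyadic (slack k x)"
  proof (cases k)
    case (Inr X)
    show ?thesis unfolding Inr slack_simps excess_def vdeg_def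
      by (intro qdyadic_diff qdyadic_sum x_dyadic)
  qed (simp add: x_dyadic)
  hence s: "qdyadic s" using M(2) qdyadic_div2 qdyadic_div4 by (auto simp: s_def)
  let ?z = "\<lambda>e. 1 * x e + (- s) * ind M e"
  have "?z \<in> L" using x_L pm_C(1)[OF M(1)] by (intro L_lin) (auto simp: C_def)
  moreover have "qdyadic (?z e)" for e
    using s x_dyadic by (intro qdyadic_add qdyadic_mult qdyadic_uminus) (auto simp: ind_def)
  moreover have "slack k ?z = 0" unfolding slack_lin using M(2) by (auto simp: s_def)
  ultimately have z: "?z \<in> dspan" by (rule facet_kernel[OF y])
  have "(\<lambda>e. 1 * ?z e + s * ind M e) \<in> dspan" by (intro dspan_comb z ind_dspan M(1) s) auto
  hence "x \<in> dspan" by simp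
  thus ?thesis by (rule dspan_dcone)
qed

lemma facet_edge:
  assumes "facet y" "Inl e \<in> tight y"
  shows "x \<in> dcone V E ends"
proof -
  have e: "e \<in> E" using assms(2) by (simp add: tight_def)
  have k: "Inl e \<in> K" "slack (Inl e) x > 0" using e x_edge by simp_all
  obtain M where M: "M \<in> PM" "slack (Inl e) (ind M) > 0" "\<forall>j\<in>tight x. slack j (ind M) = 0"
    by (rule tight_pm[OF x_C k])
  hence "slack (Inl e) (ind M) \<in> {1, 2, 4}" by (simp add: ind_def split: if_splits)
  thus ?thesis by (rule facet_unit[OF assms M(1)])
qed

end

subsection \<open>Facets and uncrossing\<close>

context interior
begin

lemma tight_compl: "Inr X \<in> tight y \<Longrightarrow> Inr (V - X) \<in> tight y"
  using odds_compl[of X] excess_compl[of X y] by (simp add: tight_def)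

lemma tight_oddsD:
  assumes "Inr X \<in> tight y"
  shows "X \<in> odds" "X \<subseteq> V" "odd (card X)" "3 \<le> card X" "card X + 3 \<le> card V" "excess X y = 0"
  using assms by (auto simp: tight_def odds_def)

lemma excess_uncross:
  "excess U y + excess W y =
    excess (U \<inter> W) y + excess (U \<union> W) y + 2 * sum y (betweenE (U - W) (W - U))"
  using uncross[of y U W] by (simp add: excess_def)

lemma excess_x_pos: "X \<in> odds \<Longrightarrow> excess X x > 0"
  using x_pos[of "Inr X"] by simp

text \<open>The multiple of \<open>x\<close> that moves \<open>z\<close> into the kernel of
  \<open>excess U\<close> also moves it into the kernel of \<open>excess D\<close>.\<close>

lemma facet_proportional:
  assumes y: "facet y" and U: "Inr U \<in> tight y" and D: "Inr D \<in> tight y"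
  obtains c where "c > 0" "\<forall>z\<in>L. excess D z = c * excess U z"
proof -
  have pos: "excess U x > 0" "excess D x > 0"
    using tight_oddsD(1)[OF U] tight_oddsD(1)[OF D] excess_x_pos by blast+
  define c where "c = excess D x / excess U x"
  have c: "c > 0" using pos by (simp add: c_def)
  have "excess D z = c * excess U z" if z: "z \<in> L" for z
  proof -
    define m where "m = excess U z / excess U x"
    let ?u = "\<lambda>e. 1 * z e + (- m) * x e"
    have u: "?u \<in> L" by (rule L_lin[OF z x_L])
    have "slack (Inr U) ?u = 0" unfolding slack_lin using pos by (simp add: m_def)
    hence "slack (Inr D) ?u = 0" using y U D u unfolding facet_def by blast
    hence "excess D z = m * excess D x" unfolding slack_lin by simp
    thus ?thesis using pos by (simp add: c_def m_def)
  qed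
  thus ?thesis using that c by blast
qed

text \<open>For every perfect matching the total of \<open>p\<close> on \<open>X\<close> equals the
  sum of \<open>p\<close> over the matched crossing vertices, since matched edges inside
  \<open>X\<close> cancel. Matchings crossing once, available for each cut edge by tightness, show
  that all these boundary values equal the total. A matching crossing more than once then shows that
  the total is a larger multiple of itself, hence 0.\<close>

lemma boundary_potential:
  fixes p :: "'v \<Rightarrow> rat"
  assumes y: "y \<in> C" "\<And>e. e \<in> E \<Longrightarrow> y e > 0" and X: "Inr X \<in> tight y"
    and p: "\<And>e. e \<in> innerE X \<Longrightarrow> (\<Sum>v\<in>ends e \<inter> X. p v) = 0"
    and g: "g \<in> cutE X"
  shows "(\<Sum>v\<in>ends g \<inter> X. p v) = 0"
proof -
  define q where "q e = (\<Sum>v\<in>ends e \<inter> X. p v)" for e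
  have XV: "X \<subseteq> V" by (rule tight_oddsD(2)[OF X])
  have key: "(\<Sum>v\<in>X. p v) = (\<Sum>e\<in>M \<inter> cutE X. q e)" if M: "M \<in> PM" for M
  proof -
    have "(\<Sum>v\<in>X. p v) = (\<Sum>v\<in>X. p v * sum (ind M) (cutE {v}))"
      by (rule sum.cong) (use pm_degree[OF M] XV in \<open>auto simp: sum_ind\<close>)
    also have "\<dots> = (\<Sum>e\<in>E. q e * ind M e)" unfolding q_def by (rule degree_sum[OF XV])
    also have "\<dots> = (\<Sum>e\<in>M \<inter> cutE X. q e)"
    proof (rule sum.mono_neutral_cong_right)
      show "\<forall>e\<in>E - M \<inter> cutE X. q e * ind M e = 0"
      proof
        fix e assume e: "e \<in> E - M \<inter> cutE X"
        show "q e * ind M e = 0"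
        proof (cases "e \<in> M")
          case True
          have eE: "e \<in> E" and nc: "e \<notin> cutE X" using e True by auto
          obtain a b where ab: "ends e = {a, b}" "a \<noteq> b" using eE by (rule edgeE)
          have "(a \<in> X) = (b \<in> X)" using nc in_cut[OF eE ab] by simp
          hence "e \<in> innerE X \<or> ends e \<inter> X = {}" using in_inner[OF eE ab(1)] ab(1) by auto
          hence "q e = 0" using p unfolding q_def by auto
          thus ?thesis by simp
        qed (simp add: ind_def)
      qed
    qed (use pms_subset[OF M] in \<open>auto simp: ind_def\<close>)
    finally show ?thesis .
  qed
  have P: "q h = (\<Sum>v\<in>X. p v)" if h: "h \<in> cutE X" for h
  proof -
    have hE: "h \<in> E" using h cut_subset by blast
    obtain M where M: "M \<in> PM" "h \<in> M" "\<forall>X. Inr X \<in> tight y \<longrightarrow> card (M \<inter> cutE X) = 1"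
      by (rule tight_pm_edge[OF y(1) hE y(2)[OF hE]])
    have "card (M \<inter> cutE X) = 1" using M(3) X by blast
    then obtain h' where h': "M \<inter> cutE X = {h'}" by (rule card_1_singletonE)
    have "h \<in> M \<inter> cutE X" using M(2) h by simp
    hence "M \<inter> cutE X = {h}" unfolding h' by simp
    thus ?thesis using key[OF M(1)] by simp
  qed
  have kX: "Inr X \<in> K" "slack (Inr X) x > 0" using tight_oddsD(1)[OF X] excess_x_pos by simp_all
  obtain M0 where M0: "M0 \<in> PM" "slack (Inr X) (ind M0) > 0" "\<forall>j\<in>tight x. slack j (ind M0) = 0"
    by (rule tight_pm[OF x_C kX])
  have l: "(of_nat (card (M0 \<inter> cutE X)) :: rat) > 1" using M0(2) pm_C(3)[OF M0(1), of X] by simp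
  have "(\<Sum>v\<in>X. p v) = of_nat (card (M0 \<inter> cutE X)) * (\<Sum>v\<in>X. p v)"
    using key[OF M0(1)] P by simp
  hence "(\<Sum>v\<in>X. p v) = 0" using l by simp
  thus ?thesis using P[OF g] by (simp add: q_def)
qed

lemma sum_nonpos_empty:
  fixes y :: "'e \<Rightarrow> rat"
  assumes "S \<subseteq> E" "sum y S \<le> 0" "\<And>e. e \<in> S \<Longrightarrow> y e > 0"
  shows "S = {}"
proof (rule ccontr)
  assume "S \<noteq> {}"
  hence "sum y S > 0" using assms(1,3) finite_subset[OF assms(1)] by (intro sum_pos) auto
  thus False using assms(2) by simp
qed

text \<open>Two disjoint odd sets defining the same facet have the same excess: the proportionality
  factor \<open>c\<close> is a potential on the rest of the graph which can only reach both sets if it is 1.\<close>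

lemma disjoint_facet_sets:
  assumes y: "facet y" "\<And>e. e \<in> E \<Longrightarrow> y e > 0"
    and U: "Inr U \<in> tight y" and D: "Inr D \<in> tight y" and disj: "U \<inter> D = {}" and notV: "U \<union> D \<noteq> V"
    and z: "z \<in> L"
  shows "excess D z = excess U z"
proof -
  obtain c where c: "c > 0" "\<forall>z\<in>L. excess D z = c * excess U z"
    by (rule facet_proportional[OF y(1) U D])
  have yC: "y \<in> C" using y(1) by (simp add: facet_def)
  have yL: "y \<in> L" by (rule C_L[OF yC])
  note UV = tight_oddsD[OF U] and DV = tight_oddsD[OF D]
  have "c = 1"
  proof (rule ccontr)
    assume c1: "c \<noteq> 1"
    define S where "S = {z :: 'e \<Rightarrow> rat. \<forall>e. e \<notin> E \<longrightarrow> z e = 0}"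
    \<comment> \<open>This functional vanishes on all vectors with zero degrees, so it is a
      combination of the degrees. Its coefficients form a vertex potential; evaluating at single
      edges gives \<open>pe\<close>.\<close>
    have "\<exists>p. \<forall>z\<in>S. sum z (cutE D) - c * sum z (cutE U) = (\<Sum>v\<in>V. p v * sum z (cutE {v}))"
    proof (rule functional_in_span)
      fix z assume z: "z \<in> S" "\<forall>v\<in>V. sum z (cutE {v}) = 0"
      hence "z \<in> L" "vdeg z = 0" using L_zero_degrees[of z] by (auto simp: S_def)
      thus "sum z (cutE D) - c * sum z (cutE U) = 0"
        using c(2)[rule_format, of z] by (simp add: excess_def)
    qed (auto simp: S_def sum_lin algebra_simps)
    then obtain p where p: "\<forall>z\<in>S. sum z (cutE D) - c * sum z (cutE U) =
      (\<Sum>v\<in>V. p v * sum z (cutE {v}))" by blast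
    have pe: "p a + p b = of_bool ((a \<in> D) \<noteq> (b \<in> D)) - c * of_bool ((a \<in> U) \<noteq> (b \<in> U))"
      if e: "e \<in> E" and ab: "ends e = {a, b}" "a \<noteq> b" for e a b
    proof -
      have one: "sum (ind {e}) A = of_bool (e \<in> A)" if "finite A" for A
        using sum_ind[OF that, of "{e}"] by (cases "e \<in> A") auto
      have abV: "{a, b} \<inter> V = {a, b}" using e ab(1) graph by (auto simp: graph_def)
      have "ind {e} \<in> S" using e by (auto simp: S_def ind_def)
      hence "sum (ind {e}) (cutE D) - c * sum (ind {e}) (cutE U) =
        (\<Sum>v\<in>V. p v * sum (ind {e}) (cutE {v}))" using p by blast
      hence "of_bool (e \<in> cutE D) - c * of_bool (e \<in> cutE U) =
        (\<Sum>v\<in>V. p v * sum (ind {e}) (cutE {v}))"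
        by (simp only: one[OF finite_cut])
      also have "\<dots> = (\<Sum>f\<in>E. (\<Sum>v\<in>ends f \<inter> V. p v) * ind {e} f)" by (rule degree_sum) simp
      also have "\<dots> = (\<Sum>f\<in>{e}. (\<Sum>v\<in>ends f \<inter> V. p v) * ind {e} f)"
        by (rule sum.mono_neutral_right) (use e in \<open>auto simp: ind_def\<close>)
      also have "\<dots> = p a + p b" using ab abV by (simp add: ind_def)
      finally show ?thesis unfolding in_cut[OF e ab] by simp
    qed
    \<comment> \<open>As \<open>U\<close> and \<open>D\<close> are disjoint, an edge inside one of
      them lies in neither cut, so the potential cancels along it and
      \<open>boundary_potential\<close> applies.\<close>
    have bnd: "p a = 0" if X: "X = U \<or> X = D" and e: "e \<in> E" "ends e = {a, b}" "a \<in> X" "b \<notin> X" for X e a b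
    proof -
      have ne: "a \<noteq> b" using e by blast
      have XT: "Inr X \<in> tight y" using X U D by blast
      have inn: "(\<Sum>v\<in>ends f \<inter> X. p v) = 0" if f: "f \<in> innerE X" for f
      proof -
        have fE: "f \<in> E" and fX: "ends f \<subseteq> X" using f by (auto simp: inner_def)
        obtain r s where rs: "ends f = {r, s}" "r \<noteq> s" using fE by (rule edgeE)
        have "ends f \<inter> X = {r, s}" using fX rs by auto
        moreover have "p r + p s = 0" using pe[OF fE rs] X fX rs(1) disj by auto
        ultimately show ?thesis using rs(2) by simp
      qed
      have ec: "e \<in> cutE X" using in_cut[OF e(1,2) ne] e(3,4) by simp
      have "(\<Sum>v\<in>ends e \<inter> X. p v) = 0"
        by (rule boundary_potential[OF yC _ XT _ ec]) (simp_all add: y(2) inn)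
      moreover have "ends e \<inter> X = {a}" using e by auto
      ultimately show ?thesis by simp
    qed
    \<comment> \<open>Edges within the rest of the graph only negate \<open>p\<close>. Edges from
      \<open>U\<close> enter the rest at absolute value \<open>c\<close>, edges from
      \<open>D\<close> at absolute value 1. Since \<open>c\<close> is not 1, all edges leaving
      \<open>X\<close> go to \<open>U\<close>, and \<open>X\<close> contains all neighbours of
      \<open>U\<close> in the rest.\<close>
    define X where "X = {k \<in> V - U - D. \<bar>p k\<bar> = c}"
    have XV: "X \<subseteq> V" and XU: "U \<inter> X = {}" and XD: "X \<inter> D = {}" by (auto simp: X_def)
    have UK: "k \<in> X" if "e \<in> E" "ends e = {u, k}" "u \<in> U" "k \<in> V - U - D" for e u k
    proof -
      have "u \<noteq> k" using that by blast
      hence "p u + p k = - c" using pe[OF that(1,2)] that(3,4) disj by auto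
      moreover have "p u = 0" using bnd[of U e u k] that by blast
      ultimately show ?thesis using that(4) c(1) by (simp add: X_def)
    qed
    have leave: "w \<in> U" if "e \<in> E" "ends e = {k, w}" "k \<in> X" "w \<notin> X" for e k w
    proof (rule ccontr)
      assume wU: "w \<notin> U"
      have kw: "k \<noteq> w" using that by blast
      have wV: "w \<in> V" using that(1,2) graph by (auto simp: graph_def)
      have k: "k \<in> V - U - D" "\<bar>p k\<bar> = c" using that(3) by (auto simp: X_def)
      show False
      proof (cases "w \<in> D")
        case True
        have "p k + p w = 1" using pe[OF that(1,2) kw] True k(1) wU by auto
        moreover have "p w = 0" using bnd[of D e w k] that(1,2) True k(1) by (simp add: insert_commute)
        ultimately show False using k(2) c1 by simp
      next
        case False
        hence "p k + p w = 0" using pe[OF that(1,2) kw] k(1) wU by auto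
        hence "\<bar>p w\<bar> = c" using k(2) by (simp add: add_eq_0_iff)
        thus False using that(4) wV wU False by (simp add: X_def)
      qed
    qed
    have cutX: "cutE X = betweenE U X"
    proof (intro set_eqI)
      fix e show "e \<in> cutE X \<longleftrightarrow> e \<in> betweenE U X"
      proof (cases "e \<in> E")
        case True
        then obtain a b where ab: "ends e = {a, b}" "a \<noteq> b" by (rule edgeE)
        have ba: "ends e = {b, a}" using ab(1) by auto
        show ?thesis unfolding in_cut[OF True ab] in_between[OF True ab(1)]
          using leave[OF True ab(1)] leave[OF True ba] XU by blast
      qed (simp add: cut_def between_def)
    qed
    define s where "s = sum y (betweenE U X)"
    have s: "sum y (cutE X) = s" by (simp add: cutX s_def)
    have sU: "sum y (cutE U) = vdeg y" using UV(6) by (simp add: excess_def)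
    have sUX: "sum y (cutE (U \<union> X)) = vdeg y - s"
      unfolding cut_disjoint_union[OF XU] s sU by (simp add: s_def)
    have ypos: "\<And>e. e \<in> cutE Z \<Longrightarrow> y e > 0" for Z using y(2) cut_subset by blast
    have Dne: "D \<noteq> {}" "U \<noteq> {}" using DV(4) UV(4) by auto
    have cUX: "card (U \<union> X) = card U + card X"
      using XU by (intro card_Un_disjoint finite_subset_V[OF XV] finite_subset_V[OF UV(2)])
    show False
    \<comment> \<open>If \<open>X\<close> is odd, its cut already has the weight of the degree, so
      nothing is left to leave the even set \<open>U \<union> X\<close>. If \<open>X\<close> is
      even, then \<open>U \<union> X\<close> is odd, which forces the cut of \<open>X\<close> to be
      empty and hence \<open>X\<close> to be empty; then every edge leaving \<open>U\<close> ends in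
      \<open>D\<close>, and the even set \<open>U \<union> D\<close> is isolated.\<close>
    proof (cases "odd (card X)")
      case True
      hence "s \<ge> vdeg y" using excess_nonneg[OF yC XV] s by (simp add: excess_def)
      hence "cutE (U \<union> X) = {}"
        using sUX ypos by (intro sum_nonpos_empty[OF cut_subset, of y]) auto
      moreover have "U \<union> X \<noteq> V" using Dne(1) disj XD DV(2) by blast
      moreover have "even (card (U \<union> X))" using cUX True UV(3) by simp
      ultimately show False using no_isolated_even[of "U \<union> X"] UV(2) XV Dne(2) by blast
    next
      case False
      have "odd (card (U \<union> X))" using cUX False UV(3) by simp
      hence "s \<le> 0" using excess_nonneg[OF yC, of "U \<union> X"] UV(2) XV sUX by (simp add: excess_def)
      hence "cutE X = {}"
        using s ypos by (intro sum_nonpos_empty[OF cut_subset, of y]) auto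
      moreover have "X \<noteq> V" using Dne(1) XD DV(2) by blast
      ultimately have X0: "X = {}" using no_isolated_even[OF XV] False by blast
      have cutU: "cutE U = betweenE U D"
      proof (intro set_eqI)
        fix e show "e \<in> cutE U \<longleftrightarrow> e \<in> betweenE U D"
        proof (cases "e \<in> E")
          case True
          then obtain a b where ab: "ends e = {a, b}" "a \<noteq> b" "a \<in> V" "b \<in> V" by (rule edgeE)
          have ba: "ends e = {b, a}" using ab(1) by auto
          show ?thesis unfolding in_cut[OF True ab(1,2)] in_between[OF True ab(1)]
            using UK[OF True ab(1)] UK[OF True ba] X0 ab(3,4) disj by blast
        qed (simp add: cut_def between_def)
      qed
      have "sum y (cutE (U \<union> D)) = 0"
        unfolding cut_disjoint_union[OF disj] using DV(6) cutU sU by (simp add: excess_def)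
      hence "cutE (U \<union> D) = {}"
        using ypos by (intro sum_nonpos_empty[OF cut_subset, of y]) auto
      moreover have "card (U \<union> D) = card U + card D"
        using disj by (intro card_Un_disjoint finite_subset_V[OF DV(2)] finite_subset_V[OF UV(2)])
      ultimately show False using no_isolated_even[of "U \<union> D"] UV(2,3) DV(2,3) Dne notV by simp
    qed
  qed
  thus ?thesis using c(2) z by simp
qed

definition facet_sets :: "'v set set" where
  "facet_sets = {X. \<exists>y. facet y \<and> Inr X \<in> tight y}"

text \<open>If a smallest set \<open>U\<close> defining a facet carries a vector with zero degrees, moving along it
  reaches a second facet, defined by some \<open>W\<close>; uncrossing \<open>U\<close> and \<open>W\<close> contradicts minimality.\<close>

lemma smallest_facet_set_kernel:
  fixes z :: "'e \<Rightarrow> rat"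
  assumes noedge: "\<And>y e. facet y \<Longrightarrow> Inl e \<notin> tight y"
    and x1: "facet x1" and U: "Inr U \<in> tight x1" and min: "\<And>W. W \<in> facet_sets \<Longrightarrow> card U \<le> card W"
    and z: "\<And>e. e \<notin> innerE U \<Longrightarrow> z e = 0" "\<And>v. v \<in> V \<Longrightarrow> sum z (cutE {v}) = 0"
    and ne: "z e0 \<noteq> 0"
  shows False
proof -
  have x1C: "x1 \<in> C" using x1 by (simp add: facet_def)
  have pos: "x1 e > 0" if "e \<in> E" for e
    using noedge[OF x1, of e] that C_nonneg[OF x1C, of e] by (auto simp: tight_def less_le)
  note UV = tight_oddsD[OF U]
  have finU: "finite U" by (rule finite_subset_V[OF UV(2)])
  have zE: "z e = 0" if "e \<notin> E" for e using z(1)[of e] that inner_subset by blast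
  have zL: "z \<in> L" "vdeg z = 0" using L_zero_degrees[of z] zE z(2) by blast+
  have zout: "sum z (cutE X) = 0" if "U \<inter> X = {} \<or> U \<subseteq> X" for X
  proof (rule sum.neutral, rule)
    fix e assume e: "e \<in> cutE X"
    hence eE: "e \<in> E" using cut_subset by blast
    obtain a b where ab: "ends e = {a, b}" "a \<noteq> b" using eE by (rule edgeE)
    have "e \<notin> innerE U" using e that unfolding in_cut[OF eE ab] in_inner[OF eE ab(1)] by blast
    thus "z e = 0" by (rule z(1))
  qed
  have "excess U z = 0" using zout[of U] zL(2) by (simp add: excess_def)
  hence alz: "slack k z = 0" if "k \<in> tight x1" for k
    using x1 U that zL(1) unfolding facet_def by (metis slack_simps(2))
  obtain f where f: "f \<in> E" "z f < 0" by (rule negative_entry[OF zL ne])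
  have k0: "Inl f \<in> K" "slack (Inl f) z < 0" using f by simp_all
  have T0: "slack k z \<ge> 0" if "k \<in> tight x1" for k using alz[OF that] by simp
  obtain t k where t: "t > 0" "(\<lambda>e. 1 * x1 e + t * z e) \<in> C" "k \<in> tight (\<lambda>e. 1 * x1 e + t * z e)" "slack k z < 0"
    by (rule shoot[OF x1C zL(1) k0 T0])
  define x2 where "x2 = (\<lambda>e. 1 * x1 e + t * z e)"
  have x2C: "x2 \<in> C" and kx2: "k \<in> tight x2" using t(2,3) by (simp_all add: x2_def)
  have "j \<in> tight x2" if j: "j \<in> tight x1" for j
    using j alz[OF j] unfolding tight_def x2_def slack_lin by simp
  moreover have "k \<notin> tight x1" using alz[of k] t(4) by auto
  ultimately have "tight x1 \<subset> tight x2" using kx2 by blast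
  then obtain y where y: "y \<in> C" "tight y \<noteq> {}" "tight y \<subseteq> tight x2 - tight x1"
    by (rule second_face[OF x1C x2C])
  obtain y2 where y2: "facet y2" "tight y2 \<subseteq> tight y" by (rule facet_below[OF y(1,2)])
  have y2C: "y2 \<in> C" and y2L: "y2 \<in> L" using y2(1) C_L by (auto simp: facet_def)
  have sub: "tight y2 \<subseteq> tight x2 - tight x1" using y(3) y2(2) by blast
  have "tight y2 \<noteq> {}" using y2(1) by (simp add: facet_def)
  then obtain k2 where k2: "k2 \<in> tight y2" by blast
  obtain W0 where W0: "Inr W0 \<in> tight y2" using k2 noedge[OF y2(1)] by (cases k2) auto
  \<comment> \<open>A set and its complement have the same excess, and one of the two meets the odd
    set \<open>U\<close> in an odd number of vertices.\<close>
  obtain W where W: "Inr W \<in> tight y2" "odd (card (U \<inter> W))"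
  proof (cases "odd (card (U \<inter> W0))")
    case False
    have "U \<inter> (V - W0) = U - U \<inter> W0" using UV(2) by blast
    hence "card (U \<inter> (V - W0)) + card (U \<inter> W0) = card U"
      using card_Diff_subset[of "U \<inter> W0" U] card_mono[of U "U \<inter> W0"] finU by simp
    hence "odd (card (U \<inter> (V - W0)))" using False UV(3) by presburger
    thus ?thesis using that tight_compl[OF W0] by blast
  qed (use that W0 in blast)
  note WV = tight_oddsD[OF W(1)]
  have finW: "finite W" by (rule finite_subset_V[OF WV(2)])
  have Wfs: "X \<in> facet_sets" if "Inr X \<in> tight y2" for X using y2(1) that unfolding facet_sets_def by blast
  have UnT: "Inr U \<notin> tight y2" using sub U by blast
  have "Inr W \<in> tight x2" "Inr U \<in> tight x2" using sub W(1) \<open>tight x1 \<subset> tight x2\<close> U by blast+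
  hence Wx2: "excess W x2 = 0" and Ux2: "excess U x2 = 0" using tight_oddsD(6) by blast+
  define D where "D = V - (U \<union> W)"
  have UWV: "U \<union> W \<subseteq> V" using UV(2) WV(2) by blast
  have "card U + card W = card (U \<union> W) + card (U \<inter> W)" by (rule card_Un_Int[OF finU finW])
  hence oUW: "odd (card (U \<union> W))" using UV(3) WV(3) W(2) by presburger
  have "card D + card (U \<union> W) = card V" unfolding D_def by (rule card_compl[OF UWV])
  hence oD: "odd (card D)" using oUW even_V by presburger
  have "0 = excess (U \<inter> W) x2 + excess (U \<union> W) x2 + 2 * sum x2 (betweenE (U - W) (W - U))"
    using excess_uncross[of U x2 W] Ux2 Wx2 by simp
  moreover have "excess (U \<inter> W) x2 \<ge> 0" using UV(2) W(2) by (intro excess_nonneg[OF x2C]) auto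
  moreover have "excess (U \<union> W) x2 \<ge> 0" by (rule excess_nonneg[OF x2C UWV oUW])
  moreover have "sum x2 (betweenE (U - W) (W - U)) \<ge> 0"
    by (rule between_nonneg) (simp add: C_nonneg[OF x2C])
  ultimately have zero: "excess (U \<union> W) x2 = 0" "sum x2 (betweenE (U - W) (W - U)) = 0" by linarith+
  \<comment> \<open>\<open>z\<close> vanishes off the edges inside \<open>U\<close>, so
    \<open>x2\<close> is still positive there. Weight zero thus means that there is no such edge at
    all, and uncrossing becomes an identity for every vector.\<close>
  have btw: "betweenE (U - W) (W - U) = {}"
  proof (rule sum_nonpos_empty[OF between_subset])
    fix e assume e: "e \<in> betweenE (U - W) (W - U)"
    hence "e \<notin> innerE U" by (auto simp: between_def inner_def)
    moreover have "e \<in> E" using e between_subset by blast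
    ultimately show "x2 e > 0" using pos z(1) by (simp add: x2_def)
  qed (use zero in simp)
  have un: "excess U u + excess W u = excess (U \<inter> W) u + excess D u" for u
    using excess_uncross[of U u W] btw excess_compl[of "U \<union> W" u] by (simp add: D_def)
  \<comment> \<open>\<open>D\<close> is disjoint from \<open>U\<close>, so \<open>z\<close> does not
    change its excess: \<open>D\<close> is tight at \<open>x1\<close> already.\<close>
  have "excess D x2 = 0" using zero(1) excess_compl[of "U \<union> W" x2] by (simp add: D_def)
  moreover have "excess D x2 = 1 * excess D x1 + t * excess D z" unfolding x2_def by (rule excess_lin)
  moreover have "excess D z = 0" using zout[of D] zL(2) by (auto simp: excess_def D_def)
  ultimately have Dx1: "excess D x1 = 0" by simp
  have "D \<subseteq> V" by (auto simp: D_def)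
  \<comment> \<open>In this case \<open>U \<inter> W\<close> is tight at \<open>y2\<close>. By
    minimality it would be all of \<open>U\<close>, which is not tight at \<open>y2\<close>; a
    trivial \<open>U \<inter> W\<close> contradicts the positive excess of \<open>W\<close> at
    \<open>x\<close>.\<close>
  have Apos: False if "\<And>u. u \<in> L \<Longrightarrow> excess W u = excess (U \<inter> W) u"
  proof -
    have Asub: "U \<inter> W \<subseteq> V" using UV(2) by blast
    show False using Asub W(2)
    proof (cases rule: odd_cases)
      case 1
      have "excess (U \<inter> W) y2 = 0" using that[OF y2L] WV(6) by simp
      hence A: "Inr (U \<inter> W) \<in> tight y2" using 1 by (simp add: tight_def)
      hence "card U \<le> card (U \<inter> W)" using min Wfs by blast
      hence "U \<inter> W = U" using finU by (intro card_seteq) auto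
      thus False using A UnT by simp
    next
      case (2 v)
      thus False using that[OF x_L] excess_single[OF x_L, of v] excess_x_pos[OF WV(1)] by simp
    next
      case (3 v)
      thus False using that[OF x_L] excess_single[OF x_L, of v] excess_compl[of "U \<inter> W" x]
        excess_x_pos[OF WV(1)] by simp
    qed
  qed
  show False using \<open>D \<subseteq> V\<close> oD
  proof (cases rule: odd_cases)
    case 1
    hence DT: "Inr D \<in> tight x1" using Dx1 by (simp add: tight_def)
    have UD: "U \<inter> D = {}" by (auto simp: D_def)
    show False
    proof (cases "U \<union> D = V")
      case True
      hence WU: "W \<subseteq> U" using WV(2) by (auto simp: D_def)
      moreover have "card U \<le> card W" using min Wfs[OF W(1)] by blast
      ultimately have "W = U" using finU by (intro card_seteq) auto
      thus False using W(1) UnT by simp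
    next
      case False
      have "excess W u = excess (U \<inter> W) u" if "u \<in> L" for u
        using un[of u] disjoint_facet_sets[OF x1 pos U DT UD False that] by simp
      thus False by (rule Apos)
    qed
  next
    case (2 d)
    \<comment> \<open>Minimality is applied to the complement of \<open>W\<close>, which has only
      one vertex outside \<open>U\<close>. This leaves a single vertex for
      \<open>U \<inter> W\<close>, so both sets on the right of \<open>un\<close> are
      trivial.\<close>
    have "V - W = (U - W) \<union> {d}" using 2 UV(2) by (auto simp: D_def)
    hence "card (V - W) \<le> card (U - W) + 1" using card_Un_le[of "U - W" "{d}"] by simp
    moreover have "card U \<le> card (V - W)" using min Wfs[OF tight_compl[OF W(1)]] by blast
    moreover have "card U = card (U \<inter> W) + card (U - W)"
      using card_Int_Diff[OF finU, of W] by simp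
    ultimately have "card (U \<inter> W) = 1" using odd_pos[OF W(2)] by linarith
    then obtain a where a: "U \<inter> W = {a}" by (rule card_1_singletonE)
    have "a \<in> V" using a UV(2) by blast
    hence "excess U x + excess W x = 0"
      using un[of x] a 2 excess_single[OF x_L] by simp
    thus False using excess_x_pos[OF UV(1)] excess_x_pos[OF WV(1)] by simp
  next
    case (3 v)
    have "U \<subseteq> {v}" using 3 UV(2) by (auto simp: D_def)
    hence "card U \<le> card {v}" by (intro card_mono) auto
    thus False using UV(4) by simp
  qed
qed

end

subsection \<open>Facets defined by an odd cycle\<close>

text \<open>By \<open>smallest_facet_set_kernel\<close>, a smallest facet set satisfies
  \<open>rigid\<close>: the incidence columns of the edges inside \<open>U\<close> are linearly
  independent.\<close>

locale rigid_facet = interior V E ends x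
  for V :: "'v set" and E :: "'e set" and ends :: "'e \<Rightarrow> 'v set" and x :: "'e \<Rightarrow> rat" +
  fixes x1 :: "'e \<Rightarrow> rat" and U :: "'v set"
  assumes noedge: "\<And>y e. facet y \<Longrightarrow> Inl e \<notin> tight y"
    and x1: "facet x1" and U: "Inr U \<in> tight x1"
    and smallest: "\<And>W. W \<in> facet_sets \<Longrightarrow> card U \<le> card W"
    and rigid: "\<And>z :: 'e \<Rightarrow> rat. (\<And>e. e \<notin> innerE U \<Longrightarrow> z e = 0) \<Longrightarrow>
      (\<And>v. v \<in> V \<Longrightarrow> sum z (cutE {v}) = 0) \<Longrightarrow> (\<And>e. z e = 0)"
begin

abbreviation IU :: "'e set" where "IU \<equiv> innerE U"

lemma x1_C: "x1 \<in> C" using x1 by (simp add: facet_def)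

lemma x1_L: "x1 \<in> L" by (rule C_L[OF x1_C])

lemma x1_pos: "e \<in> E \<Longrightarrow> x1 e > 0"
  using noedge[OF x1, of e] C_nonneg[OF x1_C, of e] by (auto simp: tight_def less_le)

lemmas U_odds = tight_oddsD[OF U]

lemma finite_U [simp]: "finite U"
  by (rule finite_subset_V[OF U_odds(2)])

lemma x1_cut_empty: "sum x1 (cutE X) \<le> 0 \<Longrightarrow> cutE X = {}"
  by (rule sum_nonpos_empty[OF cut_subset]) (use x1_pos cut_subset in blast)+

lemma U_not_V: "X \<subseteq> U \<Longrightarrow> X \<noteq> V"
  using U_odds(5) card_mono[of U X] finite_U by auto

section \<open>Every vertex of U has exactly two neighbours in U\<close>

lemma inner_cut_single:
  assumes "e \<in> E" "ends e = {a, b}" "a \<noteq> b" "v \<in> V"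
  shows "e \<in> cutE {v} \<longleftrightarrow> v = a \<or> v = b"
  using cut_single[OF assms(4)] assms by auto

text \<open>The difference of the unit vectors of two parallel edges has zero degrees.\<close>

lemma no_parallel:
  assumes "e \<in> IU" "f \<in> IU" "ends e = ends f"
  shows "e = f"
proof (rule ccontr)
  assume ne: "e \<noteq> f"
  have E: "e \<in> E" "f \<in> E" using assms inner_subset by blast+
  define z where "z g = 1 * ind {e} g + (-1) * ind {f} g" for g
  have "z e = 0"
  proof (rule rigid)
    show "z g = 0" if "g \<notin> IU" for g using that assms by (auto simp: z_def ind_def)
    show "sum z (cutE {v}) = 0" if v: "v \<in> V" for v
    proof -
      have "e \<in> cutE {v} \<longleftrightarrow> f \<in> cutE {v}" using cut_single[OF v] E assms(3) by auto
      hence "sum (ind {e}) (cutE {v}) = sum (ind {f}) (cutE {v})"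
        by (cases "f \<in> cutE {v}") (auto simp: sum_ind)
      thus ?thesis unfolding z_def sum_lin by simp
    qed
  qed
  thus False using ne by (simp add: z_def ind_def)
qed

lemma IU_cut:
  assumes "e \<in> IU"
  shows "e \<in> E" "e \<notin> cutE U"
proof -
  show e: "e \<in> E" using assms inner_subset by blast
  obtain a b where ab: "ends e = {a, b}" "a \<noteq> b" using e by (rule edgeE)
  show "e \<notin> cutE U" using assms unfolding in_cut[OF e ab] in_inner[OF e ab(1)] by simp
qed

text \<open>Otherwise the cut of \<open>U\<close> splits into those of \<open>u\<close> and of the
  even set \<open>U - {u}\<close>; tightness leaves no weight for the latter.\<close>

lemma inner_degree_nonzero:
  assumes u: "u \<in> U"
  shows "IU \<inter> cutE {u} \<noteq> {}"
proof
  assume empty: "IU \<inter> cutE {u} = {}"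
  have uV: "u \<in> V" using u U_odds(2) by blast
  have disj: "(U - {u}) \<inter> {u} = {}" and UU: "U - {u} \<union> {u} = U" using u by auto
  have "betweenE (U - {u}) {u} = {}"
  proof (rule ccontr)
    assume "betweenE (U - {u}) {u} \<noteq> {}"
    then obtain e where e: "e \<in> betweenE (U - {u}) {u}" by blast
    hence eE: "e \<in> E" using between_subset by blast
    then obtain a b where ab: "ends e = {a, b}" "a \<noteq> b" by (rule edgeE)
    have "e \<in> IU \<inter> cutE {u}"
      using e u ab unfolding in_between[OF eE ab(1)] Int_iff in_cut[OF eE ab] in_inner[OF eE ab(1)] by auto
    thus False using empty by blast
  qed
  hence "sum x1 (cutE U) = sum x1 (cutE (U - {u})) + sum x1 (cutE {u})"
    using cut_disjoint_union[OF disj, of x1] UU by simp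
  hence "sum x1 (cutE (U - {u})) = 0"
    using U_odds(6) L_degree[OF x1_L uV] by (simp add: excess_def)
  hence "cutE (U - {u}) = {}" by (intro x1_cut_empty) simp
  moreover have "card (U - {u}) = card U - 1" using u by simp
  hence "even (card (U - {u}))" "U - {u} \<noteq> {}" using U_odds(3,4) by fastforce+
  ultimately show False using no_isolated_even[of "U - {u}"] U_odds(2) U_not_V[of "U - {u}"] by blast
qed

text \<open>If \<open>e = uw\<close> were the only inner edge at \<open>u\<close>, dropping both
  ends would give an odd set whose excess differs from that of \<open>U\<close> by twice the weight
  of the edges from \<open>w\<close> out of \<open>U\<close>. At \<open>x1\<close> these summands
  must both vanish, so there are no such edges, and the smaller set has the same excess on
  \<open>L\<close> as \<open>U\<close>.\<close>

lemma inner_degree_not_one: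
  assumes u: "u \<in> U"
  shows "card (IU \<inter> cutE {u}) \<noteq> 1"
proof
  assume "card (IU \<inter> cutE {u}) = 1"
  then obtain e where e: "IU \<inter> cutE {u} = {e}" by (rule card_1_singletonE)
  have eIU: "e \<in> IU" "e \<in> cutE {u}" using e by blast+
  have eE: "e \<in> E" using eIU inner_subset by blast
  have uV: "u \<in> V" using u U_odds(2) by blast
  obtain a b where ab: "ends e = {a, b}" "a \<noteq> b" using eE by (rule edgeE)
  have "u = a \<or> u = b" using inner_cut_single[OF eE ab uV] eIU(2) by simp
  then obtain w where w: "ends e = {u, w}" "u \<noteq> w" using ab by (metis insert_commute)
  have wU: "w \<in> U" using eIU(1) in_inner[OF eE w(1)] by simp
  have wV: "w \<in> V" using wU U_odds(2) by blast
  define X where "X = U - {u, w}"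
  define S where "S = cutE {w} - IU"
  have XV: "X \<subseteq> V" using U_odds(2) by (auto simp: X_def)
  have "card {u, w} = 2" using w(2) by simp
  hence cX: "card X + 2 = card U"
    using card_Diff_subset[of "{u, w}" U] card_mono[of U "{u, w}"] u wU finite_U by (simp add: X_def)
  have oX: "odd (card X)" using cX U_odds(3) by presburger
  have disj: "X \<inter> {u, w} = {}" and UX: "X \<union> {u, w} = U" using u wU by (auto simp: X_def)
  have inn: "innerE {u, w} = {e}"
  proof (intro equalityI subsetI)
    fix f assume f: "f \<in> innerE {u, w}"
    have fE: "f \<in> E" using f inner_subset by blast
    obtain c d where cd: "ends f = {c, d}" "c \<noteq> d" using fE by (rule edgeE)
    have "ends f = {u, w}" using f cd unfolding in_inner[OF fE cd(1)] by auto
    moreover have "f \<in> IU" using f u wU by (auto simp: inner_def)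
    ultimately have "f = e" using no_parallel[of f e] eIU(1) w(1) by simp
    thus "f \<in> {e}" by simp
  qed (use eE w in \<open>simp add: inner_def\<close>)
  have btw: "betweenE X {u, w} = (IU \<inter> cutE {w}) - {e}"
  proof (intro set_eqI)
    fix f show "f \<in> betweenE X {u, w} \<longleftrightarrow> f \<in> (IU \<inter> cutE {w}) - {e}"
    proof (cases "f \<in> E")
      case True
      then obtain c d where cd: "ends f = {c, d}" "c \<noteq> d" by (rule edgeE)
      have 1: "f \<noteq> e" if "f \<in> IU" "\<not> {c, d} = {u, w}" using that cd(1) w(1) by auto
      have 2: "f = e" if "f \<in> IU" "{c, d} = {u, w}" using no_parallel[OF that(1) eIU(1)] that(2) cd(1) w(1) by simp
      have 3: "f = e" if "f \<in> IU" "u = c \<or> u = d"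
      proof -
        have "f \<in> IU \<inter> cutE {u}" using that inner_cut_single[OF True cd uV] by simp
        thus ?thesis unfolding e by simp
      qed
      show ?thesis
        unfolding in_between[OF True cd(1)] Diff_iff Int_iff inner_cut_single[OF True cd wV]
        using 1 2 3 in_inner[OF True cd(1), of U] u wU w(2) cd(2) by (auto simp: X_def)
    qed (auto simp: between_def inner_def)
  qed
  have eq: "excess U y = excess X y + 2 * sum y S" if y: "y \<in> L" for y
  proof -
    have dec: "sum y (cutE {v}) = sum y (IU \<inter> cutE {v}) + sum y (cutE {v} - IU)" for v
    proof -
      have "IU \<inter> cutE {v} \<union> (cutE {v} - IU) = cutE {v}" by blast
      thus ?thesis using sum.union_disjoint[of "IU \<inter> cutE {v}" "cutE {v} - IU" y] by auto
    qed
    have "sum y (IU \<inter> cutE {w}) = y e + sum y (IU \<inter> cutE {w} - {e})"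
      using eIU inner_cut_single[OF eE w wV] by (intro sum.remove) auto
    hence 1: "sum y (betweenE X {u, w}) = vdeg y - sum y S - y e"
      unfolding btw using dec[of w] L_degree[OF y wV] by (simp add: S_def)
    have "(\<Sum>v\<in>{u, w}. sum y (cutE {v})) = 2 * vdeg y"
      using L_degree[OF y] uV wV w(2) by simp
    hence 2: "sum y (cutE {u, w}) = 2 * vdeg y - 2 * y e"
      using sum_degrees[of "{u, w}" y] uV wV inn by simp
    show ?thesis
      using cut_disjoint_union[OF disj, of y] unfolding UX 1 2 excess_def by simp
  qed
  have "excess X x1 \<ge> 0" by (rule excess_nonneg[OF x1_C XV oX])
  moreover have S0: "sum x1 S \<ge> 0" by (rule sum_nonneg) (simp add: C_nonneg[OF x1_C])
  ultimately have 0: "excess X x1 = 0" "sum x1 S = 0" using eq[OF x1_L] U_odds(6) by simp_all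
  have "S = {}"
    by (rule sum_nonpos_empty[of _ x1]) (use 0 x1_pos cut_subset in \<open>auto simp: S_def\<close>)
  hence same: "excess U x = excess X x" using eq[OF x_L] by simp
  have pos: "excess U x > 0" by (rule excess_x_pos[OF U_odds(1)])
  show False using XV oX
  proof (cases rule: odd_cases)
    case 1
    hence "Inr X \<in> tight x1" using 0 by (simp add: tight_def)
    hence "card U \<le> card X" using smallest x1 unfolding facet_sets_def by blast
    thus False using cX by simp
  next
    case (2 v)
    thus False using same pos excess_single[OF x_L, of v] by simp
  next
    case (3 v)
    thus False using same pos excess_single[OF x_L, of v] excess_compl[of X x] by simp
  qed
qed

lemma card_IU: "card IU \<le> card U"
proof (rule ccontr)
  assume "\<not> ?thesis"
  hence "card U < card IU" by simp
  then obtain z :: "'e \<Rightarrow> rat" where z: "\<exists>e\<in>IU. z e \<noteq> 0" "\<forall>e. e \<notin> IU \<longrightarrow> z e = 0"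
    "\<forall>v\<in>U \<inter> V. sum z (cutE {v}) = 0"
    by (rule kernel_vector[OF inner_subset finite_U])
  have "z e = 0" for e
  proof (rule rigid)
    show "sum z (cutE {v}) = 0" if v: "v \<in> V" for v
    proof (cases "v \<in> U")
      case False
      have "z f = 0" if "f \<in> cutE {v}" for f
      proof -
        have "f \<notin> IU" using that cut_single[OF v] False by (auto simp: inner_def)
        thus ?thesis using z(2) by blast
      qed
      thus ?thesis by simp
    qed (use z(3) v in blast)
  qed (use z(2) in blast)
  thus False using z(1) by blast
qed

text \<open>The inner degrees are at least 2 and sum to \<open>2 * card IU\<close>, which is at most
  \<open>2 * card U\<close> by independence; so equality holds everywhere.\<close>

lemma inner_degree:
  assumes u: "u \<in> U"
  shows "card (IU \<inter> cutE {u}) = 2"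
proof -
  have ge: "card (IU \<inter> cutE {v}) \<ge> 2" if "v \<in> U" for v
  proof -
    have "card (IU \<inter> cutE {v}) \<noteq> 0" using inner_degree_nonzero[OF that] by simp
    thus ?thesis using inner_degree_not_one[OF that] by linarith
  qed
  have "IU \<inter> cutE U = {}" using IU_cut by blast
  hence "(\<Sum>v\<in>U. sum (ind IU) (cutE {v})) = 2 * of_nat (card IU)"
    using sum_degrees[OF U_odds(2), of "ind IU"] by (simp add: sum_ind)
  hence "(of_nat (\<Sum>v\<in>U. card (IU \<inter> cutE {v})) :: rat) = of_nat (2 * card IU)"
    by (simp add: sum_ind)
  hence s: "(\<Sum>v\<in>U. card (IU \<inter> cutE {v})) = 2 * card IU" by (simp only: of_nat_eq_iff)
  show ?thesis
  proof (rule ccontr)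
    assume "\<not> ?thesis"
    hence "2 < card (IU \<inter> cutE {u})" using ge[OF u] by simp
    hence "(\<Sum>v\<in>U. 2) < (\<Sum>v\<in>U. card (IU \<inter> cutE {v}))"
      using ge u by (intro sum_strict_mono_ex1) auto
    thus False using s card_IU by simp
  qed
qed

section \<open>The cycle induced by U\<close>

definition adj :: "'v \<Rightarrow> 'v \<Rightarrow> bool" where
  "adj a b \<longleftrightarrow> a \<noteq> b \<and> (\<exists>e\<in>IU. ends e = {a, b})"

lemma adj_sym: "adj a b \<Longrightarrow> adj b a"
  by (auto simp: adj_def insert_commute)

lemma adj_U: "adj a b \<Longrightarrow> a \<in> U \<and> b \<in> U"
  by (auto simp: adj_def inner_def)

lemma two_neighbours:
  assumes u: "u \<in> U"
  obtains a b where "a \<noteq> b" "{w. adj u w} = {a, b}"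
proof -
  have uV: "u \<in> V" using u U_odds(2) by blast
  obtain e f where ef: "IU \<inter> cutE {u} = {e, f}" "e \<noteq> f"
    using inner_degree[OF u] by (auto simp: card_2_iff)
  have other: "\<exists>w. ends g = {u, w} \<and> u \<noteq> w" if g: "g \<in> IU \<inter> cutE {u}" for g
  proof -
    have gE: "g \<in> E" using g inner_subset by blast
    obtain c d where cd: "ends g = {c, d}" "c \<noteq> d" using gE by (rule edgeE)
    have "u = c \<or> u = d" using inner_cut_single[OF gE cd uV] g by simp
    thus ?thesis using cd by (metis insert_commute)
  qed
  obtain a where a: "ends e = {u, a}" "u \<noteq> a" using other[of e] ef by blast
  obtain b where b: "ends f = {u, b}" "u \<noteq> b" using other[of f] ef by blast
  have efI: "e \<in> IU" "f \<in> IU" using ef by blast+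
  have "a \<noteq> b" using no_parallel[OF efI] a b ef(2) by auto
  moreover have "{w. adj u w} = {a, b}"
  proof (intro equalityI subsetI)
    fix w assume "w \<in> {w. adj u w}"
    then obtain g where g: "g \<in> IU" "ends g = {u, w}" "u \<noteq> w" by (auto simp: adj_def)
    have gE: "g \<in> E" using g(1) inner_subset by blast
    have "g \<in> IU \<inter> cutE {u}" using g inner_cut_single[OF gE g(2,3) uV] by simp
    hence "g = e \<or> g = f" unfolding ef by simp
    thus "w \<in> {a, b}" using g(2,3) a b by (auto simp: doubleton_eq_iff)
  qed (use a b efI in \<open>auto simp: adj_def\<close>)
  ultimately show ?thesis by (rule that)
qed

lemma no_three_neighbours:
  assumes "adj u a" "adj u b" "adj u c" "a \<noteq> b" "b \<noteq> c" "a \<noteq> c"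
  shows False
proof -
  have "u \<in> U" using adj_U[OF assms(1)] by simp
  then obtain r s where rs: "r \<noteq> s" "{w. adj u w} = {r, s}" by (rule two_neighbours)
  have "a \<in> {r, s}" "b \<in> {r, s}" "c \<in> {r, s}" using assms(1-3) rs(2) by blast+
  thus False using assms(4-6) by auto
qed

definition path :: "'v list \<Rightarrow> bool" where
  "path p \<longleftrightarrow> p \<noteq> [] \<and> distinct p \<and> set p \<subseteq> U \<and> (\<forall>i. Suc i < length p \<longrightarrow> adj (p ! i) (p ! Suc i))"

text \<open>The last vertex of a longest path has a second neighbour on the path; as no vertex has three
  neighbours, this is the first vertex.\<close>

lemma cycle_exists:
  obtains p where "path p" "length p \<ge> 3" "adj (p ! (length p - 1)) (p ! 0)"
proof -
  obtain u where u: "u \<in> U" using U_odds(4) by fastforce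
  have p0: "path [u]" using u by (simp add: path_def)
  have bound: "length p \<le> card U" if "path p" for p
  proof -
    have "card (set p) \<le> card U" using that by (intro card_mono) (auto simp: path_def)
    thus ?thesis using that by (simp add: path_def distinct_card)
  qed
  have "\<exists>p. path p \<and> (\<forall>q. path q \<longrightarrow> length q \<le> length p)"
    using ex_has_greatest_nat[of path "[u]" length "Suc (card U)"] p0 bound by (auto simp: less_Suc_eq_le)
  then obtain p where p: "path p" and max: "\<And>q. path q \<Longrightarrow> length q \<le> length p" by blast
  define m where "m = length p - 1"
  have len: "length p = Suc m" using p by (simp add: m_def path_def)
  have pd: "distinct p" and pU: "set p \<subseteq> U" and pa: "\<And>i. i < m \<Longrightarrow> adj (p ! i) (p ! Suc i)"
    using p len by (auto simp: path_def)
  have on: "\<exists>i<m. w = p ! i" if w: "adj (p ! m) w" for w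
  proof -
    have "w \<in> set p"
    proof (rule ccontr)
      assume "w \<notin> set p"
      hence "path (p @ [w])"
        using p w adj_U[OF w] len unfolding path_def by (auto simp: nth_append less_Suc_eq)
      thus False using max by fastforce
    qed
    then obtain i where i: "i < length p" "w = p ! i" by (auto simp: in_set_conv_nth)
    have "i \<noteq> m" using w i(2) by (auto simp: adj_def)
    thus ?thesis using i len by (intro exI[of _ i]) simp
  qed
  have "p ! m \<in> U" using pU len by auto
  then obtain a b where ab: "a \<noteq> b" "{w. adj (p ! m) w} = {a, b}" by (rule two_neighbours)
  have adja: "adj (p ! m) a" "adj (p ! m) b" using ab(2) by blast+
  obtain i where i: "i < m" "a = p ! i" using on[OF adja(1)] by blast
  obtain j where j: "j < m" "b = p ! j" using on[OF adja(2)] by blast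
  have ij: "i \<noteq> j" using ab(1) i j by blast
  have "\<exists>l. l < m \<and> l \<noteq> m - 1 \<and> adj (p ! m) (p ! l)"
  proof (cases "i = m - 1")
    case True
    thus ?thesis using j ij adja by (intro exI[of _ j]) simp
  next
    case False
    thus ?thesis using i adja by (intro exI[of _ i]) simp
  qed
  then obtain l where l: "l < m" "l \<noteq> m - 1" "adj (p ! m) (p ! l)" by blast
  have "l = 0"
  proof (rule ccontr)
    assume l0: "l \<noteq> 0"
    have s: "Suc (l - 1) = l" using l0 by simp
    have "adj (p ! (l - 1)) (p ! Suc (l - 1))" by (rule pa) (use l in simp)
    hence 1: "adj (p ! l) (p ! (l - 1))" unfolding s by (rule adj_sym)
    have 2: "adj (p ! l) (p ! Suc l)" using pa l(1) by blast
    have 3: "adj (p ! l) (p ! m)" using l(3) by (rule adj_sym)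
    have "p ! (l - 1) \<noteq> p ! Suc l" "p ! Suc l \<noteq> p ! m" "p ! (l - 1) \<noteq> p ! m"
      using pd l l0 len by (auto simp: nth_eq_iff_index_eq)
    thus False using no_three_neighbours[OF 1 2 3] by blast
  qed
  hence "adj (p ! m) (p ! 0)" using l(3) by simp
  moreover have "length p \<ge> 3" using len l by linarith
  ultimately show ?thesis using that p by (simp add: m_def)
qed

text \<open>A cycle \<open>Q\<close> has no edges to the other vertices of \<open>U\<close>, since
  all degrees are 2. If \<open>Q\<close> were not all of \<open>U\<close>, the cut of
  \<open>U\<close> would split into those of \<open>Q\<close> and \<open>U - Q\<close>; the odd one
  of the two takes the whole weight, and the even one would be isolated.\<close>

lemma odd_cycle:
  obtains k f \<epsilon> where "odd k" "k \<ge> 3" "bij_betw f {..<k} U"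
    "\<forall>i<k. \<epsilon> i \<in> IU \<and> ends (\<epsilon> i) = {f i, f (Suc i mod k)}" "\<forall>e\<in>IU. \<exists>i<k. e = \<epsilon> i"
proof -
  obtain p where p: "path p" "length p \<ge> 3" "adj (p ! (length p - 1)) (p ! 0)" by (rule cycle_exists)
  define k where "k = length p"
  define f where "f i = p ! i" for i
  have k3: "k \<ge> 3" using p(2) by (simp add: k_def)
  have pd: "distinct p" and pU: "set p \<subseteq> U" using p(1) by (auto simp: path_def)
  have inj: "f i = f j \<longleftrightarrow> i = j" if "i < k" "j < k" for i j
    using that pd by (simp add: f_def k_def nth_eq_iff_index_eq)
  have fU: "f i \<in> U" if "i < k" for i using that pU by (auto simp: f_def k_def)
  have adjf: "adj (f i) (f (Suc i mod k))" if i: "i < k" for i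
  proof (cases "Suc i < k")
    case True
    thus ?thesis using p(1) by (simp add: path_def f_def k_def)
  next
    case False
    hence "Suc i = k" using i by simp
    hence "i = length p - 1" "Suc i mod k = 0" by (auto simp: k_def)
    thus ?thesis using p(3) by (simp add: f_def)
  qed
  have "\<forall>i. \<exists>e. i < k \<longrightarrow> e \<in> IU \<and> ends e = {f i, f (Suc i mod k)}"
    using adjf unfolding adj_def by blast
  then obtain \<epsilon> where \<epsilon>: "\<forall>i. i < k \<longrightarrow> \<epsilon> i \<in> IU \<and> ends (\<epsilon> i) = {f i, f (Suc i mod k)}"
    by (rule choice[THEN exE])
  have nb: "w = f (Suc i mod k) \<or> w = f ((i + k - 1) mod k)" if i: "i < k" and w: "adj (f i) w" for i w
  proof (rule ccontr)
    assume neg: "\<not> ?thesis"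
    define j where "j = (i + k - 1) mod k"
    have jk: "j < k" "Suc i mod k < k" using k3 by (auto simp: j_def)
    have ji: "Suc j mod k = i" unfolding j_def using i k3 by (simp add: mod_Suc_eq)
    have a1: "adj (f i) (f j)" using adjf[OF jk(1)] adj_sym unfolding ji by blast
    have "j \<noteq> Suc i mod k"
    proof
      assume "j = Suc i mod k"
      hence "Suc (Suc i) mod k = i" using ji by (metis mod_Suc_eq)
      thus False using i k3 by (cases "Suc (Suc i) < k") (auto simp: mod_if split: if_splits)
    qed
    hence "f j \<noteq> f (Suc i mod k)" using inj jk by blast
    thus False using no_three_neighbours[OF a1 adjf[OF i] w] neg unfolding j_def by blast
  qed
  define Q where "Q = f ` {..<k}"
  have QU: "Q \<subseteq> U" using fU by (auto simp: Q_def)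
  have closed: "w \<in> Q" if "v \<in> Q" "adj v w" for v w
    using that nb k3 by (fastforce simp: Q_def)
  have "Q = U"
  proof (rule ccontr)
    assume ne: "Q \<noteq> U"
    define R where "R = U - Q"
    have R: "R \<noteq> {}" "R \<subseteq> U" using ne QU by (auto simp: R_def)
    have Qne: "Q \<noteq> {}" using k3 by (auto simp: Q_def lessThan_empty_iff)
    have disj: "Q \<inter> R = {}" and QR: "Q \<union> R = U" using QU by (auto simp: R_def)
    have "betweenE Q R = {}"
    proof (rule ccontr)
      assume "betweenE Q R \<noteq> {}"
      then obtain e where e: "e \<in> betweenE Q R" by blast
      hence eE: "e \<in> E" using between_subset by blast
      then obtain a b where ab: "ends e = {a, b}" "a \<noteq> b" by (rule edgeE)
      have ba: "ends e = {b, a}" using ab(1) by auto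
      have m: "(a \<in> Q \<and> b \<in> R) \<or> (b \<in> Q \<and> a \<in> R)"
        using e disj unfolding in_between[OF eE ab(1)] by blast
      hence "e \<in> IU" using QU R(2) unfolding in_inner[OF eE ab(1)] by blast
      hence "adj a b" "adj b a" using ab ba unfolding adj_def by blast+
      thus False using m closed disj by blast
    qed
    hence s: "sum x1 (cutE Q) + sum x1 (cutE R) = vdeg x1"
      using cut_disjoint_union[OF disj, of x1] QR U_odds(6) by (simp add: excess_def)
    have c: "card U = card Q + card R"
      using card_Un_disjoint[OF _ _ disj] finite_subset[OF QU] finite_subset[OF R(2)] QR by simp
    have V: "Q \<subseteq> V" "R \<subseteq> V" using QU R(2) U_odds(2) by blast+
    show False
    proof (cases "odd (card Q)")
      case True
      hence "sum x1 (cutE Q) \<ge> vdeg x1" using excess_nonneg[OF x1_C V(1)] by (simp add: excess_def)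
      hence "cutE R = {}" using s by (intro x1_cut_empty) simp
      moreover have "even (card R)" using c True U_odds(3) by presburger
      ultimately show False using no_isolated_even[OF V(2)] R U_not_V[of R] by blast
    next
      case False
      hence "odd (card R)" using c U_odds(3) by presburger
      hence "sum x1 (cutE R) \<ge> vdeg x1" using excess_nonneg[OF x1_C V(2)] by (simp add: excess_def)
      hence "cutE Q = {}" using s by (intro x1_cut_empty) simp
      thus False using no_isolated_even[OF V(1)] False Qne U_not_V[of Q] QU by blast
    qed
  qed
  hence bij: "bij_betw f {..<k} U" using inj by (auto simp: bij_betw_def inj_on_def Q_def)
  hence "card {..<k} = card U" by (rule bij_betw_same_card)
  hence ok: "odd k" using U_odds(3) by simp
  have all: "\<exists>i<k. e = \<epsilon> i" if e: "e \<in> IU" for e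
  proof -
    have eE: "e \<in> E" using e inner_subset by blast
    obtain a b where ab: "ends e = {a, b}" "a \<noteq> b" using eE by (rule edgeE)
    have "a \<in> U" using e in_inner[OF eE ab(1)] by simp
    then obtain i where i: "i < k" "a = f i" using \<open>Q = U\<close> by (auto simp: Q_def)
    have "adj (f i) b" using e ab i by (auto simp: adj_def)
    hence "b = f (Suc i mod k) \<or> b = f ((i + k - 1) mod k)" by (rule nb[OF i(1)])
    thus ?thesis
    proof
      assume "b = f (Suc i mod k)"
      hence "ends e = ends (\<epsilon> i)" using \<epsilon> i ab by simp
      thus ?thesis using no_parallel[OF e] \<epsilon> i(1) by blast
    next
      assume b: "b = f ((i + k - 1) mod k)"
      let ?j = "(i + k - 1) mod k"
      have j: "?j < k" "Suc ?j mod k = i" using i k3 by (simp_all add: mod_Suc_eq)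
      hence "ends (\<epsilon> ?j) = {f ?j, f i}" using \<epsilon> by (metis (no_types))
      hence "ends e = ends (\<epsilon> ?j)" using b i(2) ab(1) by auto
      thus ?thesis using no_parallel[OF e] \<epsilon> j(1) by blast
    qed
  qed
  show ?thesis using that[OF ok k3 bij] \<epsilon> all by blast
qed

end

section \<open>Matchings of an odd cycle that miss positions of alternating parity\<close>

definition rank :: "nat set \<Rightarrow> nat \<Rightarrow> nat" where
  "rank J i = card (J \<inter> {..i})"

lemma rank_Suc: "rank J (Suc i) = rank J i + of_bool (Suc i \<in> J)"
proof -
  have "J \<inter> {..Suc i} = (if Suc i \<in> J then insert (Suc i) (J \<inter> {..i}) else J \<inter> {..i})"
    by (auto simp: le_Suc_eq)
  thus ?thesis by (simp add: rank_def)
qed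

lemma rank_0: "rank J 0 = of_bool (0 \<in> J)"
proof -
  have "J \<inter> {..0} = (if 0 \<in> J then {0} else {})" by auto
  thus ?thesis by (simp add: rank_def)
qed

definition cyc_pred :: "nat \<Rightarrow> nat \<Rightarrow> nat" where
  "cyc_pred k i = (if i = 0 then k - 1 else i - 1)"

text \<open>On an odd cycle, deleting positions of alternating parity leaves a perfect matching, which
  uses the edge from \<open>i\<close> to \<open>i + 1\<close> iff \<open>i + rank J i + q\<close> is even.\<close>

lemma alternating_matching:
  assumes J: "J \<subseteq> {..<k}" "odd (card J)" and k: "odd k"
    and alt: "\<And>i. i \<in> J \<Longrightarrow> odd (i + rank J i + q)" and i: "i < k"
  shows "i \<in> J \<Longrightarrow> odd (i + rank J i + q) \<and> odd (cyc_pred k i + rank J (cyc_pred k i) + q)"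
    and "i \<notin> J \<Longrightarrow> even (i + rank J i + q) \<noteq> even (cyc_pred k i + rank J (cyc_pred k i) + q)"
proof -
  \<comment> \<open>This matters at the wrap-around: \<open>k - 1\<close> is even and
    \<open>card J\<close> is odd, so \<open>k - 1\<close> has the parity of a position -1 with rank
    0.\<close>
  have full: "rank J (k - 1) = card J"
  proof -
    have "J \<inter> {..k - 1} = J" using J(1) by auto
    thus ?thesis by (simp add: rank_def)
  qed
  have *: "(i \<in> J \<longrightarrow> odd (i + rank J i + q) \<and> odd (cyc_pred k i + rank J (cyc_pred k i) + q)) \<and>
    (i \<notin> J \<longrightarrow> even (i + rank J i + q) \<noteq> even (cyc_pred k i + rank J (cyc_pred k i) + q))"
  proof (cases i)
    case 0
    have "k \<ge> 1" using i by simp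
    thus ?thesis using 0 alt[of 0] full J(2) k by (auto simp: cyc_pred_def rank_0)
  next
    case (Suc j)
    thus ?thesis using alt[of i] by (auto simp: cyc_pred_def rank_Suc)
  qed
  show "i \<in> J \<Longrightarrow> odd (i + rank J i + q) \<and> odd (cyc_pred k i + rank J (cyc_pred k i) + q)"
    and "i \<notin> J \<Longrightarrow> even (i + rank J i + q) \<noteq> even (cyc_pred k i + rank J (cyc_pred k i) + q)"
    using * by blast+
qed

text \<open>\<open>B\<close> lists the cycle edges of a matching, where edge \<open>i\<close> joins
  positions \<open>i\<close> and \<open>i + 1\<close>. Position \<open>i + 1\<close> is either
  unmatched, or matched forwards, or matched backwards; in each case
  \<open>i + rank J i + of_bool (i \<in> B)\<close> keeps its parity.\<close>

lemma unmatched_alternating: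
  assumes J: "J = {i. i < k \<and> i \<notin> B \<and> cyc_pred k i \<notin> B}"
    and B: "\<And>i. i < k \<Longrightarrow> i \<in> B \<Longrightarrow> cyc_pred k i \<notin> B"
  obtains q where "\<And>i. i \<in> J \<Longrightarrow> even (i + rank J i + q)"
proof -
  define q where "q = rank J 0 + of_bool (0 \<in> B)"
  have inv: "even (i + rank J i + of_bool (i \<in> B) + q)" if "i < k" for i
    using that
  proof (induction i)
    case (Suc i)
    have "cyc_pred k (Suc i) = i" by (simp add: cyc_pred_def)
    hence "Suc i \<in> J \<longleftrightarrow> Suc i \<notin> B \<and> i \<notin> B" "\<not> (Suc i \<in> B \<and> i \<in> B)"
      using Suc.prems B[of "Suc i"] by (auto simp: J)
    thus ?case using Suc by (auto simp: rank_Suc)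
  qed (simp add: q_def)
  have "even (i + rank J i + q)" if i: "i \<in> J" for i
  proof -
    have "i < k" "i \<notin> B" using i by (simp_all add: J)
    thus ?thesis using inv[of i] by simp
  qed
  thus ?thesis by (rule that)
qed

lemma symd_image:
  assumes "inj_on g D" "A \<subseteq> D" "B \<subseteq> D"
  shows "symd (g ` A) (g ` B) = g ` symd A B"
  unfolding symd_def using inj_on_image_set_diff[OF assms(1)] assms(2,3)
  by (simp add: image_Un Diff_subset subset_trans[OF Diff_subset])

lemma symd_Un:
  assumes "W \<inter> A = {}" "W \<inter> B = {}"
  shows "symd (W \<union> A) (W \<union> B) = symd A B" "symd (W \<union> A) B = W \<union> symd A B"
  using assms unfolding symd_def by blast+

lemma symd_commute: "symd A B = symd B A"
  by (auto simp: symd_def)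

context rigid_facet
begin

section \<open>Perfect matchings crossing the cut of U in three or five edges\<close>

definition spokes :: "'e set \<Rightarrow> 'v set" where
  "spokes M = {u \<in> U. \<exists>e\<in>M \<inter> cutE U. u \<in> ends e}"

lemma card_spokes:
  assumes M: "M \<in> PM"
  shows "card (spokes M) = card (M \<inter> cutE U)"
proof -
  have one: "\<exists>u. ends e \<inter> U = {u}" if "e \<in> M \<inter> cutE U" for e
    using that by (auto simp: cut_def card_1_singleton_iff)
  then obtain h where h: "\<And>e. e \<in> M \<inter> cutE U \<Longrightarrow> ends e \<inter> U = {h e}" by metis
  have hm: "h e \<in> ends e" "h e \<in> U" if "e \<in> M \<inter> cutE U" for e using h[OF that] by blast+
  have "inj_on h (M \<inter> cutE U)"
  proof
    fix e f assume e: "e \<in> M \<inter> cutE U" and f: "f \<in> M \<inter> cutE U" and eq: "h e = h f"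
    have "h e \<in> V" using hm(2)[OF e] U_odds(2) by blast
    moreover have "h e \<in> ends f" using hm(1)[OF f] eq by simp
    ultimately show "e = f" using pm_edge_unique[OF M _ _ _ hm(1)[OF e]] e f by blast
  qed
  moreover have "h ` (M \<inter> cutE U) = spokes M"
  proof (intro equalityI subsetI)
    fix u assume "u \<in> spokes M"
    then obtain e where e: "u \<in> U" "e \<in> M \<inter> cutE U" "u \<in> ends e" by (auto simp: spokes_def)
    have "u \<in> ends e \<inter> U" using e by simp
    hence "u = h e" unfolding h[OF e(2)] by simp
    thus "u \<in> h ` (M \<inter> cutE U)" using e(2) by (rule image_eqI)
  qed (use hm in \<open>auto simp: spokes_def\<close>)
  ultimately show ?thesis using card_image by fastforce
qed

lemma IU_or_cut:
  assumes "e \<in> E" "u \<in> U" "u \<in> ends e" "e \<notin> IU"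
  shows "e \<in> cutE U"
proof -
  obtain a b where ab: "ends e = {a, b}" "a \<noteq> b" using assms(1) by (rule edgeE)
  show ?thesis using assms(2-4) ab(1) unfolding in_cut[OF assms(1) ab] in_inner[OF assms(1) ab(1)] by auto
qed

lemma outside_covered:
  assumes M: "M \<in> PM"
  shows "matching ends (M - IU)" "covered ends (M - IU) = (V - U) \<union> spokes M"
proof -
  note mM = pm_matching[OF M]
  show "matching ends (M - IU)" using mM(1) by (simp add: matching_def)
  show "covered ends (M - IU) = (V - U) \<union> spokes M"
  proof (intro equalityI subsetI)
    fix v assume "v \<in> covered ends (M - IU)"
    then obtain e where e: "e \<in> M" "e \<notin> IU" "v \<in> ends e" by blast
    have vV: "v \<in> V" using mM(2) e by blast
    have eE: "e \<in> E" using pms_subset[OF M] e(1) by blast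
    show "v \<in> (V - U) \<union> spokes M"
    proof (cases "v \<in> U")
      case True
      hence "e \<in> cutE U" using IU_or_cut eE e by blast
      thus ?thesis using True e by (auto simp: spokes_def)
    qed (use vV in simp)
  next
    fix v assume v: "v \<in> (V - U) \<union> spokes M"
    show "v \<in> covered ends (M - IU)"
    proof (cases "v \<in> U")
      case True
      then obtain e where e: "e \<in> M \<inter> cutE U" "v \<in> ends e" using v by (auto simp: spokes_def)
      hence "e \<notin> IU" using IU_cut(2) by blast
      thus ?thesis using e by blast
    next
      case False
      hence "v \<in> V" using v by (auto simp: spokes_def)
      then obtain e where e: "e \<in> M" "v \<in> ends e" by (rule pm_edge_exists[OF M])
      have "e \<notin> IU" using e False by (auto simp: inner_def)
      thus ?thesis using e by blast
    qed
  qed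
qed

lemma combine_matchings:
  assumes N: "N \<subseteq> E - IU" "matching ends N" "covered ends N = (V - U) \<union> S"
    and S: "S \<subseteq> U" and Q: "Q \<subseteq> IU" "matching ends Q" "covered ends Q = U - S"
  shows "N \<union> Q \<in> PM" "card ((N \<union> Q) \<inter> cutE U) = card S"
proof -
  have disj: "ends e \<inter> ends f = {}" if "e \<in> N" "f \<in> Q" for e f
    using that N(3) Q(3) S U_odds(2) by blast
  have "matching ends (N \<union> Q)"
    using N(2) Q(2) disj unfolding matching_def by (metis Int_commute UnE)
  moreover have "covered ends (N \<union> Q) = V"
    unfolding image_Un Union_Un_distrib N(3) Q(3) using S U_odds(2) by blast
  moreover have "N \<union> Q \<subseteq> E" using N(1) Q(1) inner_subset by blast
  ultimately show M: "N \<union> Q \<in> PM" by (intro matching_pm)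
  have "spokes (N \<union> Q) = S"
  proof (intro equalityI subsetI)
    fix u assume "u \<in> spokes (N \<union> Q)"
    then obtain e where e: "u \<in> U" "e \<in> N \<union> Q" "e \<in> cutE U" "u \<in> ends e" by (auto simp: spokes_def)
    hence "e \<in> N" using Q(1) IU_cut(2) by blast
    hence "u \<in> covered ends N" using e(4) by blast
    thus "u \<in> S" using N(3) e(1) by blast
  next
    fix u assume u: "u \<in> S"
    hence "u \<in> covered ends N" using N(3) by blast
    then obtain e where e: "e \<in> N" "u \<in> ends e" by blast
    have "e \<in> cutE U" using IU_or_cut[of e u] e u S N(1) by blast
    thus "u \<in> spokes (N \<union> Q)" using e u S by (auto simp: spokes_def)
  qed
  thus "card ((N \<union> Q) \<inter> cutE U) = card S" using card_spokes[OF M] by simp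
qed

text \<open>Some perfect matching \<open>M0\<close> crosses the cut of \<open>U\<close> more than
  once. Its own edges on the cycle show that the crossing positions alternate in parity along the
  cycle. Therefore a subset of them whose indices alternate again leaves a cycle with a perfect
  matching on the remaining vertices, and it suffices to find such a subset of size 3 or 5 that an
  outer matching can cover.\<close>

lemma small_crossing_pm:
  obtains M where "M \<in> PM" "card (M \<inter> cutE U) \<in> {3, 5}"
proof -
  obtain k f \<epsilon> where k: "odd k" "k \<ge> 3" and bij: "bij_betw f {..<k} U"
    and \<epsilon>: "\<forall>i<k. \<epsilon> i \<in> IU \<and> ends (\<epsilon> i) = {f i, f (Suc i mod k)}" and all: "\<forall>e\<in>IU. \<exists>i<k. e = \<epsilon> i"
    by (rule odd_cycle)
  have inj: "f i = f j \<longleftrightarrow> i = j" if "i < k" "j < k" for i j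
    using bij that by (auto simp: bij_betw_def inj_on_def)
  have fU: "f ` {..<k} = U" using bij by (simp add: bij_betw_def)
  have prd: "cyc_pred k i < k" "Suc (cyc_pred k i) mod k = i" if "i < k" for i
    using that k(2) by (auto simp: cyc_pred_def)
  have nxt: "Suc j mod k = i \<longleftrightarrow> j = cyc_pred k i" if "i < k" "j < k" for i j
    using that k(2) by (auto simp: cyc_pred_def mod_Suc split: if_splits)
  have endsf: "f i \<in> ends (\<epsilon> j) \<longleftrightarrow> j = i \<or> j = cyc_pred k i" if ij: "i < k" "j < k" for i j
  proof -
    have "Suc j mod k < k" using k(2) by simp
    hence "f i = f (Suc j mod k) \<longleftrightarrow> Suc j mod k = i" using inj[OF ij(1)] by auto
    thus ?thesis using \<epsilon> ij inj[OF ij] nxt[OF ij] by auto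
  qed
  have ne: "cyc_pred k i \<noteq> i" if "i < k" for i using k(2) that by (auto simp: cyc_pred_def)
  have \<epsilon>inj: "i = j" if ij: "i < k" "j < k" "\<epsilon> i = \<epsilon> j" for i j
  proof -
    have "f i \<in> ends (\<epsilon> i)" "f j \<in> ends (\<epsilon> j)" using \<epsilon> ij(1,2) by simp_all
    hence "f i \<in> ends (\<epsilon> j)" "f j \<in> ends (\<epsilon> i)" using ij(3) by simp_all
    hence "j = i \<or> j = cyc_pred k i" "i = j \<or> i = cyc_pred k j"
      unfolding endsf[OF ij(1,2)] endsf[OF ij(2,1)] .
    thus ?thesis using k(2) ij by (auto simp: cyc_pred_def split: if_splits)
  qed
  have kU: "Inr U \<in> K" "slack (Inr U) x > 0" using U_odds(1) excess_x_pos by simp_all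
  obtain M0 where M0: "M0 \<in> PM" "slack (Inr U) (ind M0) > 0" "\<forall>j\<in>tight x. slack j (ind M0) = 0"
    by (rule tight_pm[OF x_C kU])
  define B where "B = {i. i < k \<and> \<epsilon> i \<in> M0}"
  define J0 where "J0 = {i. i < k \<and> i \<notin> B \<and> cyc_pred k i \<notin> B}"
  have "cyc_pred k i \<notin> B" if i: "i < k" "i \<in> B" for i
  proof
    assume "cyc_pred k i \<in> B"
    hence "\<epsilon> i \<in> M0" "\<epsilon> (cyc_pred k i) \<in> M0" using i by (auto simp: B_def)
    moreover have "f i \<in> V" using i(1) fU U_odds(2) by blast
    ultimately have "\<epsilon> i = \<epsilon> (cyc_pred k i)"
      using pm_edge_unique[OF M0(1), of "f i" "\<epsilon> i" "\<epsilon> (cyc_pred k i)"] endsf i(1) prd(1)[OF i(1)] by simp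
    thus False using \<epsilon>inj[of i "cyc_pred k i"] prd(1) ne i(1) by force
  qed
  then obtain q where q: "\<And>i. i \<in> J0 \<Longrightarrow> even (i + rank J0 i + q)"
    using unmatched_alternating[OF J0_def] by blast
  have sp0: "spokes M0 = f ` J0"
  proof -
    have "f i \<in> spokes M0 \<longleftrightarrow> i \<in> J0" if i: "i < k" for i
    proof -
      have fi: "f i \<in> U" "f i \<in> V" using i fU U_odds(2) by blast+
      obtain e where e: "e \<in> M0" "f i \<in> ends e" by (rule pm_edge_exists[OF M0(1) fi(2)])
      have eE: "e \<in> E" using pms_subset[OF M0(1)] e(1) by blast
      have uniq: "g = e" if "g \<in> M0" "f i \<in> ends g" for g
        using pm_edge_unique[OF M0(1) fi(2) that(1) e(1) that(2) e(2)] .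
      show ?thesis
      proof (cases "e \<in> IU")
        case True
        then obtain j where j: "j < k" "e = \<epsilon> j" using all by blast
        have "j = i \<or> j = cyc_pred k i" using e(2) j endsf[OF i j(1)] by simp
        moreover have "j \<in> B" using j e(1) by (simp add: B_def)
        ultimately have "i \<notin> J0" by (auto simp: J0_def)
        moreover have "f i \<notin> spokes M0" using uniq True IU_cut(2) by (auto simp: spokes_def)
        ultimately show ?thesis by simp
      next
        case False
        hence "e \<in> cutE U" using IU_or_cut[OF eE fi(1) e(2)] by simp
        hence 1: "f i \<in> spokes M0" using fi(1) e by (auto simp: spokes_def)
        have "j \<notin> B" if "j = i \<or> j = cyc_pred k i" for j
        proof
          assume "j \<in> B"
          hence j: "j < k" "\<epsilon> j \<in> M0" by (auto simp: B_def)
          hence "\<epsilon> j = e" using uniq endsf[OF i j(1)] that by simp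
          thus False using False \<epsilon> j(1) by auto
        qed
        hence "i \<in> J0" using i by (simp add: J0_def)
        thus ?thesis using 1 by simp
      qed
    qed
    moreover have "spokes M0 \<subseteq> f ` {..<k}" unfolding fU by (auto simp: spokes_def)
    moreover have "J0 \<subseteq> {..<k}" by (auto simp: J0_def)
    ultimately show ?thesis by blast
  qed
  have J0k: "J0 \<subseteq> {..<k}" and finJ: "finite J0" by (auto simp: J0_def)
  define l where "l = card J0"
  \<comment> \<open>The crossing positions are listed in increasing order, so parity conditions on
    positions can be translated into conditions on indices below \<open>l\<close>.\<close>
  define h where "h t = sorted_list_of_set J0 ! t" for t
  have len: "length (sorted_list_of_set J0) = l" using finJ by (simp add: l_def)
  have hmono: "h s < h t" if "s < t" "t < l" for s t
    unfolding h_def using strict_sorted_list_of_set[of J0] that len by (simp add: sorted_wrt_nth_less)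
  have hJ: "h t \<in> J0" if "t < l" for t
    using nth_mem[of t "sorted_list_of_set J0"] that len finJ by (simp add: h_def)
  have hle: "h s \<le> h t \<longleftrightarrow> s \<le> t" if "s < l" "t < l" for s t
    using hmono[of s t] hmono[of t s] that by (cases s t rule: linorder_cases) auto
  have hinj: "inj_on h {..<l}" using hle by (intro inj_onI) (metis lessThan_iff order_antisym order_refl)
  have himg: "h ` {..<l} = J0"
    by (rule card_subset_eq[OF finJ]) (use hJ card_image[OF hinj] in \<open>auto simp: l_def\<close>)
  have hrank: "rank (h ` R) (h r) = rank R r" if R: "R \<subseteq> {..<l}" "r \<in> R" for R r
  proof -
    have "h s \<le> h r \<longleftrightarrow> s \<le> r" if "s \<in> R" for s
      by (rule hle) (use R that in auto)
    hence "h ` R \<inter> {..h r} = h ` (R \<inter> {..r})" by blast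
    moreover have "inj_on h (R \<inter> {..r})" using hinj by (rule inj_on_subset) (use R in blast)
    ultimately show ?thesis by (simp add: rank_def card_image)
  qed
  define g where "g t = f (h t)" for t
  have hk: "h t < k" if "t < l" for t using hJ[OF that] J0k by blast
  have ginj: "inj_on g {..<l}"
    using hinj hk inj unfolding g_def inj_on_def by blast
  have gU: "g ` R \<subseteq> U" if "R \<subseteq> {..<l}" for R using that hk fU by (auto simp: g_def)
  have gJ0: "g ` {..<l} = spokes M0" unfolding sp0 himg[symmetric] by (simp add: g_def image_image)
  have cl: "card (M0 \<inter> cutE U) = l"
    using card_spokes[OF M0(1)] card_image[OF ginj] gJ0 by simp
  have lodd: "odd l" using pm_cut_odd[OF M0(1) U_odds(2,3)] cl by simp
  have l1: "l \<noteq> 1" using M0(2) pm_C(3)[OF M0(1), of U] cl by auto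
  \<comment> \<open>Membership in \<open>I\<close> concerns the outer matching alone. Whether the
    remaining vertices of \<open>U\<close> can be matched along the cycle is settled in
    \<open>realize\<close>.\<close>
  define I where "I = {R. R \<subseteq> {..<l} \<and> (\<exists>N. N \<subseteq> E - IU \<and> matching ends N \<and> covered ends N = (V - U) \<union> g ` R)}"
  have exch: "\<exists>b\<in>symd R S. b \<noteq> a \<and> symd R {a, b} \<in> I \<and> symd S {a, b} \<in> I"
    if R: "R \<in> I" and S: "S \<in> I" and a: "a \<in> R" "a \<notin> S" for R S a
  proof -
    obtain N1 where N1: "N1 \<subseteq> E - IU" "matching ends N1" "covered ends N1 = (V - U) \<union> g ` R"
      using R unfolding I_def by blast
    obtain N2 where N2: "N2 \<subseteq> E - IU" "matching ends N2" "covered ends N2 = (V - U) \<union> g ` S"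
      using S unfolding I_def by blast
    have RS: "R \<subseteq> {..<l}" "S \<subseteq> {..<l}" using R S by (auto simp: I_def)
    have W: "(V - U) \<inter> g ` X = {}" if "X \<subseteq> {..<l}" for X using gU[OF that] by blast
    have fin: "finite N1" by (rule finite_subset[OF N1(1)]) simp
    have "g a \<in> covered ends N1" using N1(3) a(1) by simp
    moreover have "g a \<notin> covered ends N2"
    proof -
      have "a \<in> {..<l}" using a(1) RS(1) by blast
      hence "g a \<notin> g ` S" using a(2) inj_on_image_mem_iff[OF ginj _ RS(2)] by blast
      moreover have "g a \<in> U" using gU[OF RS(1)] a(1) by blast
      ultimately show ?thesis using N2(3) by blast
    qed
    ultimately obtain M1 M2 b' where M: "matching ends M1" "matching ends M2" "M1 \<union> M2 \<subseteq> N1 \<union> N2" "b' \<noteq> g a"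
      "b' \<in> symd (covered ends N1) (covered ends N2)"
      "covered ends M1 = symd (covered ends N1) {g a, b'}" "covered ends M2 = symd (covered ends N2) {g a, b'}"
      using matching_exchange[OF fin N1(2) N2(2)] by metis
    have "symd (covered ends N1) (covered ends N2) = g ` symd R S"
      unfolding N1(3) N2(3) symd_Un(1)[OF W[OF RS(1)] W[OF RS(2)]] by (rule symd_image[OF ginj RS])
    then obtain b where b: "b \<in> symd R S" "b' = g b" using M(5) by auto
    have bl: "{a, b} \<subseteq> {..<l}" using b(1) RS a(1) by (auto simp: symd_def)
    have img: "symd ((V - U) \<union> g ` X) {g a, b'} = (V - U) \<union> g ` symd X {a, b}" if X: "X \<subseteq> {..<l}" for X
    proof -
      have "{g a, b'} = g ` {a, b}" using b(2) by simp
      thus ?thesis using symd_Un(2)[OF W[OF X] W[OF bl]] symd_image[OF ginj X bl] by simp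
    qed
    have sub: "symd X {a, b} \<subseteq> {..<l}" if "X \<subseteq> {..<l}" for X using that bl by (auto simp: symd_def)
    have "symd R {a, b} \<in> I"
      unfolding I_def using M(1,3,6) N1(1) N2(1) img[OF RS(1)] sub[OF RS(1)] unfolding N1(3)
      by (intro CollectI conjI exI[of _ M1]) auto
    moreover have "symd S {a, b} \<in> I"
      unfolding I_def using M(2,3,7) N1(1) N2(1) img[OF RS(2)] sub[OF RS(2)] unfolding N2(3)
      by (intro CollectI conjI exI[of _ M2]) auto
    moreover have "b \<noteq> a" using M(4) b(2) by blast
    ultimately show ?thesis using b(1) by blast
  qed
  have exch': "\<exists>b\<in>symd R S. b \<noteq> a \<and> symd R {a, b} \<in> I \<and> symd S {a, b} \<in> I"
    if "R \<in> I" "S \<in> I" "a \<in> symd R S" for R S a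
    using that exch[of R S a] exch[of S R a] symd_commute[of R S] by (auto simp: symd_def[of R S])
  have full: "{..<l} \<in> I"
    unfolding I_def using outside_covered[OF M0(1)] gJ0 pms_subset[OF M0(1)]
    by (intro CollectI conjI exI[of _ "M0 - IU"]) auto
  \<comment> \<open>The edge by which \<open>M0\<close> leaves \<open>U\<close> at
    \<open>g i\<close> lies in some perfect matching that crosses the tight cut of \<open>U\<close>
    only there.\<close>
  have single: "{i} \<in> I" if i: "i < l" for i
  proof -
    have "g i \<in> spokes M0" using i gJ0 by blast
    then obtain e where e: "e \<in> M0" "e \<in> cutE U" "g i \<in> ends e" "g i \<in> U" by (auto simp: spokes_def)
    have eE: "e \<in> E" using e(2) cut_subset by blast
    obtain M where M: "M \<in> PM" "e \<in> M" "\<forall>X. Inr X \<in> tight x1 \<longrightarrow> card (M \<inter> cutE X) = 1"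
      by (rule tight_pm_edge[OF x1_C eE x1_pos[OF eE]])
    have "card (spokes M) = 1" using card_spokes[OF M(1)] M(3) U by simp
    then obtain u where u: "spokes M = {u}" by (rule card_1_singletonE)
    have "g i \<in> spokes M" using e M(2) by (auto simp: spokes_def)
    hence "spokes M = g ` {i}" using u by simp
    thus ?thesis unfolding I_def using outside_covered[OF M(1)] pms_subset[OF M(1)] i
      by (intro CollectI conjI exI[of _ "M - IU"]) auto
  qed
  have realize: "\<exists>M\<in>PM. card (M \<inter> cutE U) = card R"
    if R: "R \<in> I" "odd (card R)" and alt: "\<And>r. r \<in> R \<Longrightarrow> odd (r + rank R r + p)" for R p
  proof -
    have Rl: "R \<subseteq> {..<l}" using R(1) by (simp add: I_def)
    obtain N where N: "N \<subseteq> E - IU" "matching ends N" "covered ends N = (V - U) \<union> g ` R"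
      using R(1) unfolding I_def by blast
    define J where "J = h ` R"
    \<comment> \<open>The position \<open>h r\<close> has the parity of \<open>r + 1 + q\<close>,
      because it has rank \<open>r + 1\<close> in \<open>J0\<close>; this shift turns the condition
      on indices into one on positions.\<close>
    define p' where "p' = p + q + 1"
    have cJ: "card J = card R" unfolding J_def using inj_on_subset[OF hinj Rl] by (rule card_image)
    have Jk: "J \<subseteq> {..<k}" using Rl hk by (auto simp: J_def)
    have gR: "g ` R = f ` J" by (simp add: g_def J_def image_image)
    have altJ: "odd (i + rank J i + p')" if i: "i \<in> J" for i
    proof -
      obtain r where r: "r \<in> R" "i = h r" using i by (auto simp: J_def)
      have rl: "r < l" using r(1) Rl by blast
      have "rank J0 (h r) = rank {..<l} r" using hrank[of "{..<l}" r] rl himg by simp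
      also have "\<dots> = Suc r"
      proof -
        have "{..<l} \<inter> {..r} = {..r}" using rl by auto
        thus ?thesis by (simp add: rank_def)
      qed
      finally have "even (h r + Suc r + q)" using q[OF hJ[OF rl]] by simp
      moreover have "rank J i = rank R r" unfolding J_def r(2) by (rule hrank[OF Rl r(1)])
      ultimately show ?thesis using alt[OF r(1)] r(2) by (auto simp: p'_def)
    qed
    have oJ: "odd (card J)" using cJ R(2) by simp
    have AM: "i \<in> J \<Longrightarrow> odd (i + rank J i + p') \<and> odd (cyc_pred k i + rank J (cyc_pred k i) + p')"
      "i \<notin> J \<Longrightarrow> even (i + rank J i + p') \<noteq> even (cyc_pred k i + rank J (cyc_pred k i) + p')"
      if "i < k" for i
      using alternating_matching[OF Jk oJ k(1) _ that, of p'] altJ by blast+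
    \<comment> \<open>The cycle edges selected by the parity rule of
      \<open>alternating_matching\<close>.\<close>
    define Q where "Q = \<epsilon> ` {i. i < k \<and> even (i + rank J i + p')}"
    have QI: "Q \<subseteq> IU" using \<epsilon> by (auto simp: Q_def)
    have inQ: "\<epsilon> i \<in> Q \<longleftrightarrow> even (i + rank J i + p')" if "i < k" for i
      using that \<epsilon>inj by (auto simp: Q_def)
    have at: "e = \<epsilon> i \<or> e = \<epsilon> (cyc_pred k i)" if ie: "i < k" "e \<in> IU" "f i \<in> ends e" for e i
    proof -
      obtain j where j: "j < k" "e = \<epsilon> j" using all ie(2) by blast
      show ?thesis using ie(3) endsf[OF ie(1) j(1)] j(2) by auto
    qed
    have covQ: "f i \<in> covered ends Q \<longleftrightarrow> i \<notin> J" if i: "i < k" for i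
    proof -
      have "f i \<in> covered ends Q \<longleftrightarrow> \<epsilon> i \<in> Q \<or> \<epsilon> (cyc_pred k i) \<in> Q"
      proof
        assume "f i \<in> covered ends Q"
        then obtain e where e: "e \<in> Q" "f i \<in> ends e" by (rule UN_E)
        have "e \<in> IU" using QI e(1) by (rule subsetD)
        thus "\<epsilon> i \<in> Q \<or> \<epsilon> (cyc_pred k i) \<in> Q" using at[OF i _ e(2)] e(1) by auto
      next
        have "f i \<in> ends (\<epsilon> i)" "f i \<in> ends (\<epsilon> (cyc_pred k i))"
          using endsf[OF i i] endsf[OF i prd(1)[OF i]] by simp_all
        thus "\<epsilon> i \<in> Q \<or> \<epsilon> (cyc_pred k i) \<in> Q \<Longrightarrow> f i \<in> covered ends Q" by (meson UN_I)
      qed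
      also have "\<dots> \<longleftrightarrow> i \<notin> J"
        unfolding inQ[OF i] inQ[OF prd(1)[OF i]] using AM[OF i] by blast
      finally show ?thesis .
    qed
    have "matching ends Q"
      unfolding matching_def
    proof (intro conjI ballI impI)
      fix e assume "e \<in> Q"
      hence "e \<in> E" using QI inner_subset by blast
      thus "card (ends e) = 2" using graph by (simp add: graph_def)
    next
      fix e e' assume ee: "e \<in> Q" "e' \<in> Q" "e \<noteq> e'"
      show "ends e \<inter> ends e' = {}"
      proof (rule ccontr)
        assume "ends e \<inter> ends e' \<noteq> {}"
        then obtain v where v: "v \<in> ends e" "v \<in> ends e'" by blast
        have IUs: "e \<in> IU" "e' \<in> IU" using ee QI by blast+
        hence "v \<in> U" using v by (auto simp: inner_def)
        then obtain i where i: "i < k" "v = f i" using fU by blast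
        have "e = \<epsilon> i \<or> e = \<epsilon> (cyc_pred k i)" "e' = \<epsilon> i \<or> e' = \<epsilon> (cyc_pred k i)"
          using at[OF i(1)] IUs v i(2) by blast+
        hence "\<epsilon> i \<in> Q" "\<epsilon> (cyc_pred k i) \<in> Q" using ee by auto
        thus False unfolding inQ[OF i(1)] inQ[OF prd(1)[OF i(1)]]
          using AM[OF i(1)] by blast
      qed
    qed
    moreover have "covered ends Q = U - g ` R"
    proof -
      have sub: "covered ends Q \<subseteq> U" using QI by (auto simp: inner_def)
      have mem: "f i \<in> f ` J \<longleftrightarrow> i \<in> J" if "i < k" for i
        using that Jk inj by blast
      have "v \<in> covered ends Q \<longleftrightarrow> v \<notin> f ` J" if v: "v \<in> U" for v
      proof -
        obtain i where i: "i < k" "v = f i" using v fU by blast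
        show ?thesis unfolding i(2) covQ[OF i(1)] mem[OF i(1)] ..
      qed
      thus ?thesis unfolding gR using sub by blast
    qed
    ultimately have "N \<union> Q \<in> PM" "card ((N \<union> Q) \<inter> cutE U) = card (g ` R)"
      using combine_matchings[OF N gU[OF Rl] QI] by blast+
    moreover have "card (g ` R) = card R" using inj_on_subset[OF ginj Rl] by (rule card_image)
    ultimately show ?thesis by metis
  qed
  show ?thesis
  proof (cases "l \<ge> 7")
    case False
    hence "l = 3 \<or> l = 5" using lodd l1 by presburger
    thus ?thesis using that M0(1) cl by blast
  next
    case True
    have "(\<exists>a b c. a < b \<and> b < c \<and> c < l \<and> odd (a + b) \<and> odd (b + c) \<and> {a, b, c} \<in> I) \<or>
      (\<exists>a b c d e. a < b \<and> b < c \<and> c < d \<and> d < e \<and> e < l \<and> odd (a + b) \<and> odd (b + c) \<and>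
        odd (c + d) \<and> odd (d + e) \<and> {a, b, c, d, e} \<in> I)"
      by (rule alternating_exchange) (use exch' single full lodd True in auto)
    hence "\<exists>R\<in>I. (card R = 3 \<or> card R = 5) \<and> (\<exists>p. \<forall>r\<in>R. odd (r + rank R r + p))"
    proof (elim disjE exE conjE)
      fix a b c assume abc: "a < b" "b < c" "c < l" "odd (a + b)" "odd (b + c)" "{a, b, c} \<in> I"
      have "{a, b, c} \<inter> {..a} = {a}" "{a, b, c} \<inter> {..b} = {a, b}" "{a, b, c} \<inter> {..c} = {a, b, c}"
        using abc(1,2) by auto
      hence "rank {a, b, c} a = 1" "rank {a, b, c} b = 2" "rank {a, b, c} c = 3"
        using abc(1,2) by (simp_all add: rank_def)
      hence "\<forall>r\<in>{a, b, c}. odd (r + rank {a, b, c} r + a)" using abc(4,5) by auto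
      moreover have "card {a, b, c} = 3" using abc(1,2) by simp
      ultimately show ?thesis using abc(6) by blast
    next
      fix a b c d e assume s: "a < b" "b < c" "c < d" "d < e" "e < l" "odd (a + b)" "odd (b + c)"
        "odd (c + d)" "odd (d + e)" "{a, b, c, d, e} \<in> I"
      let ?R = "{a, b, c, d, e}"
      have "?R \<inter> {..a} = {a}" "?R \<inter> {..b} = {a, b}" "?R \<inter> {..c} = {a, b, c}" "?R \<inter> {..d} = {a, b, c, d}"
        "?R \<inter> {..e} = ?R" using s(1-4) by auto
      hence "rank ?R a = 1" "rank ?R b = 2" "rank ?R c = 3" "rank ?R d = 4" "rank ?R e = 5"
        using s(1-4) by (simp_all add: rank_def)
      hence "\<forall>r\<in>?R. odd (r + rank ?R r + a)" using s(6-9) by auto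
      moreover have "card ?R = 5" using s(1-4) by simp
      ultimately show ?thesis using s(10) by blast
    qed
    then obtain R p where R: "R \<in> I" "card R = 3 \<or> card R = 5" "\<And>r. r \<in> R \<Longrightarrow> odd (r + rank R r + p)" by blast
    have "odd (card R)" using R(2) by auto
    then obtain M where "M \<in> PM" "card (M \<inter> cutE U) = card R"
      using realize[OF R(1) _ R(3)] by blast
    thus ?thesis using that R(2) by auto
  qed
qed

end

section \<open>Interior points lie in the dyadic cone\<close>

context interior
begin

lemma x_in_dcone: "x \<in> dcone V E ends"
proof (rule ccontr)
  assume no: "x \<notin> dcone V E ends"
  have noedge: "Inl e \<notin> tight y" if "facet y" for y e using facet_edge[OF that] no by blast
  obtain w where w: "w \<in> C" "tight w \<noteq> {}" "vdeg w > 0" by (rule boundary_exists)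
  obtain y where y: "facet y" "tight y \<subseteq> tight w" by (rule facet_below[OF w(1,2)])
  have "tight y \<noteq> {}" using y(1) by (simp add: facet_def)
  then obtain k where k: "k \<in> tight y" by blast
  then obtain X where "Inr X \<in> tight y" using noedge[OF y(1)] by (cases k) auto
  hence "X \<in> facet_sets" using y(1) unfolding facet_sets_def by blast
  then obtain U where U: "U \<in> facet_sets" and min: "\<And>W. W \<in> facet_sets \<Longrightarrow> card U \<le> card W"
    using ex_has_least_nat[of "\<lambda>X. X \<in> facet_sets" X card] by blast
  obtain x1 where x1: "facet x1" "Inr U \<in> tight x1" using U unfolding facet_sets_def by blast
  interpret rf: rigid_facet V E ends x x1 U
  proof
    show "z e = 0" if "\<And>e. e \<notin> innerE U \<Longrightarrow> z e = 0" "\<And>v. v \<in> V \<Longrightarrow> sum z (cutE {v}) = 0"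
      for z :: "'e \<Rightarrow> rat" and e
      using smallest_facet_set_kernel[OF noedge x1 min, of z e] that by blast
  qed (use noedge x1 min in blast)+
  obtain M where M: "M \<in> PM" "card (M \<inter> cutE U) \<in> {3, 5}" by (rule rf.small_crossing_pm)
  have "slack (Inr U) (ind M) \<in> {1, 2, 4}" using M pm_C(3)[OF M(1), of U] by auto
  thus False using facet_unit[OF x1 M(1)] no by blast
qed

end

subsection \<open>The induction\<close>

context mgraph
begin

lemma delete_zero_edge:
  assumes x: "x \<in> mcone V E ends" and e: "e \<in> E" "x e = 0"
  shows "x \<in> mcone V (E - {e}) ends"
proof -
  have "cut (E - {e}) ends X = cut E ends X - {e}" for X by (auto simp: cut_def)
  hence "sum x (cut (E - {e}) ends X) = sum x (cut E ends X)" for X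
    using e(2) by (simp add: sum_diff1)
  thus ?thesis using x e(2) unfolding mcone_def by auto
qed

text \<open>Besides the ends of \<open>e\<close> at most two vertices remain. Their set has the same
  cut and the same degree sum as the ends of \<open>e\<close>, hence the same positive inner weight,
  so an edge joins them.\<close>

lemma small_pm_exists:
  assumes V: "even (card V)" "card V < 6" and x: "x \<in> mcone V E ends"
    and pos: "\<And>e. e \<in> E \<Longrightarrow> x e > 0" and e: "e \<in> E"
  obtains M where "M \<in> pms V E ends" "e \<in> M"
proof -
  obtain r where deg: "\<forall>v\<in>V. sum x (cut E ends {v}) = r"
    using x unfolding mcone_def by blast
  obtain a b where ab: "ends e = {a, b}" "a \<noteq> b" "a \<in> V" "b \<in> V" using e by (rule edgeE)
  define R where "R = V - {a, b}"
  have RV: "R \<subseteq> V" by (auto simp: R_def)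
  have cR: "card R + 2 = card V"
    using card_Diff_subset[of "{a, b}" V] card_mono[of V "{a, b}"] ab by (simp add: R_def)
  have ce: "card (ends e) = 2" using ab by simp
  show ?thesis
  proof (cases "R = {}")
    case True
    have "{e} \<in> pms V E ends"
      using e ce ab True by (intro matching_pm) (auto simp: matching_def R_def)
    thus ?thesis using that by blast
  next
    case False
    have "finite R" by (rule finite_subset_V[OF RV])
    hence "card R \<noteq> 0" using False by simp
    hence "card R = 2" using cR V by presburger
    then obtain c d where cd: "R = {c, d}" "c \<noteq> d" by (auto simp: card_2_iff)
    have "2 * r = sum x (cut E ends {a, b}) + 2 * sum x (inner E ends {a, b})"
      using sum_degrees[of "{a, b}" x] deg ab by simp
    moreover have "2 * r = sum x (cut E ends R) + 2 * sum x (inner E ends R)"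
      using sum_degrees[OF RV, of x] deg RV cd by simp
    moreover have "cut E ends R = cut E ends {a, b}" unfolding R_def by (rule cut_compl)
    ultimately have "sum x (inner E ends R) = sum x (inner E ends {a, b})" by simp
    moreover have "x e \<le> sum x (inner E ends {a, b})"
      by (rule member_le_sum) (use e ab pos inner_subset in \<open>auto simp: inner_def less_imp_le\<close>)
    ultimately have "sum x (inner E ends R) > 0" using pos[OF e] by simp
    then obtain f where f: "f \<in> inner E ends R" using sum_pos_exists by blast
    have fE: "f \<in> E" and "ends f \<subseteq> R" using f by (auto simp: inner_def)
    moreover have cf: "card (ends f) = 2" using fE graph by (simp add: graph_def)
    ultimately have ef: "ends f = R" using cd by (intro card_subset_eq) auto
    have "{e, f} \<in> pms V E ends"
    proof (rule matching_pm)
      show "matching ends {e, f}" unfolding matching_def using ce cf ef ab(1) by (auto simp: R_def)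
      show "covered ends {e, f} = V" using ef ab by (auto simp: R_def)
    qed (use e fE in simp)
    thus ?thesis using that by blast
  qed
qed

text \<open>With at most four vertices, every odd set is a singleton or the complement of one, so
  its cut is a vertex degree.\<close>

lemma small_odd_sets:
  assumes V: "card V < 6" and X: "X \<subseteq> V" "odd (card X)" and y: "\<forall>v\<in>V. sum y (cut E ends {v}) = (r :: rat)"
    and even: "even (card V)"
  shows "sum y (cut E ends X) = r"
proof -
  have c: "card (V - X) + card X = card V" by (rule card_compl[OF X(1)])
  have "card X = 1 \<or> card (V - X) = 1" using c V X(2) even by presburger
  thus ?thesis
  proof
    assume "card X = 1"
    then obtain v where "X = {v}" by (rule card_1_singletonE)
    thus ?thesis using y X(1) by simp
  next
    assume "card (V - X) = 1"
    then obtain v where v: "V - X = {v}" by (rule card_1_singletonE)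
    hence "v \<in> V" by blast
    hence "sum y (cut E ends {v}) = r" using y by blast
    moreover have "cut E ends {v} = cut E ends X" unfolding v[symmetric] by (rule cut_compl)
    ultimately show ?thesis by simp
  qed
qed

end

lemma mcone_subset_dcone:
  fixes V :: "'v set" and E :: "'e set"
  assumes "graph V E ends" "even (card V)" "x \<in> mcone V E ends" "\<And>e. qdyadic (x e)"
  shows "x \<in> dcone V E ends"
  using assms
proof (induction "card V + card E" arbitrary: V E ends x rule: less_induct)
  case less
  interpret mgraph V E ends by unfold_locales (rule less.prems(1))
  have edge_step: "y \<in> dcone V E ends"
    if y: "y \<in> mcone V E ends" "\<And>e. qdyadic (y e)" and e: "e \<in> E" "y e = 0" for y e
  proof -
    have "card (E - {e}) < card E" using e(1) by (intro card_Diff1_less) simp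
    moreover have "graph V (E - {e}) ends" using graph by (auto simp: graph_def)
    ultimately have "y \<in> dcone V (E - {e}) ends"
      using less.hyps[of V "E - {e}" ends y] less.prems(2) delete_zero_edge[OF y(1) e] y(2) by simp
    thus ?thesis using dcone_mono[of E "E - {e}" V ends] by auto
  qed
  \<comment> \<open>Contraction replaces at least three vertices by one and so decreases the
    induction measure; as \<open>X\<close> is odd, the number of vertices stays even.\<close>
  have side: "(\<lambda>e. if e \<in> E - inner E ends X then y e else 0)
      \<in> dcone (insert u (V - X)) (E - inner E ends X) (contract_ends X u ends)"
    if y: "y \<in> mcone V E ends" "\<And>e. qdyadic (y e)"
      and X: "X \<subseteq> V" "odd (card X)" "3 \<le> card X" "u \<in> X"
      and tight: "\<And>v. v \<in> V \<Longrightarrow> sum y (cut E ends X) = sum y (cut E ends {v})" for y X u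
  proof -
    have c: "card (V - X) + card X = card V" by (rule card_compl[OF X(1)])
    have cu: "card (insert u (V - X)) = Suc (card (V - X))" using X(4) by simp
    have "card (E - inner E ends X) \<le> card E" by (intro card_mono) auto
    hence "card (insert u (V - X)) + card (E - inner E ends X) < card V + card E" using c cu X(3) by simp
    moreover have "even (card (insert u (V - X)))" using c cu X(2) less.prems(2) by presburger
    ultimately show ?thesis
      using contract_graph[OF X(1,4)] contract_mcone[OF X(1,4,2) y(1) tight] y(2)
      by (intro less.hyps) auto
  qed
  have cut_step: "y \<in> dcone V E ends"
    if y: "y \<in> mcone V E ends" "\<And>e. qdyadic (y e)"
      and X: "X \<subseteq> V" "odd (card X)" "3 \<le> card X" "card X + 3 \<le> card V"
      and tight: "\<And>v. v \<in> V \<Longrightarrow> sum y (cut E ends X) = sum y (cut E ends {v})" for y X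
  proof -
    have c: "card (V - X) + card X = card V" by (rule card_compl[OF X(1)])
    have "X \<noteq> {}" "V - X \<noteq> {}" using X c by fastforce+
    then obtain u w where u: "u \<in> X" and w: "w \<in> V - X" by blast
    have 1: "V - X \<subseteq> V" "odd (card (V - X))" "3 \<le> card (V - X)"
    proof -
      show "odd (card (V - X))" using c X(2) less.prems(2) by presburger
      show "3 \<le> card (V - X)" using c X(4) by simp
    qed blast
    have tight': "sum y (cut E ends (V - X)) = sum y (cut E ends {v})" if "v \<in> V" for v
      unfolding cut_compl by (rule tight[OF that])
    have zero: "\<forall>e. e \<notin> E \<longrightarrow> y e = 0" using y(1) by (simp add: mcone_def)
    show ?thesis
      by (rule glue_dcone[OF X(1) u w zero side[OF y X(1-3) u tight] side[OF y 1 w tight']])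
  qed
  show ?case
  proof (cases "\<exists>e\<in>E. x e = 0")
    case True
    thus ?thesis using edge_step[OF less.prems(3,4)] by blast
  next
    case False
    have xm: "\<forall>e. x e \<ge> 0" "\<forall>e. e \<notin> E \<longrightarrow> x e = 0" using less.prems(3) by (auto simp: mcone_def)
    have pos: "x e > 0" if "e \<in> E" for e using False xm(1) that by (auto simp: less_le)
    show ?thesis
    proof (cases "card V \<ge> 6")
      case small: False
      show ?thesis
      proof (cases "E = {}")
        case True
        hence "x = (\<lambda>_. 0)" using xm(2) by auto
        thus ?thesis using dcone_0 by simp
      next
        case ne: False
        obtain r where deg: "\<forall>v\<in>V. sum x (cut E ends {v}) = r"
          using less.prems(3) unfolding mcone_def by blast
        obtain e where e: "e \<in> E" using ne by blast
        have sm: "card V < 6" using small by simp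
        obtain M where M: "M \<in> pms V E ends" "e \<in> M"
          by (rule small_pm_exists[OF less.prems(2) sm less.prems(3) pos e])
        have finM: "finite M" by (rule finite_pm[OF M(1)])
        \<comment> \<open>Subtracting \<open>t\<close> times the matching makes an edge of weight
          \<open>t\<close> vanish, and no odd cut inequality can fail because all odd cuts are
          vertex degrees here.\<close>
        define t where "t = Min (x ` M)"
        have "t \<in> x ` M" unfolding t_def using finM M(2) by (intro Min_in) auto
        then obtain e0 where e0: "e0 \<in> M" "t = x e0" by blast
        have tle: "t \<le> x f" if "f \<in> M" for f unfolding t_def using finM that by simp
        have e0E: "e0 \<in> E" using e0(1) pms_subset[OF M(1)] by blast
        have t: "t > 0" "qdyadic t" using e0 pos[OF e0E] less.prems(4) by auto
        define y where "y f = 1 * x f + (- t) * ind M f" for f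
        have y0: "\<forall>f. y f \<ge> 0" using xm(1) tle by (auto simp: y_def ind_def)
        have degy: "\<forall>v\<in>V. sum y (cut E ends {v}) = r - t"
        proof
          fix v assume v: "v \<in> V"
          have "sum y (cut E ends {v}) = sum x (cut E ends {v}) - t * sum (ind M) (cut E ends {v})"
            by (simp add: y_def sum_subtractf sum_distrib_left)
          thus "sum y (cut E ends {v}) = r - t" using deg v pm_degree[OF M(1) v] by (simp add: sum_ind)
        qed
        have "y \<in> mcone V E ends"
          unfolding mcone_def
        proof (intro CollectI conjI exI[of _ "r - t"])
          show "\<forall>f. f \<notin> E \<longrightarrow> y f = 0" using xm(2) pms_subset[OF M(1)] by (auto simp: y_def ind_def)
          show "\<forall>X\<subseteq>V. odd (card X) \<longrightarrow> r - t \<le> sum y (cut E ends X)"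
            using small_odd_sets[OF sm _ _ degy less.prems(2)] by simp
        qed (use y0 degy in auto)
        moreover have "qdyadic (y f)" for f
          unfolding y_def using t(2) less.prems(4)
          by (intro qdyadic_add qdyadic_mult qdyadic_uminus) (auto simp: ind_def)
        moreover have "y e0 = 0" using e0 by (simp add: y_def ind_def)
        ultimately have "y \<in> dcone V E ends" using edge_step e0E by blast
        hence "(\<lambda>f. 1 * y f + t * ind M f) \<in> dcone V E ends"
          using ind_in_dcone[OF finite_E M(1)] t by (intro dcone_comb) auto
        thus ?thesis by (simp add: y_def)
      qed
    next
      case big: True
      show ?thesis
      proof (cases "\<exists>X. X \<subseteq> V \<and> odd (card X) \<and> 3 \<le> card X \<and> card X + 3 \<le> card V \<and>
          (\<forall>v\<in>V. sum x (cut E ends X) = sum x (cut E ends {v}))")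
        case True
        then obtain X where "X \<subseteq> V" "odd (card X)" "3 \<le> card X" "card X + 3 \<le> card V"
          "\<forall>v\<in>V. sum x (cut E ends X) = sum x (cut E ends {v})" by blast
        thus ?thesis using cut_step[OF less.prems(3,4)] by blast
      next
        case notight: False
        obtain r where deg: "\<forall>v\<in>V. sum x (cut E ends {v}) = r"
          "\<forall>X\<subseteq>V. odd (card X) \<longrightarrow> r \<le> sum x (cut E ends X)"
          using less.prems(3) unfolding mcone_def by blast
        have strict: "sum x (cut E ends {v}) < sum x (cut E ends X)"
          if "X \<subseteq> V" "odd (card X)" "3 \<le> card X" "card X + 3 \<le> card V" "v \<in> V" for X v
        proof -
          have "sum x (cut E ends X) \<noteq> r" using notight that(1-4) deg(1) by auto
          thus ?thesis using deg that by (simp add: less_le)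
        qed
        interpret interior V E ends x
        proof
          show "y \<in> dcone V E ends" if "y \<in> mcone V E ends" "\<And>e. qdyadic (y e)" "e \<in> E" "y e = 0" for y e
            using edge_step that by blast
          show "y \<in> dcone V E ends" if "y \<in> mcone V E ends" "\<And>e. qdyadic (y e)" "X \<subseteq> V" "odd (card X)"
            "3 \<le> card X" "card X + 3 \<le> card V"
            "\<And>v. v \<in> V \<Longrightarrow> sum y (cut E ends X) = sum y (cut E ends {v})" for y X
            using cut_step[OF that] .
        qed (use less.prems big pos strict in auto)
        show ?thesis by (rule x_in_dcone)
      qed
    qed
  qed
qed

section \<open>From rational to real vectors\<close>

lemma dyadic_of_rat: "qdyadic q \<Longrightarrow> dyadic (of_rat q)"
proof -
  assume "qdyadic q"
  then obtain a k where q: "q = of_int a / 2 ^ k" unfolding qdyadic_def by blast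
  have "(of_rat q :: real) = of_int a / 2 ^ k" unfolding q by (simp add: of_rat_divide of_rat_power)
  thus ?thesis unfolding dyadic_def by blast
qed

lemma incidence_vector_ind: "incidence_vector M e = of_rat (ind M e)"
  by (simp add: incidence_vector_def ind_def)

lemma incidence_vector_support: "{e. incidence_vector M e \<noteq> 0} = M"
  by (auto simp: incidence_vector_def)

theorem theorem1p10:
  fixes V :: "'v set" and E :: "'e set" and ends :: "'e \<Rightarrow> 'v set"
  assumes "graph V E ends"
    and "even (card V)"
  shows "dyadic_generating_set (perfect_matching_vectors V E ends)"
proof -
  interpret mgraph V E ends by unfold_locales (rule assms(1))
  let ?P = "pms V E ends" and ?S = "perfect_matching_vectors V E ends"
  have S: "?S = incidence_vector ` ?P"
    by (auto simp: perfect_matching_vectors_def pms_def)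
  have inj: "inj_on incidence_vector ?P"
    by (rule inj_onI) (metis incidence_vector_support)
  have sumS: "(\<Sum>s\<in>?S. c s * s e) = (\<Sum>M\<in>?P. c (incidence_vector M) * of_rat (ind M e))"
    for c :: "('e \<Rightarrow> real) \<Rightarrow> real" and e
    unfolding S sum.reindex[OF inj] by (simp add: incidence_vector_ind)
  have "\<exists>c. (\<forall>s\<in>?S. c s \<ge> 0 \<and> dyadic (c s)) \<and> x = (\<lambda>e. \<Sum>s\<in>?S. c s * s e)"
    if int: "integral_vec x" and hull: "x \<in> conic_hull_fin ?S" for x
  proof -
    obtain c where c: "\<forall>s\<in>?S. c s \<ge> 0" "x = (\<lambda>e. \<Sum>s\<in>?S. c s * s e)"
      using hull unfolding conic_hull_fin_def by blast
    define d where "d M = c (incidence_vector M)" for M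
    have d0: "d M \<ge> 0" if "M \<in> ?P" for M using c(1) that by (simp add: d_def S)
    have xe: "x e = (\<Sum>M\<in>?P. d M * of_rat (ind M e))" for e unfolding c(2) sumS d_def ..
    \<comment> \<open>As \<open>x\<close> is integral, the floor merely converts it to a rational
      vector.\<close>
    define y :: "'e \<Rightarrow> rat" where "y e = of_int \<lfloor>x e\<rfloor>" for e
    have yx: "of_rat (y e) = x e" for e
    proof -
      have "x e \<in> \<int>" using int by (simp add: integral_vec_def)
      then obtain n where "x e = of_int n" by (rule Ints_cases)
      thus ?thesis by (simp add: y_def)
    qed
    \<comment> \<open>The given real coefficients are used to bound cuts: every perfect matching
      meets a vertex cut once and an odd cut at least once, so \<open>y\<close> satisfies Edmonds'
      inequalities.\<close>
    have xsum: "of_rat (sum y A) = (\<Sum>M\<in>?P. d M * of_nat (card (M \<inter> A)))" if A: "finite A" for A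
    proof -
      have "(of_rat (sum y A) :: real) = (\<Sum>e\<in>A. \<Sum>M\<in>?P. d M * of_rat (ind M e))"
        by (simp add: of_rat_sum yx xe)
      also have "\<dots> = (\<Sum>M\<in>?P. \<Sum>e\<in>A. d M * of_rat (ind M e))" by (rule sum.swap)
      also have "\<dots> = (\<Sum>M\<in>?P. d M * of_rat (sum (ind M) A))" by (simp add: of_rat_sum sum_distrib_left)
      finally show ?thesis using A by (simp add: sum_ind)
    qed
    have deg: "of_rat (sum y (cut E ends {v})) = (\<Sum>M\<in>?P. d M)" if "v \<in> V" for v
      unfolding xsum[OF finite_cut] by (rule sum.cong) (use pm_degree that in auto)
    have "\<exists>r. (\<forall>v\<in>V. sum y (cut E ends {v}) = r) \<and> (\<forall>X\<subseteq>V. odd (card X) \<longrightarrow> r \<le> sum y (cut E ends X))"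
    proof (cases "V = {}")
      case False
      then obtain v where v: "v \<in> V" by blast
      have "sum y (cut E ends w) = sum y (cut E ends {v})" if "w \<in> (\<lambda>u. {u}) ` V" for w
      proof -
        have "(of_rat (sum y (cut E ends w)) :: real) = of_rat (sum y (cut E ends {v}))"
          using that deg deg[OF v] by auto
        thus ?thesis by simp
      qed
      moreover have "sum y (cut E ends {v}) \<le> sum y (cut E ends X)" if X: "X \<subseteq> V" "odd (card X)" for X
      proof -
        have "(of_rat (sum y (cut E ends {v})) :: real) \<le> of_rat (sum y (cut E ends X))"
          unfolding deg[OF v] unfolding xsum[OF finite_cut]
        proof (rule sum_mono)
          fix M assume M: "M \<in> ?P"
          have "1 \<le> card (M \<inter> cut E ends X)" using odd_pos[OF pm_cut_odd[OF M X]] by simp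
          hence "d M * 1 \<le> d M * of_nat (card (M \<inter> cut E ends X))"
            by (intro mult_left_mono d0 M) simp
          thus "d M \<le> d M * of_nat (card (M \<inter> cut E ends X))" by simp
        qed
        thus ?thesis by (simp add: of_rat_less_eq)
      qed
      ultimately show ?thesis by (intro exI[of _ "sum y (cut E ends {v})"]) blast
    qed auto
    moreover have "y e \<ge> 0" for e
    proof -
      have "x e \<ge> 0" unfolding xe by (intro sum_nonneg mult_nonneg_nonneg d0) (auto simp: ind_def)
      thus ?thesis by (simp add: y_def)
    qed
    moreover have "y e = 0" if "e \<notin> E" for e
    proof -
      have "ind M e = 0" if "M \<in> ?P" for M using pms_subset[OF that] \<open>e \<notin> E\<close> by (auto simp: ind_def)
      hence "x e = 0" unfolding xe by simp
      thus ?thesis by (simp add: y_def)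
    qed
    ultimately have "y \<in> mcone V E ends" unfolding mcone_def by blast
    hence "y \<in> dcone V E ends" using mcone_subset_dcone[OF assms] by (simp add: y_def)
    then obtain a where a: "\<forall>M\<in>?P. a M \<ge> 0 \<and> qdyadic (a M)" "\<forall>e. y e = (\<Sum>M\<in>?P. a M * ind M e)"
      unfolding dcone_def by blast
    \<comment> \<open>A matching is recovered from its incidence vector as the support, which turns
      coefficients of matchings into coefficients of vectors.\<close>
    define b :: "('e \<Rightarrow> real) \<Rightarrow> real" where "b s = of_rat (a {e. s e \<noteq> 0})" for s
    have b: "b (incidence_vector M) = of_rat (a M)" for M
      by (simp add: b_def incidence_vector_support)
    have "x e = (\<Sum>s\<in>?S. b s * s e)" for e
      unfolding sumS b yx[symmetric] a(2)[rule_format, of e] by (simp add: of_rat_sum of_rat_mult)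
    moreover have "\<forall>s\<in>?S. b s \<ge> 0 \<and> dyadic (b s)"
      using a(1) dyadic_of_rat by (auto simp: S b)
    ultimately show ?thesis by (intro exI[of _ b]) auto
  qed
  moreover have "finite ?S" unfolding S by simp
  moreover have "\<forall>s\<in>?S. integral_vec s"
    by (auto simp: S integral_vec_def incidence_vector_def)
  ultimately show ?thesis unfolding dyadic_generating_set_def by blast
qed

end
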